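(* Let $M$ be a connected compact complex manifold of complex dimension $n\ge 2$ and let $G$ be a complex Finsler metric on $M$. Then the volume preserved conformal class $[G]$ contains at most one Kähler Finsler metric.
   Context: Conventions. $T'M$ is the holomorphic tangent bundle of the complex manifold $M$, with local holomorphic coordinates $(z^i;v^i)$ for the vector $v=v^i\partial/\partial z^i$ at $z$; $\tilde M=T'M\setminus\{\mathbf 0\}$ is the slit bundle. The summation convention is used. Write $\partial_i=\partial/\partial z^i$, $\partial_{\bar j}=\partial/\partial\bar z^j$, $\dot\partial_i=\partial/\partial v^i$, $\dot\partial_{\bar j}=\partial/\partial\bar v^j$. A complex Finsler metric on $M$ is a continuous function $G:T'M\to[0,\infty)$ such that (I) $G(z,v)=0$ iff $v=0$; (II) $G$ is $C^\infty$ on $\tilde M$; (III) $G(z,\lambda v)=\lambda\bar\lambda G(z,v)$ for $\lambda\in\mathbb C^*$; (IV) the matrix $(G_{i\bar j})$, $G_{i\bar j}=\dot\partial_i\dot\partial_{\bar j}G$, is positive definite on $\tilde M$. Its inverse $(G^{i\bar k})$ satisfies $G^{i\bar k}G_{j\bar k}=\delta^i_j$. Put $N^i_j=G^{i\bar k}\dot\partial_{\bar k}\partial_jG$, $\delta_i=\partial_i-N^k_i\dot\partial_k$, $\delta v^i=dv^i+N^i_kdz^k$, and $\delta_{\bar i}=\overline{\delta_i}$, $\delta\bar v^i=\overline{\delta v^i}$. The Kähler form is $\omega_{\mathcal H}=\sqrt{-1}\,G_{i\bar j}(z,v)\,dz^i\wedge d\bar z^j$, and $d_{\mathcal H}=\partial_{\mathcal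 H}+\overline{\partial}_{\mathcal H}$ is the horizontal part of $d$, so $\partial_{\mathcal H}\omega_{\mathcal H}=\sqrt{-1}\,(\delta_kG_{i\bar j})\,dz^k\wedge dz^i\wedge d\bar z^j$ and $\overline\partial_{\mathcal H}\omega_{\mathcal H}$ is its complex conjugate. $G$ is a Kähler Finsler metric if $d_{\mathcal H}\omega_{\mathcal H}=0$. Let $\pi:\mathbb P(\tilde M)=\tilde M/\mathbb C^*\to M$ be the projectivized tangent bundle, $\omega_{\mathcal V}=\sqrt{-1}\,(\dot\partial_i\dot\partial_{\bar j}\log G)\,\delta v^i\wedge\delta\bar v^j$, and $d\mu_{\mathbb P(\tilde M)}=\frac{\omega_{\mathcal V}^{n-1}}{(n-1)!}\wedge\frac{\omega_{\mathcal H}^n}{n!}$, a volume form on $\mathbb P(\tilde M)$. The induced volume form on $M$ is $d\mu_M=\pi_*(d\mu_{\mathbb P(\tilde M)})$, where $\pi_*$ is integration along the fibre (so $\int_M a\,d\mu_M=\int_{\mathbb P(\tilde M)}(a\circ\pi)\,d\mu_{\mathbb P(\tilde M)}$ for $a\in C^\infty(M)$), and $\mathrm{vol}(M,G)=\int_Md\mu_M$. The volume preserved conformal class is $[G]=\{e^fG: f\in C^\infty(M)\text{ real},\ \mathrm{vol}(M,e^fG)=\mathrm{vol}(M,G)\}$. *)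

theory Defs
  imports "HOL-Analysis.Analysis"
begin

section \<open>Calculus\<close>

text \<open>On an open set \<open>S\<close> of a finite-dimensional space this is \<open>C\<^sup>k\<close>: \<open>f\<close> is \<open>C\<^sup>k\<^sup>+\<^sup>1\<close> iff it is
  differentiable and all its directional derivatives are \<open>C\<^sup>k\<close>.\<close>

primrec Ck_on ::
  "nat \<Rightarrow> 'a::real_normed_vector set \<Rightarrow> ('a \<Rightarrow> 'b::real_normed_vector) \<Rightarrow> bool" where
  "Ck_on 0 S f \<longleftrightarrow> continuous_on S f"
| "Ck_on (Suc k) S f \<longleftrightarrow> (\<forall>x\<in>S. f differentiable (at x)) \<and>
     (\<forall>u. Ck_on k S (\<lambda>x. frechet_derivative f (at x) u))"

definition Cinf_on :: "'a::real_normed_vector set \<Rightarrow> ('a \<Rightarrow> 'b::real_normed_vector) \<Rightarrow> bool" where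
  "Cinf_on S f \<longleftrightarrow> (\<forall>k. Ck_on k S f)"

text \<open>Holomorphic maps between open subsets of \<open>\<complex>\<^sup>n\<close>: real differentiable with complex linear
  derivative.\<close>

definition holomorphic_map_on ::
  "((complex^'n) \<Rightarrow> (complex^'n)) \<Rightarrow> (complex^'n::finite) set \<Rightarrow> bool" where
  "holomorphic_map_on f S \<longleftrightarrow>
     (\<forall>x\<in>S. \<exists>f'. (f has_derivative f') (at x) \<and> (\<forall>a v. f' (a *s v) = a *s f' v))"


section \<open>Complex manifolds and the holomorphic tangent bundle\<close>

text \<open>A chart is a coordinate domain together with a coordinate map; only the values of the map on
  the domain are relevant.\<close>

type_synonym ('a, 'n) chart = "'a set \<times> ('a \<Rightarrow> complex^'n)"

abbreviation chart_image :: "('a, 'n::finite) chart \<Rightarrow> (complex^'n) set" where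
  "chart_image c \<equiv> snd c ` fst c"

abbreviation chart_inv :: "('a, 'n::finite) chart \<Rightarrow> complex^'n \<Rightarrow> 'a" where
  "chart_inv c \<equiv> inv_into (fst c) (snd c)"

definition transition ::
  "('a, 'n::finite) chart \<Rightarrow> ('a, 'n) chart \<Rightarrow> complex^'n \<Rightarrow> complex^'n" where
  "transition c d = snd d \<circ> chart_inv c"

definition complex_manifold :: "'a topology \<Rightarrow> ('a, 'n::finite) chart set \<Rightarrow> bool" where
  "complex_manifold M A \<longleftrightarrow>
     Hausdorff_space M \<and> second_countable M \<and>
     (\<Union>c\<in>A. fst c) = topspace M \<and>
     (\<forall>c\<in>A. openin M (fst c) \<and> open (chart_image c) \<and>
        homeomorphic_map (subtopology M (fst c)) (top_of_set (chart_image c)) (snd c)) \<and>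
     (\<forall>c\<in>A. \<forall>d\<in>A. holomorphic_map_on (transition c d) (snd c ` (fst c \<inter> fst d)))"

text \<open>A holomorphic tangent vector at \<open>p\<close> is given by its components \<open>w c \<in> \<complex>\<^sup>n\<close> in all charts \<open>c\<close>
  around \<open>p\<close>, related by the Jacobians of the coordinate changes. The component vectors for charts
  not containing \<open>p\<close> are set to \<open>0\<close>, so that equal tangent vectors are equal as functions.\<close>

type_synonym ('a, 'n) tangent = "'a \<times> (('a, 'n) chart \<Rightarrow> complex^'n)"

definition tangent_bundle ::
  "'a topology \<Rightarrow> ('a, 'n::finite) chart set \<Rightarrow> ('a, 'n) tangent set" where
  "tangent_bundle M A = {(p, w). p \<in> topspace M \<and>
     (\<forall>c. \<not> (c \<in> A \<and> p \<in> fst c) \<longrightarrow> w c = 0) \<and>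
     (\<forall>c\<in>A. \<forall>d\<in>A. p \<in> fst c \<and> p \<in> fst d \<longrightarrow>
        w d = frechet_derivative (transition c d) (at (snd c p)) (w c))}"

text \<open>The tangent vector with coordinates \<open>(z; v)\<close> in the bundle chart induced by \<open>c\<close>.\<close>

definition tangent_of ::
  "('a, 'n::finite) chart set \<Rightarrow> ('a, 'n) chart \<Rightarrow> (complex^'n) \<times> (complex^'n) \<Rightarrow> ('a, 'n) tangent"
  where
  "tangent_of A c = (\<lambda>(z, v). (chart_inv c z,
     \<lambda>d. if d \<in> A \<and> chart_inv c z \<in> fst d then frechet_derivative (transition c d) (at z) v else 0))"

definition scale_tangent :: "complex \<Rightarrow> ('a, 'n::finite) tangent \<Rightarrow> ('a, 'n) tangent" where
  "scale_tangent l = (\<lambda>(p, w). (p, \<lambda>c. l *s w c))"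

definition local_rep ::
  "('a, 'n::finite) chart set \<Rightarrow> (('a, 'n) tangent \<Rightarrow> real) \<Rightarrow> ('a, 'n) chart \<Rightarrow>
     (complex^'n) \<times> (complex^'n) \<Rightarrow> real" where
  "local_rep A G c = (\<lambda>x. G (tangent_of A c x))"

definition smooth_function :: "('a, 'n::finite) chart set \<Rightarrow> ('a \<Rightarrow> real) \<Rightarrow> bool" where
  "smooth_function A f \<longleftrightarrow> (\<forall>c\<in>A. Cinf_on (chart_image c) (f \<circ> chart_inv c))"


section \<open>Wirtinger derivatives in bundle coordinates\<close>

definition wirt ::
  "((complex^'n) \<times> (complex^'n) \<Rightarrow> complex) \<Rightarrow> (complex^'n::finite) \<times> (complex^'n) \<Rightarrow>
     (complex^'n) \<times> (complex^'n) \<Rightarrow> (complex^'n) \<times> (complex^'n) \<Rightarrow> complex" where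
  "wirt F x e ie =
     (frechet_derivative F (at x) e - \<i> * frechet_derivative F (at x) ie) / 2"

definition wirt_bar ::
  "((complex^'n) \<times> (complex^'n) \<Rightarrow> complex) \<Rightarrow> (complex^'n::finite) \<times> (complex^'n) \<Rightarrow>
     (complex^'n) \<times> (complex^'n) \<Rightarrow> (complex^'n) \<times> (complex^'n) \<Rightarrow> complex" where
  "wirt_bar F x e ie =
     (frechet_derivative F (at x) e + \<i> * frechet_derivative F (at x) ie) / 2"

text \<open>\<open>dz\<close>, \<open>dv\<close>, \<open>dvbar\<close> are the derivatives \<open>\<partial>/\<partial>z\<^sup>i\<close>, \<open>\<partial>/\<partial>v\<^sup>i\<close> and the conjugate derivative in
  \<open>v\<^sup>i\<close>.\<close>

definition dz ::
  "'n::finite \<Rightarrow> ((complex^'n) \<times> (complex^'n) \<Rightarrow> complex) \<Rightarrow>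
     (complex^'n) \<times> (complex^'n) \<Rightarrow> complex" where
  "dz i F x = wirt F x (axis i 1, 0) (axis i \<i>, 0)"

definition dv ::
  "'n::finite \<Rightarrow> ((complex^'n) \<times> (complex^'n) \<Rightarrow> complex) \<Rightarrow>
     (complex^'n) \<times> (complex^'n) \<Rightarrow> complex" where
  "dv i F x = wirt F x (0, axis i 1) (0, axis i \<i>)"

definition dvbar ::
  "'n::finite \<Rightarrow> ((complex^'n) \<times> (complex^'n) \<Rightarrow> complex) \<Rightarrow>
     (complex^'n) \<times> (complex^'n) \<Rightarrow> complex" where
  "dvbar i F x = wirt_bar F x (0, axis i 1) (0, axis i \<i>)"

definition levi_matrix ::
  "((complex^'n) \<times> (complex^'n) \<Rightarrow> real) \<Rightarrow> (complex^'n::finite) \<times> (complex^'n) \<Rightarrow> complex^'n^'n"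
  where
  "levi_matrix g x = (\<chi> i j. dv i (dvbar j (\<lambda>y. complex_of_real (g y))) x)"

definition positive_definite :: "complex^'n^'n::finite \<Rightarrow> bool" where
  "positive_definite H \<longleftrightarrow> (\<forall>i j. H $ j $ i = cnj (H $ i $ j)) \<and>
     (\<forall>\<xi>. \<xi> \<noteq> 0 \<longrightarrow> 0 < Re (\<Sum>i\<in>UNIV. \<Sum>j\<in>UNIV. H $ i $ j * \<xi> $ i * cnj (\<xi> $ j)))"


section \<open>Complex Finsler metrics\<close>

text \<open>The total space carries the topology and smooth structure for which all bundle charts
  \<open>(z; v)\<close> are diffeomorphisms, so continuity and smoothness are tested in these charts.\<close>

definition complex_finsler ::
  "'a topology \<Rightarrow> ('a, 'n::finite) chart set \<Rightarrow> (('a, 'n) tangent \<Rightarrow> real) \<Rightarrow> bool" where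
  "complex_finsler M A G \<longleftrightarrow>
     (\<forall>x\<in>tangent_bundle M A. 0 \<le> G x) \<and>
     (\<forall>c\<in>A. continuous_on (chart_image c \<times> UNIV) (local_rep A G c)) \<and>
     (\<forall>x\<in>tangent_bundle M A. G x = 0 \<longleftrightarrow> snd x = (\<lambda>_. 0)) \<and>
     (\<forall>c\<in>A. Cinf_on (chart_image c \<times> - {0}) (local_rep A G c)) \<and>
     (\<forall>x\<in>tangent_bundle M A. \<forall>l. l \<noteq> 0 \<longrightarrow>
        complex_of_real (G (scale_tangent l x)) = l * cnj l * complex_of_real (G x)) \<and>
     (\<forall>c\<in>A. \<forall>x\<in>chart_image c \<times> - {0}. positive_definite (levi_matrix (local_rep A G c) x))"

text \<open>The inverse matrix satisfies \<open>\<Sum>k. levi_inverse g x $ i $ k * levi_matrix g x $ j $ k = \<delta> i j\<close>,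
  whence the transpose.\<close>

definition levi_inverse ::
  "((complex^'n) \<times> (complex^'n) \<Rightarrow> real) \<Rightarrow> (complex^'n::finite) \<times> (complex^'n) \<Rightarrow> complex^'n^'n"
  where
  "levi_inverse g x = matrix_inv (transpose (levi_matrix g x))"

text \<open>\<open>nconn g i j\<close> is the connection coefficient with upper index \<open>i\<close> and lower index \<open>j\<close>.\<close>

definition nconn ::
  "((complex^'n) \<times> (complex^'n) \<Rightarrow> real) \<Rightarrow> 'n::finite \<Rightarrow> 'n \<Rightarrow>
     (complex^'n) \<times> (complex^'n) \<Rightarrow> complex" where
  "nconn g i j x =
     (\<Sum>k\<in>UNIV. levi_inverse g x $ i $ k * dvbar k (dz j (\<lambda>y. complex_of_real (g y))) x)"

definition delta ::
  "((complex^'n) \<times> (complex^'n) \<Rightarrow> real) \<Rightarrow> 'n::finite \<Rightarrow>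
     ((complex^'n) \<times> (complex^'n) \<Rightarrow> complex) \<Rightarrow> (complex^'n) \<times> (complex^'n) \<Rightarrow> complex" where
  "delta g i F x = dz i F x - (\<Sum>k\<in>UNIV. nconn g k i x * dv k F x)"


section \<open>Differential forms\<close>

text \<open>A complex-valued form at a point is a function of a sequence of tangent vectors, a \<open>d\<close>-form
  using the first \<open>d\<close> of them only. \<open>wedge d [\<alpha>\<^sub>0, \<dots>, \<alpha>\<^sub>m\<^sub>-\<^sub>1]\<close> is the wedge product of \<open>m\<close> forms
  of degree \<open>d\<close>, normalised so that \<open>(dx \<and> dy) (\<partial>x, \<partial>y) = 1\<close>.\<close>

type_synonym 'v form = "(nat \<Rightarrow> 'v) \<Rightarrow> complex"

definition wedge :: "nat \<Rightarrow> 'v form list \<Rightarrow> 'v form" where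
  "wedge d \<alpha>s X =
     (\<Sum>\<sigma> | \<sigma> permutes {..<d * length \<alpha>s}.
        of_int (sign \<sigma>) * (\<Prod>j<length \<alpha>s. (\<alpha>s ! j) (\<lambda>i. X (\<sigma> (d * j + i)))))
     / of_nat (fact d ^ length \<alpha>s)"

text \<open>In bundle coordinates the real tangent space of the total space is \<open>\<complex>\<^sup>n \<times> \<complex>\<^sup>n\<close>: the pair
  \<open>(\<xi>, \<eta>)\<close> stands for \<open>\<xi>\<^sup>i \<partial>/\<partial>z\<^sup>i + \<eta>\<^sup>i \<partial>/\<partial>v\<^sup>i\<close> plus its complex conjugate.\<close>

definition form_dz :: "'n::finite \<Rightarrow> ((complex^'n) \<times> (complex^'n)) form" where
  "form_dz i X = fst (X 0) $ i"

definition form_delta_v ::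
  "((complex^'n) \<times> (complex^'n) \<Rightarrow> real) \<Rightarrow> (complex^'n::finite) \<times> (complex^'n) \<Rightarrow> 'n \<Rightarrow>
     ((complex^'n) \<times> (complex^'n)) form" where
  "form_delta_v g x i X = snd (X 0) $ i + (\<Sum>k\<in>UNIV. nconn g i k x * form_dz k X)"

definition form_cnj :: "'v form \<Rightarrow> 'v form" where
  "form_cnj \<alpha> X = cnj (\<alpha> X)"

definition omega_H ::
  "((complex^'n) \<times> (complex^'n) \<Rightarrow> real) \<Rightarrow> (complex^'n::finite) \<times> (complex^'n) \<Rightarrow>
     ((complex^'n) \<times> (complex^'n)) form" where
  "omega_H g x X = \<i> * (\<Sum>i\<in>UNIV. \<Sum>j\<in>UNIV.
     levi_matrix g x $ i $ j * wedge 1 [form_dz i, form_cnj (form_dz j)] X)"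

definition omega_V ::
  "((complex^'n) \<times> (complex^'n) \<Rightarrow> real) \<Rightarrow> (complex^'n::finite) \<times> (complex^'n) \<Rightarrow>
     ((complex^'n) \<times> (complex^'n)) form" where
  "omega_V g x X = \<i> * (\<Sum>i\<in>UNIV. \<Sum>j\<in>UNIV.
     levi_matrix (\<lambda>y. ln (g y)) x $ i $ j *
       wedge 1 [form_delta_v g x i, form_cnj (form_delta_v g x j)] X)"

definition del_H_omega_H ::
  "((complex^'n) \<times> (complex^'n) \<Rightarrow> real) \<Rightarrow> (complex^'n::finite) \<times> (complex^'n) \<Rightarrow>
     ((complex^'n) \<times> (complex^'n)) form" where
  "del_H_omega_H g x X = \<i> * (\<Sum>k\<in>UNIV. \<Sum>i\<in>UNIV. \<Sum>j\<in>UNIV.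
     delta g k (\<lambda>y. levi_matrix g y $ i $ j) x *
       wedge 1 [form_dz k, form_dz i, form_cnj (form_dz j)] X)"

definition d_H_omega_H ::
  "((complex^'n) \<times> (complex^'n) \<Rightarrow> real) \<Rightarrow> (complex^'n::finite) \<times> (complex^'n) \<Rightarrow>
     ((complex^'n) \<times> (complex^'n)) form" where
  "d_H_omega_H g x X = del_H_omega_H g x X + form_cnj (del_H_omega_H g x) X"

definition kaehler_finsler ::
  "'a topology \<Rightarrow> ('a, 'n::finite) chart set \<Rightarrow> (('a, 'n) tangent \<Rightarrow> real) \<Rightarrow> bool" where
  "kaehler_finsler M A G \<longleftrightarrow> complex_finsler M A G \<and>
     (\<forall>c\<in>A. \<forall>x\<in>chart_image c \<times> - {0}. \<forall>X. d_H_omega_H (local_rep A G c) x X = 0)"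


section \<open>The induced volume\<close>

text \<open>The form \<open>d\<mu>\<close> of the projectivized bundle, as a form on the slit bundle.\<close>

definition proj_volume_form ::
  "((complex^'n) \<times> (complex^'n) \<Rightarrow> real) \<Rightarrow> (complex^'n::finite) \<times> (complex^'n) \<Rightarrow>
     ((complex^'n) \<times> (complex^'n)) form" where
  "proj_volume_form g x X =
     wedge 2 (replicate (CARD('n) - 1) (omega_V g x) @ replicate CARD('n) (omega_H g x)) X
     / (fact (CARD('n) - 1) * fact CARD('n))"

text \<open>Over a chart \<open>c\<close>, the open set \<open>v\<^sup>a \<noteq> 0\<close> of the projectivized bundle has coordinates
  \<open>(z, u)\<close> with \<open>u\<^sup>b = v\<^sup>b / v\<^sup>a\<close> for \<open>b \<noteq> a\<close>, and forms are pulled back to it along the local section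
  \<open>(z, u) \<mapsto> (z, affine_point a u)\<close> of the slit bundle.\<close>

definition affine_point :: "'n::finite \<Rightarrow> ('n \<Rightarrow> complex) \<Rightarrow> complex^'n" where
  "affine_point a u = (\<chi> b. if b = a then 1 else u b)"

text \<open>The image under that section of the oriented real coordinate frame: real and imaginary
  directions of each \<open>z\<^sup>i\<close>, then of each \<open>u\<^sup>b\<close>. The enumeration of the indices does not matter, as it
  only permutes pairs of vectors.\<close>

definition enum_of :: "'n set \<Rightarrow> nat \<Rightarrow> 'n" where
  "enum_of S = (SOME h. bij_betw h {..<card S} S)"

definition affine_frame :: "'n::finite \<Rightarrow> nat \<Rightarrow> (complex^'n) \<times> (complex^'n)" where
  "affine_frame a k =
     (let r = (if even k then 1 else \<i>)
      in if k < 2 * CARD('n) then (axis (enum_of UNIV (k div 2)) r, 0)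
         else (0, axis (enum_of (- {a}) (k div 2 - CARD('n))) r))"

definition proj_density ::
  "((complex^'n) \<times> (complex^'n) \<Rightarrow> real) \<Rightarrow> 'n::finite \<Rightarrow> complex^'n \<Rightarrow> ('n \<Rightarrow> complex) \<Rightarrow> real" where
  "proj_density g a z u = Re (proj_volume_form g (z, affine_point a u) (affine_frame a))"

text \<open>Integrals over projective space and over \<open>M\<close> are defined, as usual, by a partition of unity
  subordinate to the coordinate domains; their values do not depend on the chosen partition.
  Functions on projective space are scaling invariant functions on the nonzero vectors. As \<open>M\<close> is
  compact, finite partitions suffice.\<close>

definition proj_partition :: "('n::finite \<Rightarrow> complex^'n \<Rightarrow> real) \<Rightarrow> bool" where
  "proj_partition \<tau> \<longleftrightarrow>
     (\<forall>a. continuous_on (- {0}) (\<tau> a) \<and>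
        (\<forall>v. v \<noteq> 0 \<longrightarrow> 0 \<le> \<tau> a v) \<and>
        (\<forall>v l. v \<noteq> 0 \<and> l \<noteq> 0 \<longrightarrow> \<tau> a (l *s v) = \<tau> a v) \<and>
        closure {v. v \<noteq> 0 \<and> \<tau> a v \<noteq> 0} - {0} \<subseteq> {v. v $ a \<noteq> 0}) \<and>
     (\<forall>v. v \<noteq> 0 \<longrightarrow> (\<Sum>a\<in>UNIV. \<tau> a v) = 1)"

definition manifold_partition ::
  "'a topology \<Rightarrow> ('a, 'n::finite) chart set \<Rightarrow> ('a, 'n) chart set \<Rightarrow>
     (('a, 'n) chart \<Rightarrow> 'a \<Rightarrow> real) \<Rightarrow> bool" where
  "manifold_partition M A K \<rho> \<longleftrightarrow> finite K \<and> K \<subseteq> A \<and>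
     (\<forall>c\<in>K. continuous_map M euclideanreal (\<rho> c) \<and>
        (\<forall>p\<in>topspace M. 0 \<le> \<rho> c p) \<and>
        M closure_of {p \<in> topspace M. \<rho> c p \<noteq> 0} \<subseteq> fst c) \<and>
     (\<forall>p\<in>topspace M. (\<Sum>c\<in>K. \<rho> c p) = 1)"

text \<open>Integration along the fibre: with \<open>z\<close> the coordinates of a point in the chart \<open>c\<close>,
  \<open>induced_volume A G c z\<close> is the coefficient of \<open>d\<mu>\<^sub>M\<close> with respect to the Lebesgue volume form
  \<open>dx\<^sup>1 \<and> dy\<^sup>1 \<and> \<dots> \<and> dx\<^sup>n \<and> dy\<^sup>n\<close>, where \<open>z\<^sup>i = x\<^sup>i + \<i> y\<^sup>i\<close>.\<close>

definition proj_integral :: "('n::finite \<Rightarrow> ('n \<Rightarrow> complex) \<Rightarrow> real) \<Rightarrow> real" where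
  "proj_integral D = (let \<tau> = (SOME \<tau>. proj_partition \<tau>) in
     \<Sum>a\<in>UNIV. LINT u | Pi\<^sub>M (- {a}) (\<lambda>_. lborel). \<tau> a (affine_point a u) * D a u)"

definition induced_volume ::
  "('a, 'n::finite) chart set \<Rightarrow> (('a, 'n) tangent \<Rightarrow> real) \<Rightarrow> ('a, 'n) chart \<Rightarrow> complex^'n \<Rightarrow> real"
  where
  "induced_volume A G c z = proj_integral (\<lambda>a u. proj_density (local_rep A G c) a z u)"

definition manifold_integral ::
  "'a topology \<Rightarrow> ('a, 'n::finite) chart set \<Rightarrow> (('a, 'n) chart \<Rightarrow> complex^'n \<Rightarrow> real) \<Rightarrow> real" where
  "manifold_integral M A D = (let (K, \<rho>) = (SOME (K, \<rho>). manifold_partition M A K \<rho>) in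
     \<Sum>c\<in>K. set_lebesgue_integral lborel (chart_image c) (\<lambda>z. \<rho> c (chart_inv c z) * D c z))"

definition vol :: "'a topology \<Rightarrow> ('a, 'n::finite) chart set \<Rightarrow> (('a, 'n) tangent \<Rightarrow> real) \<Rightarrow> real" where
  "vol M A G = manifold_integral M A (induced_volume A G)"

text \<open>Metrics are functions on the tangent bundle; restricting makes the choice of values outside it
  irrelevant.\<close>

definition conformal_change ::
  "'a topology \<Rightarrow> ('a, 'n::finite) chart set \<Rightarrow> ('a \<Rightarrow> real) \<Rightarrow> (('a, 'n) tangent \<Rightarrow> real) \<Rightarrow>
     ('a, 'n) tangent \<Rightarrow> real" where
  "conformal_change M A f G = (\<lambda>x\<in>tangent_bundle M A. exp (f (fst x)) * G x)"

definition vp_conformal_class ::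
  "'a topology \<Rightarrow> ('a, 'n::finite) chart set \<Rightarrow> (('a, 'n) tangent \<Rightarrow> real) \<Rightarrow>
     (('a, 'n) tangent \<Rightarrow> real) set" where
  "vp_conformal_class M A G = {conformal_change M A f G | f.
     smooth_function A f \<and> vol M A (conformal_change M A f G) = vol M A G}"

end

theory Submission
  imports Defs "Jordan_Normal_Form.Determinant"
begin

text \<open>Let \<open>G\<^sub>1\<close> and \<open>G\<^sub>2\<close> be Kaehler metrics in the volume preserved conformal class, so that
  \<open>G\<^sub>2 = e\<^sup>h G\<^sub>1\<close> for a smooth function \<open>h\<close> on the base. The proof shows that \<open>h\<close> is constant, and
  then that the constant is \<open>0\<close>.

  That \<open>h\<close> is constant is a pointwise computation. Because \<open>h\<close> does not depend on the fibre
  coordinate \<open>v\<close>, Euler's relation \<open>G\<^sub>i\<^sub>j v\<^sup>i = \<partial>G/\<partial>vbar\<^sup>j\<close> gives the new connection coefficients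
  \<open>N\<^sup>i\<^sub>j + (\<partial>\<^sub>j h) v\<^sup>i\<close>. The Levi matrix \<open>G\<^sub>i\<^sub>j\<close> is homogeneous of degree \<open>0\<close> in \<open>v\<close>, so the
  additional term of the connection does not see it, and
  \<open>\<delta>'\<^sub>k (e\<^sup>h G\<^sub>i\<^sub>j) = e\<^sup>h ((\<partial>\<^sub>k h) G\<^sub>i\<^sub>j + \<delta>\<^sub>k G\<^sub>i\<^sub>j)\<close> (\<open>delta_levi_conformal\<close>). The Kaehler
  condition says that \<open>\<delta>\<^sub>k G\<^sub>i\<^sub>j\<close> is symmetric in \<open>k\<close> and \<open>i\<close> (\<open>kaehler_symmetric\<close>). Comparing the
  two metrics, \<open>(\<partial>\<^sub>k h) G\<^sub>i\<^sub>j = (\<partial>\<^sub>i h) G\<^sub>k\<^sub>j\<close> for all \<open>j\<close>, so for \<open>i \<noteq> k\<close> the vector with entry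
  \<open>\<partial>\<^sub>k h\<close> at \<open>i\<close> and \<open>- \<partial>\<^sub>i h\<close> at \<open>k\<close> is in the kernel of a positive definite matrix. Hence
  \<open>\<partial>h = 0\<close>; this is where \<open>n \<ge> 2\<close> enters (\<open>conformal_kaehler_derivative_zero\<close>), and connectedness
  makes \<open>h\<close> constant.

  A constant factor \<open>e\<^sup>k\<close> changes neither \<open>N\<close> nor the complex Hessian of \<open>log G\<close>, so it leaves the
  vertical form alone, and it multiplies the horizontal form by \<open>e\<^sup>k\<close>. Therefore it multiplies the
  volume by \<open>e\<^sup>n\<^sup>k\<close> (\<open>vol_scaling\<close>). The two volumes agree, so \<open>k = 0\<close> once the volume is known
  not to be \<open>0\<close> (\<open>vol_pos\<close>).

  Positivity of the volume takes most of the work. By Gram decompositions, the horizontal and the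
  vertical form are both sums \<open>\<i> \<Sum> \<phi>\<^sub>l \<and> cnj \<phi>\<^sub>l\<close> with complex linear \<open>\<phi>\<^sub>l\<close>. On a frame of the
  type \<open>X, \<i>X\<close> a top degree product of such sums is a sum of squared moduli of determinants
  (\<open>wedge_sum_of_squares\<close>), and one of these determinants is nonzero because \<open>G\<^sub>i\<^sub>j\<close> is positive
  definite and the Hessian of \<open>log G\<close> is positive definite transversally to \<open>v\<close>
  (\<open>proj_density_pos\<close>). Thus the density is positive everywhere. Since a Lebesgue integral has the
  value \<open>0\<close> by convention when the integrand is not integrable, integrability has to be
  established as well: the density is continuous, and the members of the partitions of unity
  confine it to compact sets.\<close>

text \<open>The dollar sign denotes the components of the vectors of \<open>\<complex>\<^sup>n\<close>.\<close>

no_notation vec_index (infixl "$" 100)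

section \<open>Positive definite Hermitian forms on finite index sets\<close>

definition pos_def_on :: "'i set \<Rightarrow> ('i \<Rightarrow> 'i \<Rightarrow> complex) \<Rightarrow> bool" where
  "pos_def_on S H \<longleftrightarrow> (\<forall>j\<in>S. \<forall>k\<in>S. H k j = cnj (H j k)) \<and>
     (\<forall>\<xi>. (\<exists>i\<in>S. \<xi> i \<noteq> 0) \<longrightarrow> 0 < Re (\<Sum>i\<in>S. \<Sum>j\<in>S. H i j * \<xi> i * cnj (\<xi> j)))"

lemma pos_def_onD:
  "pos_def_on S H \<Longrightarrow> j \<in> S \<Longrightarrow> k \<in> S \<Longrightarrow> H k j = cnj (H j k)"
  "pos_def_on S H \<Longrightarrow> i \<in> S \<Longrightarrow> \<xi> i \<noteq> 0 \<Longrightarrow> 0 < Re (\<Sum>i\<in>S. \<Sum>j\<in>S. H i j * \<xi> i * cnj (\<xi> j))"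
  unfolding pos_def_on_def by blast+

text \<open>Cholesky decomposition. Removing the index \<open>s\<close> leaves the Schur complement
  \<open>H j k - H j s * H s k / H s s\<close>, whose quadratic form at \<open>\<xi>\<close> is the minimum of the quadratic
  form of \<open>H\<close> over all extensions of \<open>\<xi>\<close> to the index \<open>s\<close>; so it is positive definite again and
  the induction applies to it.\<close>

lemma gram_decomposition:
  assumes "finite S" and "pos_def_on S H"
  shows "\<exists>b. \<forall>j\<in>S. \<forall>k\<in>S. H j k = (\<Sum>l\<in>S. b l j * cnj (b l k))"
  using assms
proof (induction S arbitrary: H rule: finite_induct)
  case empty
  then show ?case by simp
next
  case (insert s S)
  have herm: "H k j = cnj (H j k)" if "j \<in> insert s S" "k \<in> insert s S" for j k
    using insert.prems that by (rule pos_def_onD(1))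
  define d where "d = Re (H s s)"
  have "0 < Re (\<Sum>i\<in>insert s S. \<Sum>j\<in>insert s S. H i j * (if i = s then 1 else 0)
      * cnj (if j = s then 1 else 0))"
    using insert.prems by (rule pos_def_onD(2)[where i = s]) auto
  also have "(\<Sum>i\<in>insert s S. \<Sum>j\<in>insert s S. H i j * (if i = s then 1 else 0)
      * cnj (if j = s then 1 else 0)) = H s s"
  proof -
    have "(\<Sum>i\<in>insert s S. \<Sum>j\<in>insert s S. H i j * (if i = s then 1 else 0) * cnj (if j = s then 1 else 0)) =
      (\<Sum>i\<in>insert s S. \<Sum>j\<in>insert s S. if j = s then if i = s then H s s else 0 else 0)"
      by (intro sum.cong) auto
    also have "\<dots> = H s s" using insert.hyps by (simp only: sum.delta finite_insert) simp
    finally show ?thesis .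
  qed
  finally have d: "d > 0" by (simp add: d_def)
  have "Im (H s s) = 0" using herm[of s s] by (simp add: complex_eq_iff)
  hence Hss: "H s s = of_real d" by (simp add: d_def complex_eq_iff)
  define H' where "H' j k = H j k - H j s * H s k / d" for j k
  have "pos_def_on S H'"
    unfolding pos_def_on_def
  proof (intro conjI ballI allI impI)
    fix j k assume "j \<in> S" "k \<in> S"
    then show "H' k j = cnj (H' j k)"
      using herm[of j k] herm[of j s] herm[of s k] by (simp add: H'_def)
  next
    fix \<xi> :: "'a \<Rightarrow> complex" assume "\<exists>i\<in>S. \<xi> i \<noteq> 0"
    then obtain i where i: "i \<in> S" "\<xi> i \<noteq> 0" by blast
    define u where "u = (\<Sum>j\<in>S. H j s * \<xi> j)"
    (* the extension of \<xi> to s that minimises the quadratic form *)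
    define \<zeta> where "\<zeta> = \<xi>(s := - u / d)"
    have z: "\<zeta> j = \<xi> j" if "j \<in> S" for j using that insert.hyps by (auto simp: \<zeta>_def)
    have zs: "\<zeta> s = - u / d" by (simp add: \<zeta>_def)
    have cu: "cnj u = (\<Sum>j\<in>S. H s j * cnj (\<xi> j))"
      unfolding u_def cnj_sum complex_cnj_mult
    proof (rule sum.cong[OF refl])
      fix j assume "j \<in> S"
      then show "cnj (H j s) * cnj (\<xi> j) = H s j * cnj (\<xi> j)" using herm[of j s] by simp
    qed
    have "0 < Re (\<Sum>i\<in>insert s S. \<Sum>j\<in>insert s S. H i j * \<zeta> i * cnj (\<zeta> j))"
      using insert.prems by (rule pos_def_onD(2)[where i = i]) (use i z in auto)
    also have "(\<Sum>i\<in>insert s S. \<Sum>j\<in>insert s S. H i j * \<zeta> i * cnj (\<zeta> j)) =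
       H s s * \<zeta> s * cnj (\<zeta> s) + \<zeta> s * (\<Sum>j\<in>S. H s j * cnj (\<xi> j)) + (\<Sum>i\<in>S. H i s * \<xi> i) * cnj (\<zeta> s)
       + (\<Sum>i\<in>S. \<Sum>j\<in>S. H i j * \<xi> i * cnj (\<xi> j))"
    proof -
      have f: "(\<Sum>j\<in>insert s S. H i j * \<zeta> i * cnj (\<zeta> j)) = H i s * \<zeta> i * cnj (\<zeta> s) + \<zeta> i
          * (\<Sum>j\<in>S. H i j * cnj (\<xi> j))" for i
      proof -
        have "(\<Sum>j\<in>S. H i j * \<zeta> i * cnj (\<zeta> j)) = \<zeta> i * (\<Sum>j\<in>S. H i j * cnj (\<xi> j))"
          unfolding sum_distrib_left by (rule sum.cong) (simp_all add: z)
        then show ?thesis using insert.hyps by simp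
      qed
      have g: "(\<Sum>i\<in>S. H i s * \<zeta> i * cnj (\<zeta> s) + \<zeta> i * (\<Sum>j\<in>S. H i j * cnj (\<xi> j))) =
        (\<Sum>i\<in>S. H i s * \<xi> i) * cnj (\<zeta> s) + (\<Sum>i\<in>S. \<Sum>j\<in>S. H i j * \<xi> i * cnj (\<xi> j))"
        unfolding sum.distrib sum_distrib_left sum_distrib_right
        by (intro arg_cong2[where f = "(+)"] sum.cong refl) (simp_all add: z)
      show ?thesis unfolding f using insert.hyps g by simp
    qed
    also have "\<dots> = (\<Sum>i\<in>S. \<Sum>j\<in>S. H i j * \<xi> i * cnj (\<xi> j)) - u * cnj u / d"
      unfolding cu[symmetric] u_def[symmetric] zs Hss using d by (simp add: field_simps)
    also have "u * cnj u / d = (\<Sum>i\<in>S. \<Sum>j\<in>S. H i s * H s j / d * \<xi> i * cnj (\<xi> j))"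
      unfolding cu unfolding u_def by (simp add: sum_product sum_divide_distrib ac_simps)
    also have "(\<Sum>i\<in>S. \<Sum>j\<in>S. H i j * \<xi> i * cnj (\<xi> j)) - \<dots> = (\<Sum>i\<in>S. \<Sum>j\<in>S. H' i j * \<xi> i * cnj (\<xi> j))"
      by (simp add: H'_def sum_subtractf left_diff_distrib)
    finally show "0 < Re \<dots>" .
  qed
  from insert.IH[OF this] obtain b
    where b: "\<And>j k. j \<in> S \<Longrightarrow> k \<in> S \<Longrightarrow> H' j k = (\<Sum>l\<in>S. b l j * cnj (b l k))" by blast
  (* triangular: the vectors of the smaller index set get the entry 0 at s *)
  define b' where "b' l j = (if l = s then H j s / sqrt d else if j = s then 0 else b l j)" for l j
  have sq: "complex_of_real (sqrt d) * complex_of_real (sqrt d) = d"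
    using d by (simp flip: of_real_mult)
  have "H j k = (\<Sum>l\<in>insert s S. b' l j * cnj (b' l k))" if jk: "j \<in> insert s S" "k \<in> insert s S" for j k
  proof -
    have "(\<Sum>l\<in>insert s S. b' l j * cnj (b' l k)) =
      H j s * H s k / d + (\<Sum>l\<in>S. if j = s \<or> k = s then 0 else b l j * cnj (b l k))"
    proof -
      have "(\<Sum>l\<in>S. b' l j * cnj (b' l k)) = (\<Sum>l\<in>S. if j = s \<or> k = s then 0 else b l j * cnj (b l k))"
        using insert.hyps by (intro sum.cong) (auto simp: b'_def)
      moreover have "b' s j * cnj (b' s k) = H j s * H s k / d"
        using herm[of k s] jk by (simp add: b'_def sq)
      ultimately show ?thesis using insert.hyps by simp
    qed
    also have "\<dots> = H j k"
    proof (cases "j = s \<or> k = s")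
      case True
      then show ?thesis using d by (auto simp: Hss)
    next
      case False
      then show ?thesis using jk b[of j k, symmetric] by (simp add: H'_def)
    qed
    finally show ?thesis ..
  qed
  then show ?case by blast
qed

lemma gram_sesquilinear:
  assumes "\<forall>j\<in>S. \<forall>k\<in>S. H j k = (\<Sum>l\<in>S. b l j * cnj (b l k))"
  shows "(\<Sum>j\<in>S. \<Sum>k\<in>S. H j k * (\<alpha> j * cnj (\<beta> k))) =
    (\<Sum>l\<in>S. (\<Sum>j\<in>S. b l j * \<alpha> j) * cnj (\<Sum>k\<in>S. b l k * \<beta> k))"
proof -
  have "(\<Sum>j\<in>S. \<Sum>k\<in>S. H j k * (\<alpha> j * cnj (\<beta> k))) =
    (\<Sum>j\<in>S. \<Sum>k\<in>S. \<Sum>l\<in>S. (b l j * \<alpha> j) * cnj (b l k * \<beta> k))"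
    using assms by (intro sum.cong refl) (auto simp: sum_distrib_right intro!: sum.cong)
  also have "\<dots> = (\<Sum>j\<in>S. \<Sum>l\<in>S. \<Sum>k\<in>S. (b l j * \<alpha> j) * cnj (b l k * \<beta> k))"
    by (intro sum.cong refl sum.swap)
  also have "\<dots> = (\<Sum>l\<in>S. \<Sum>j\<in>S. \<Sum>k\<in>S. (b l j * \<alpha> j) * cnj (b l k * \<beta> k))"
    by (rule sum.swap)
  also have "\<dots> = (\<Sum>l\<in>S. (\<Sum>j\<in>S. b l j * \<alpha> j) * cnj (\<Sum>k\<in>S. b l k * \<beta> k))"
    unfolding cnj_sum sum_product by simp
  finally show ?thesis .
qed

text \<open>The form at \<open>\<xi>\<close> is the sum of the squares of the numbers \<open>\<Sum>j. b l j * \<xi> j\<close>.\<close>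

lemma gram_kernel:
  assumes "pos_def_on S H" "\<forall>j\<in>S. \<forall>k\<in>S. H j k = (\<Sum>l\<in>S. b l j * cnj (b l k))"
    and "\<And>l. l \<in> S \<Longrightarrow> (\<Sum>j\<in>S. b l j * \<xi> j) = 0" and "i \<in> S"
  shows "\<xi> i = 0"
proof (rule ccontr)
  assume "\<xi> i \<noteq> 0"
  from pos_def_onD(2)[where \<xi> = \<xi> and i = i, OF assms(1,4) this] gram_sesquilinear[OF assms(2), of \<xi> \<xi>]
      show False
    by (simp add: assms(3) mult.assoc)
qed

section \<open>Wedge products of forms of type (1,1)\<close>

lemma prod_pairs: "(\<Prod>i<2 * m. f i) = (\<Prod>t<m. f (2 * t) * f (2 * t + 1))" for m :: nat
  by (induction m) (simp_all add: ac_simps)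

text \<open>Under a signed sum over permutations, antisymmetrizing a factor doubles the sum: the
  transposition of \<open>2r\<close> and \<open>2r + 1\<close> exchanges the two terms of the \<open>r\<close>-th factor, fixes all other
  factors and changes the sign. The induction treats the factors one after the other.\<close>

lemma signed_sum_antisymmetrize_upto:
  fixes \<beta> :: "nat \<Rightarrow> nat \<Rightarrow> nat \<Rightarrow> complex"
  assumes "r \<le> m"
  shows "(\<Sum>\<sigma> | \<sigma> permutes {..<2 * m}. of_int (sign \<sigma>) *
      (\<Prod>t<m. \<beta> t (\<sigma> (2 * t)) (\<sigma> (2 * t + 1)) - (if t < r then \<beta> t (\<sigma> (2 * t + 1)) (\<sigma> (2 * t)) else 0)))
    = 2 ^ r * (\<Sum>\<sigma> | \<sigma> permutes {..<2 * m}. of_int (sign \<sigma>) * (\<Prod>t<m. \<beta> t (\<sigma> (2 * t)) (\<sigma> (2 * t + 1))))"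
  using assms
proof (induction r)
  case 0
  then show ?case by simp
next
  case (Suc r)
  let ?P = "{\<sigma>. \<sigma> permutes {..<2 * m}}"
  define R where "R \<sigma> = (\<Prod>t\<in>{..<m} - {r}. \<beta> t (\<sigma> (2 * t)) (\<sigma> (2 * t + 1))
      - (if t < r then \<beta> t (\<sigma> (2 * t + 1)) (\<sigma> (2 * t)) else 0))" for \<sigma> :: "nat \<Rightarrow> nat"
  define \<tau> where "\<tau> = Transposition.transpose (2 * r) (2 * r + 1)"
  have \<tau>: "\<tau> permutes {..<2 * m}" unfolding \<tau>_def using Suc.prems by (intro permutes_swap_id) auto
  have \<tau>\<tau>: "\<tau> \<circ> \<tau> = id" by (simp add: \<tau>_def)
  have bij: "bij_betw (\<lambda>\<sigma>. \<sigma> \<circ> \<tau>) ?P ?P"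
    by (rule bij_betw_byWitness[where f' = "\<lambda>\<sigma>. \<sigma> \<circ> \<tau>"])
       (auto simp: o_assoc[symmetric] \<tau>\<tau> intro: permutes_compose[OF \<tau>])
  have sgn: "sign (\<sigma> \<circ> \<tau>) = - sign \<sigma>" if "\<sigma> permutes {..<2 * m}" for \<sigma> :: "nat \<Rightarrow> nat"
  proof -
    have "permutation \<sigma>" "permutation \<tau>" using that \<tau> by (auto intro: permutation_permutes[THEN iffD2])
    then show ?thesis by (simp add: sign_compose) (simp add: \<tau>_def sign_swap_id)
  qed
  have R\<tau>: "R (\<sigma> \<circ> \<tau>) = R \<sigma>" for \<sigma>
  proof -
    have "\<tau> (2 * t) = 2 * t \<and> \<tau> (2 * t + 1) = 2 * t + 1" if "t \<noteq> r" for t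
      using that unfolding \<tau>_def by (auto simp: Transposition.transpose_def)
    then show ?thesis unfolding R_def by (intro prod.cong) auto
  qed
  have split: "(\<Prod>t<m. \<beta> t (\<sigma> (2 * t)) (\<sigma> (2 * t + 1))
      - (if t < q then \<beta> t (\<sigma> (2 * t + 1)) (\<sigma> (2 * t)) else 0))
     = (\<beta> r (\<sigma> (2 * r)) (\<sigma> (2 * r + 1)) - (if r < q then \<beta> r (\<sigma> (2 * r + 1)) (\<sigma> (2 * r)) else 0)) * R \<sigma>"
    if "q = r \<or> q = Suc r" for \<sigma> q
  proof -
    have "r \<in> {..<m}" using Suc.prems by simp
    have "t < q \<longleftrightarrow> t < r" if "t \<noteq> r" for t using \<open>q = r \<or> q = Suc r\<close> that by auto
    then show ?thesis unfolding R_def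
      by (subst prod.remove[OF _ \<open>r \<in> {..<m}\<close>]) (auto intro!: prod.cong arg_cong2[where f = "(*)"])
  qed
  have "(\<Sum>\<sigma>\<in>?P. of_int (sign \<sigma>) * (\<beta> r (\<sigma> (2 * r + 1)) (\<sigma> (2 * r)) * R \<sigma>)) =
     (\<Sum>\<sigma>\<in>?P. of_int (sign (\<sigma> \<circ> \<tau>)) * (\<beta> r ((\<sigma> \<circ> \<tau>) (2 * r + 1)) ((\<sigma> \<circ> \<tau>) (2 * r)) * R (\<sigma> \<circ> \<tau>)))"
    by (rule sum.reindex_bij_betw[OF bij, symmetric])
  also have "\<dots> = - (\<Sum>\<sigma>\<in>?P. of_int (sign \<sigma>) * (\<beta> r (\<sigma> (2 * r)) (\<sigma> (2 * r + 1)) * R \<sigma>))"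
    unfolding sum_negf[symmetric]
    by (rule sum.cong[OF refl]) (simp add: sgn R\<tau>, (simp add: \<tau>_def)?)
  finally have swap: "(\<Sum>\<sigma>\<in>?P. of_int (sign \<sigma>) * (\<beta> r (\<sigma> (2 * r + 1)) (\<sigma> (2 * r)) * R \<sigma>)) = \<dots>" .
  have IH: "(\<Sum>\<sigma>\<in>?P. of_int (sign \<sigma>) * (\<beta> r (\<sigma> (2 * r)) (\<sigma> (2 * r + 1)) * R \<sigma>)) =
      2 ^ r * (\<Sum>\<sigma>\<in>?P. of_int (sign \<sigma>) * (\<Prod>t<m. \<beta> t (\<sigma> (2 * t)) (\<sigma> (2 * t + 1))))"
    using Suc.IH[OF Suc_leD[OF Suc.prems]] unfolding split[OF disjI1[OF refl]] by simp
  have "(\<Sum>\<sigma>\<in>?P. of_int (sign \<sigma>) *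
      (\<Prod>t<m. \<beta> t (\<sigma> (2 * t)) (\<sigma> (2 * t + 1)) - (if t < Suc r then \<beta> t (\<sigma> (2 * t + 1)) (\<sigma> (2 * t)) else 0)))
    = (\<Sum>\<sigma>\<in>?P. of_int (sign \<sigma>) * (\<beta> r (\<sigma> (2 * r)) (\<sigma> (2 * r + 1)) * R \<sigma>)
        - of_int (sign \<sigma>) * (\<beta> r (\<sigma> (2 * r + 1)) (\<sigma> (2 * r)) * R \<sigma>))"
    by (subst split, simp) (simp add: algebra_simps)
  also have "\<dots> = 2 * (\<Sum>\<sigma>\<in>?P. of_int (sign \<sigma>) * (\<beta> r (\<sigma> (2 * r)) (\<sigma> (2 * r + 1)) * R \<sigma>))"
    unfolding sum_subtractf swap by simp
  finally show ?case unfolding IH by simp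
qed

lemma signed_sum_antisymmetrize:
  fixes \<beta> :: "nat \<Rightarrow> nat \<Rightarrow> nat \<Rightarrow> complex"
  shows "(\<Sum>\<sigma> | \<sigma> permutes {..<2 * m}. of_int (sign \<sigma>) *
      (\<Prod>t<m. \<beta> t (\<sigma> (2 * t)) (\<sigma> (2 * t + 1)) - \<beta> t (\<sigma> (2 * t + 1)) (\<sigma> (2 * t))))
    = 2 ^ m * (\<Sum>\<sigma> | \<sigma> permutes {..<2 * m}. of_int (sign \<sigma>) * (\<Prod>t<m. \<beta> t (\<sigma> (2 * t)) (\<sigma> (2 * t + 1))))"
proof -
  have "(\<Prod>t<m. \<beta> t (\<sigma> (2 * t)) (\<sigma> (2 * t + 1)) - \<beta> t (\<sigma> (2 * t + 1)) (\<sigma> (2 * t))) =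
    (\<Prod>t<m. \<beta> t (\<sigma> (2 * t)) (\<sigma> (2 * t + 1)) - (if t < m then \<beta> t (\<sigma> (2 * t + 1)) (\<sigma> (2 * t)) else 0))"
        for \<sigma> :: "nat \<Rightarrow> nat"
    by (intro prod.cong) auto
  then show ?thesis using signed_sum_antisymmetrize_upto[of m m \<beta>] by simp
qed

text \<open>The permutation \<open>\<pi>\<close> lists the even positions before the odd ones. It acts on the rows and on the
  columns, so its sign enters twice.\<close>

lemma det_interleave:
  fixes F :: "'a::comm_ring_1 mat"
  assumes F: "F \<in> carrier_mat (2 * m) (2 * m)"
  defines "\<pi> \<equiv> \<lambda>i. if i < 2 * m then if even i then i div 2 else m + i div 2 else i"
  shows "Determinant.det (Matrix.mat (2 * m) (2 * m) (\<lambda>(i, j). F $$ (\<pi> i, \<pi> j))) = Determinant.det F"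
proof -
  have \<pi>: "\<pi> permutes {0..<2 * m}"
  proof (rule bij_imp_permutes)
    show "bij_betw \<pi> {0..<2 * m} {0..<2 * m}"
      by (rule bij_betw_byWitness[where f' = "\<lambda>i. if i < m then 2 * i else 2 * (i - m) + 1"])
         (auto simp: \<pi>_def elim!: evenE oddE)
  qed (simp add: \<pi>_def)
  have \<pi>_less: "\<pi> i < 2 * m" if "i < 2 * m" for i
    using that permutes_in_image[OF \<pi>, of i] by simp
  define F' where "F' = Matrix.mat (2 * m) (2 * m) (\<lambda>(i, j). F $$ (i, \<pi> j))"
  have F': "F' \<in> carrier_mat (2 * m) (2 * m)" by (simp add: F'_def)
  have "Matrix.mat (2 * m) (2 * m) (\<lambda>(i, j). F $$ (\<pi> i, \<pi> j))
      = Matrix.mat (2 * m) (2 * m) (\<lambda>(i, j). F' $$ (\<pi> i, j))"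
    by (rule eq_matI) (auto simp: F'_def \<pi>_less)
  hence "Determinant.det (Matrix.mat (2 * m) (2 * m) (\<lambda>(i, j). F $$ (\<pi> i, \<pi> j))) = of_int (sign \<pi>)
      * Determinant.det F'"
    using det_permute_rows[OF F' \<pi>] by simp
  also have "Determinant.det F' = Determinant.det (F'\<^sup>T)" using det_transpose[OF F'] by simp
  also have "F'\<^sup>T = Matrix.mat (2 * m) (2 * m) (\<lambda>(i, j). F\<^sup>T $$ (\<pi> i, j))"
    using F by (intro eq_matI) (auto simp: F'_def \<pi>_less)
  also have "Determinant.det \<dots> = of_int (sign \<pi>) * Determinant.det (F\<^sup>T)"
    using F by (intro det_permute_rows[OF _ \<pi>]) auto
  also have "Determinant.det (F\<^sup>T) = Determinant.det F" using det_transpose[OF F] .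
  finally show ?thesis
    by (simp flip: mult.assoc of_int_mult) 
qed

text \<open>The signed sum is the determinant of the matrix with the rows \<open>a 0, b 0, a 1, b 1, \<dots>\<close>. With even
  rows and columns first, it is the block matrix with rows \<open>(A, \<i> A)\<close> and \<open>(B, - \<i> B)\<close>, which is
  the product of the block diagonal matrix of \<open>A\<close> and \<open>B\<close> with the matrix of rows \<open>(1, \<i>)\<close> and
  \<open>(1, - \<i>)\<close>; the latter has determinant \<open>(- 2 \<i>)\<^sup>m\<close>. For \<open>b = cnj a\<close> this is the fact that a
  complex linear map of determinant \<open>\<Delta>\<close> has real determinant \<open>\<bar>\<Delta>\<bar>\<^sup>2\<close>.\<close>

lemma signed_sum_pairs_eq_det:
  fixes a b :: "nat \<Rightarrow> nat \<Rightarrow> complex"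
  assumes a: "\<And>t s. t < m \<Longrightarrow> s < m \<Longrightarrow> a t (2 * s + 1) = \<i> * a t (2 * s)"
    and b: "\<And>t s. t < m \<Longrightarrow> s < m \<Longrightarrow> b t (2 * s + 1) = - \<i> * b t (2 * s)"
  shows "(\<Sum>\<sigma> | \<sigma> permutes {..<2 * m}. of_int (sign \<sigma>) * (\<Prod>t<m. a t (\<sigma> (2 * t)) * b t (\<sigma> (2 * t + 1)))) =
    (- 2 * \<i>) ^ m * Determinant.det (Matrix.mat m m (\<lambda>(t, s). a t (2 * s)))
        * Determinant.det (Matrix.mat m m (\<lambda>(t, s). b t (2 * s)))"
proof -
  define A where "A = Matrix.mat m m (\<lambda>(t, s). a t (2 * s))"
  define B where "B = Matrix.mat m m (\<lambda>(t, s). b t (2 * s))"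
  have AB: "A \<in> carrier_mat m m" "B \<in> carrier_mat m m" by (auto simp: A_def B_def)
  define M where "M = Matrix.mat (2 * m) (2 * m) (\<lambda>(i, p). if even i then a (i div 2) p else b (i div 2) p)"
  let ?\<pi> = "\<lambda>i. if i < 2 * m then if even i then i div 2 else m + i div 2 else i"
  let ?I = "1\<^sub>m m :: complex mat"
  define F where "F = four_block_mat A (\<i> \<cdot>\<^sub>m A) B ((- \<i>) \<cdot>\<^sub>m B)"
  define Q where "Q = four_block_mat ?I (\<i> \<cdot>\<^sub>m ?I) ?I ((- \<i>) \<cdot>\<^sub>m ?I)"
  have F: "F \<in> carrier_mat (2 * m) (2 * m)" using AB by (auto simp: F_def mult_2)
  have "M = Matrix.mat (2 * m) (2 * m) (\<lambda>(i, j). F $$ (?\<pi> i, ?\<pi> j))"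
  proof (rule eq_matI)
    fix i j assume ij: "i < dim_row (Matrix.mat (2 * m) (2 * m) (\<lambda>(i, j). F $$ (?\<pi> i, ?\<pi> j)))"
      "j < dim_col (Matrix.mat (2 * m) (2 * m) (\<lambda>(i, j). F $$ (?\<pi> i, ?\<pi> j)))"
    have h: "i div 2 < m" "j div 2 < m" "i < 2 * m" "j < 2 * m" "i < m + m" "j < m + m" using ij by auto
    have "a (i div 2) j = \<i> * a (i div 2) (2 * (j div 2))" "b (i div 2) j = - \<i>
        * b (i div 2) (2 * (j div 2))" if "odd j"
      using a[OF h(1,2)] b[OF h(1,2)] that by (auto elim!: oddE)
    then show "M $$ (i, j) = Matrix.mat (2 * m) (2 * m) (\<lambda>(i, j). F $$ (?\<pi> i, ?\<pi> j)) $$ (i, j)"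
      using h by (auto simp: M_def F_def A_def B_def)
  qed (auto simp: M_def)
  hence "Determinant.det M = Determinant.det F" using det_interleave[OF F] by simp
  also have "F = four_block_mat A (0\<^sub>m m m) (0\<^sub>m m m) B * Q"
    unfolding F_def Q_def using AB
    by (subst mult_four_block_mat[where ?nr1.0 = m and ?n1.0 = m and ?n2.0 = m and ?nr2.0 = m and ?nc1.0
        = m and ?nc2.0 = m])
       (auto simp: mult_smult_distrib)
  also have "Determinant.det \<dots> = Determinant.det (four_block_mat A (0\<^sub>m m m) (0\<^sub>m m m) B)
      * Determinant.det Q"
    by (rule det_mult[where n = "m + m"]) (use AB in \<open>auto simp: Q_def\<close>)
  also have "Determinant.det (four_block_mat A (0\<^sub>m m m) (0\<^sub>m m m) B) = Determinant.det A
      * Determinant.det B"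
    using AB by (intro det_four_block_mat_lower_left_zero) auto
  also have "Determinant.det Q = Determinant.det (?I * ((- \<i>) \<cdot>\<^sub>m ?I) - (\<i> \<cdot>\<^sub>m ?I) * ?I)"
    unfolding Q_def by (rule det_four_block_mat) auto
  also have "?I * ((- \<i>) \<cdot>\<^sub>m ?I) - (\<i> \<cdot>\<^sub>m ?I) * ?I = (- 2 * \<i>) \<cdot>\<^sub>m ?I"
    by (rule eq_matI) (auto simp: mult_smult_distrib)
  also have "Determinant.det \<dots> = (- 2 * \<i>) ^ m" by simp
  finally have detM: "Determinant.det M = (- 2 * \<i>) ^ m * Determinant.det A * Determinant.det B" by simp
  have "Determinant.det M = (\<Sum>\<sigma> | \<sigma> permutes {..<2 * m}. of_int (sign \<sigma>) * (\<Prod>i<2 * m. M $$ (i, \<sigma> i)))"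
    by (subst det_def'[of _ "2 * m"]) (auto simp: M_def atLeast0LessThan)
  also have "\<dots> = (\<Sum>\<sigma> | \<sigma> permutes {..<2 * m}. of_int (sign \<sigma>)
      * (\<Prod>t<m. a t (\<sigma> (2 * t)) * b t (\<sigma> (2 * t + 1))))"
  proof (rule sum.cong[OF refl])
    fix \<sigma> assume "\<sigma> \<in> {\<sigma>. \<sigma> permutes {..<2 * m}}"
    hence "\<sigma> i < 2 * m" if "i < 2 * m" for i using that permutes_in_image[of \<sigma> "{..<2 * m}" i] by simp
    hence "(\<Prod>t<m. M $$ (2 * t, \<sigma> (2 * t)) * M $$ (2 * t + 1, \<sigma> (2 * t + 1)))
        = (\<Prod>t<m. a t (\<sigma> (2 * t)) * b t (\<sigma> (2 * t + 1)))"
      by (intro prod.cong) (auto simp: M_def)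
    then show "of_int (sign \<sigma>) * (\<Prod>i<2 * m. M $$ (i, \<sigma> i)) = of_int (sign \<sigma>)
        * (\<Prod>t<m. a t (\<sigma> (2 * t)) * b t (\<sigma> (2 * t + 1)))"
      by (simp only: prod_pairs)
  qed
  finally show ?thesis using detM by (simp add: A_def B_def)
qed

lemma det_mat_cnj:
  "Determinant.det (Matrix.mat m m (\<lambda>(t, s). cnj (f t s)))
      = cnj (Determinant.det (Matrix.mat m m (\<lambda>(t, s). f t s)))"
proof -
  have "(\<Prod>i = 0..<m. Matrix.mat m m (\<lambda>(t, s). g t s) $$ (i, p i)) = (\<Prod>i = 0..<m. g i (p i))"
    if "p permutes {0..<m}" for p and g :: "nat \<Rightarrow> nat \<Rightarrow> complex"
    using permutes_in_image[OF that] by (intro prod.cong) auto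
  then show ?thesis by (simp add: det_def'[of _ m])
qed

text \<open>A product of \<open>m\<close> forms \<open>\<i> \<Sum> \<phi>\<^sub>l \<and> cnj \<phi>\<^sub>l\<close>, evaluated on a frame consisting of pairs \<open>X, \<i>X\<close>, is
  expanded into one term for each choice \<open>L\<close> of a summand in every factor. Each term contributes
  \<open>\<i>\<^sup>m (- 2 \<i>)\<^sup>m = 2\<^sup>m\<close> times the determinant of the chosen forms times its conjugate.\<close>

lemma wedge_sum_of_squares:
  fixes \<phi> :: "nat \<Rightarrow> 'i \<Rightarrow> 'v \<Rightarrow> complex"
  assumes len: "length \<alpha>s = m"
    and fin: "\<And>t. t < m \<Longrightarrow> finite (S t)"
    and \<alpha>: "\<And>t Y. t < m \<Longrightarrow> (\<alpha>s ! t) Y =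
      \<i> * (\<Sum>l\<in>S t. \<phi> t l (Y 0) * cnj (\<phi> t l (Y 1)) - \<phi> t l (Y 1) * cnj (\<phi> t l (Y 0)))"
    and X: "\<And>t l s. t < m \<Longrightarrow> l \<in> S t \<Longrightarrow> s < m \<Longrightarrow> \<phi> t l (X (2 * s + 1)) = \<i> * \<phi> t l (X (2 * s))"
  shows "wedge 2 \<alpha>s X = complex_of_real (2 ^ m *
    (\<Sum>L\<in>PiE {..<m} S. (cmod (Determinant.det (Matrix.mat m m (\<lambda>(t, s). \<phi> t (L t) (X (2 * s))))))\<^sup>2))"
proof -
  let ?P = "{\<sigma>. \<sigma> permutes {..<2 * m}}"
  (* the t-th form at X p, X q is \<beta> t p q - \<beta> t q p *)
  define \<beta> where "\<beta> t p q = \<i> * (\<Sum>l\<in>S t. \<phi> t l (X p) * cnj (\<phi> t l (X q)))" for t p q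
  have "wedge 2 \<alpha>s X = (\<Sum>\<sigma>\<in>?P. of_int (sign \<sigma>) *
      (\<Prod>t<m. \<beta> t (\<sigma> (2 * t)) (\<sigma> (2 * t + 1)) - \<beta> t (\<sigma> (2 * t + 1)) (\<sigma> (2 * t)))) / 2 ^ m"
    unfolding wedge_def len
    by (simp add: \<alpha> \<beta>_def sum_subtractf right_diff_distrib)
  also have "\<dots> = (\<Sum>\<sigma>\<in>?P. of_int (sign \<sigma>) * (\<Prod>t<m. \<beta> t (\<sigma> (2 * t)) (\<sigma> (2 * t + 1))))"
    by (subst signed_sum_antisymmetrize) simp
  also have "\<dots> = (\<Sum>\<sigma>\<in>?P. \<Sum>L\<in>PiE {..<m} S. \<i> ^ m * (of_int (sign \<sigma>) *
      (\<Prod>t<m. \<phi> t (L t) (X (\<sigma> (2 * t))) * cnj (\<phi> t (L t) (X (\<sigma> (2 * t + 1)))))))"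
  proof (rule sum.cong[OF refl])
    fix \<sigma> :: "nat \<Rightarrow> nat"
    have "(\<Prod>t<m. \<Sum>l\<in>S t. \<phi> t l (X (\<sigma> (2 * t))) * cnj (\<phi> t l (X (\<sigma> (2 * t + 1))))) =
      (\<Sum>L\<in>PiE {..<m} S. \<Prod>t<m. \<phi> t (L t) (X (\<sigma> (2 * t))) * cnj (\<phi> t (L t) (X (\<sigma> (2 * t + 1)))))"
      by (rule prod_sum_PiE) (use fin in auto)
    then show "of_int (sign \<sigma>) * (\<Prod>t<m. \<beta> t (\<sigma> (2 * t)) (\<sigma> (2 * t + 1))) =
      (\<Sum>L\<in>PiE {..<m} S. \<i> ^ m * (of_int (sign \<sigma>) *
      (\<Prod>t<m. \<phi> t (L t) (X (\<sigma> (2 * t))) * cnj (\<phi> t (L t) (X (\<sigma> (2 * t + 1)))))))"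
      unfolding \<beta>_def prod.distrib[of "\<lambda>_. \<i>"] by (simp add: sum_distrib_left ac_simps)
  qed
  also have "\<dots> = (\<Sum>L\<in>PiE {..<m} S. \<i> ^ m * (\<Sum>\<sigma>\<in>?P. of_int (sign \<sigma>) *
      (\<Prod>t<m. \<phi> t (L t) (X (\<sigma> (2 * t))) * cnj (\<phi> t (L t) (X (\<sigma> (2 * t + 1)))))))"
    by (subst sum.swap) (simp add: sum_distrib_left)
  also have "\<dots> = (\<Sum>L\<in>PiE {..<m} S. complex_of_real (2 ^ m
      * (cmod (Determinant.det (Matrix.mat m m (\<lambda>(t, s). \<phi> t (L t) (X (2 * s))))))\<^sup>2))"
  proof (rule sum.cong[OF refl])
    fix L assume L: "L \<in> PiE {..<m} S"
    let ?D = "Determinant.det (Matrix.mat m m (\<lambda>(t, s). \<phi> t (L t) (X (2 * s))))"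
    have i2: "\<i> ^ m * (- (2 * \<i>)) ^ m = 2 ^ m"
    proof -
      have "\<i> * (- (2 * \<i>)) = 2" by (simp add: complex_eq_iff)
      then show ?thesis by (simp only: power_mult_distrib[symmetric])
    qed
    have "(\<Sum>\<sigma>\<in>?P. of_int (sign \<sigma>) *
      (\<Prod>t<m. \<phi> t (L t) (X (\<sigma> (2 * t))) * cnj (\<phi> t (L t) (X (\<sigma> (2 * t + 1)))))) =
      (- 2 * \<i>) ^ m * ?D * Determinant.det (Matrix.mat m m (\<lambda>(t, s). cnj (\<phi> t (L t) (X (2 * s)))))"
      by (rule signed_sum_pairs_eq_det) (use L X in \<open>auto simp: PiE_mem\<close>)
    also have "\<dots> = (- 2 * \<i>) ^ m * (?D * cnj ?D)" unfolding det_mat_cnj by simp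
    also have "?D * cnj ?D = complex_of_real ((cmod ?D)\<^sup>2)"
      by (rule complex_norm_square[symmetric])
    finally show "\<i> ^ m * (\<Sum>\<sigma>\<in>?P. of_int (sign \<sigma>) *
      (\<Prod>t<m. \<phi> t (L t) (X (\<sigma> (2 * t))) * cnj (\<phi> t (L t) (X (\<sigma> (2 * t + 1))))))
          = complex_of_real (2 ^ m * (cmod ?D)\<^sup>2)"
      using i2 by (simp add: mult.assoc[symmetric] del: power_mult_distrib)
  qed
  finally show ?thesis by (simp add: sum_distrib_left)
qed

lemma det_mat_nonzeroI:
  fixes f :: "nat \<Rightarrow> nat \<Rightarrow> complex"
  assumes "\<And>x. (\<And>t. t < m \<Longrightarrow> (\<Sum>s<m. f t s * x s) = 0) \<Longrightarrow> \<forall>s<m. x s = 0"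
  shows "Determinant.det (Matrix.mat m m (\<lambda>(t, s). f t s)) \<noteq> 0"
proof
  let ?A = "Matrix.mat m m (\<lambda>(t, s). f t s)"
  assume "Determinant.det ?A = 0"
  then obtain v where v: "v \<in> carrier_vec m" "v \<noteq> 0\<^sub>v m" "?A *\<^sub>v v = 0\<^sub>v m"
    by (subst (asm) det_0_iff_vec_prod_zero[where n = m]) auto
  have "(\<Sum>s<m. f t s * vec_index v s) = 0" if "t < m" for t
  proof -
    have "vec_index (?A *\<^sub>v v) t = (\<Sum>s<m. f t s * vec_index v s)"
      using that v(1) by (simp add: scalar_prod_def atLeast0LessThan)
    then show ?thesis using v(3) that by simp
  qed
  from assms[OF this] have "\<forall>s<m. vec_index v s = 0" by blast
  hence "v = 0\<^sub>v m" using v(1) by (intro eq_vecI) auto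
  with v(2) show False by simp
qed


lemma wedge_two:
  fixes a b :: "'v form"
  assumes "\<And>X. a X = a' (X 0)" "\<And>X. b X = b' (X 0)"
  shows "wedge 1 [a, b] X = a' (X 0) * b' (X 1) - a' (X 1) * b' (X 0)"
proof -
  have s: "{..<2::nat} = insert 0 (insert 1 {})" by auto
  have "wedge 1 [a, b] X = (\<Sum>\<sigma> | \<sigma> permutes {..<2}. of_int (sign \<sigma>) * (a' (X (\<sigma> 0)) * b' (X (\<sigma> 1))))"
    unfolding wedge_def by (simp add: eval_nat_numeral lessThan_Suc assms ac_simps)
  also have "\<dots> = a' (X 0) * b' (X 1) - a' (X 1) * b' (X 0)"
    unfolding s
    by (simp add: sum_over_permutations_insert permutes_sing sign_compose permutation_swap_id sign_swap_id
        sign_id Transposition.transpose_def)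
  finally show ?thesis .
qed

lemma wedge_three:
  fixes a b c :: "'v form"
  assumes "\<And>X. a X = a' (X 0)" "\<And>X. b X = b' (X 0)" "\<And>X. c X = c' (X 0)"
  shows "wedge 1 [a, b, c] X = a' (X 0) * b' (X 1) * c' (X 2) + a' (X 1) * b' (X 2) * c' (X 0)
    + a' (X 2) * b' (X 0) * c' (X 1) - a' (X 1) * b' (X 0) * c' (X 2)
    - a' (X 0) * b' (X 2) * c' (X 1) - a' (X 2) * b' (X 1) * c' (X 0)"
proof -
  have s: "{..<3::nat} = insert 0 (insert 1 (insert 2 {}))" by auto
  have "wedge 1 [a, b, c] X = (\<Sum>\<sigma> | \<sigma> permutes {..<3}. of_int (sign \<sigma>)
      * (a' (X (\<sigma> 0)) * b' (X (\<sigma> 1)) * c' (X (\<sigma> 2))))"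
    unfolding wedge_def by (simp add: eval_nat_numeral lessThan_Suc assms ac_simps)
  also have "\<dots> = a' (X 0) * b' (X 1) * c' (X 2) + a' (X 1) * b' (X 2) * c' (X 0)
    + a' (X 2) * b' (X 0) * c' (X 1) - a' (X 1) * b' (X 0) * c' (X 2)
    - a' (X 0) * b' (X 2) * c' (X 1) - a' (X 2) * b' (X 1) * c' (X 0)"
    unfolding s
    by (simp add: sum_over_permutations_insert permutes_sing sign_compose permutation_swap_id sign_swap_id
        sign_id Transposition.transpose_def)
  finally show ?thesis .
qed

section \<open>Smooth functions\<close>

lemma frechet_derivative_cong_open:
  assumes "open S" "x \<in> S" "\<And>y. y \<in> S \<Longrightarrow> f y = g y"
  shows "frechet_derivative f (at x) = frechet_derivative g (at x)"
proof -
  have "(f has_derivative f') (at x) \<longleftrightarrow> (g has_derivative f') (at x)" for f'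
    using has_derivative_transform_within_open[of f f' x UNIV S g]
      has_derivative_transform_within_open[of g f' x UNIV S f] assms by auto
  then show ?thesis by (simp add: frechet_derivative_def)
qed

lemma differentiable_cong_open:
  assumes "open S" "x \<in> S" "\<And>y. y \<in> S \<Longrightarrow> f y = g y" "f differentiable (at x)"
  shows "g differentiable (at x)"
  using assms has_derivative_transform_within_open[of f _ x UNIV S g] unfolding differentiable_def by blast

lemma Ck_on_cong:
  assumes "open S" "Ck_on k S f" "\<And>x. x \<in> S \<Longrightarrow> f x = g x"
  shows "Ck_on k S g"
  using assms(2,3)
proof (induction k arbitrary: f g)
  case 0
  then show ?case by (auto cong: continuous_on_cong)
next
  case (Suc k)
  have "g differentiable (at x)" if "x \<in> S" for x
    using differentiable_cong_open[OF assms(1) that, of f g] Suc.prems that by auto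
  moreover have "Ck_on k S (\<lambda>x. frechet_derivative g (at x) u)" for u
  proof (rule Suc.IH)
    show "Ck_on k S (\<lambda>x. frechet_derivative f (at x) u)" using Suc.prems by simp
    show "frechet_derivative f (at x) u = frechet_derivative g (at x) u" if "x \<in> S" for x
      using frechet_derivative_cong_open[OF assms(1) that, of f g] Suc.prems by simp
  qed
  ultimately show ?case by simp
qed

lemma Ck_on_bounded_linear:
  assumes "open S" "bounded_linear L" "Ck_on k S f"
  shows "Ck_on k S (\<lambda>x. L (f x))"
  using assms(3)
proof (induction k arbitrary: f)
  case 0
  then show ?case by (auto intro!: bounded_linear.continuous_on[OF assms(2)])
next
  case (Suc k)
  have d: "((\<lambda>x. L (f x)) has_derivative (\<lambda>h. L (frechet_derivative f (at x) h))) (at x)" if "x \<in> S" for x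
    using Suc.prems that by (intro bounded_linear.has_derivative[OF assms(2)])
        (simp add: frechet_derivative_works)
  have "Ck_on k S (\<lambda>x. frechet_derivative (\<lambda>x. L (f x)) (at x) u)" for u
  proof (rule Ck_on_cong[OF assms(1)])
    show "Ck_on k S (\<lambda>x. L (frechet_derivative f (at x) u))" using Suc by simp
    show "L (frechet_derivative f (at x) u) = frechet_derivative (\<lambda>x. L (f x)) (at x) u" if "x \<in> S" for x
      using frechet_derivative_at[OF d[OF that]] by (simp add: fun_eq_iff)
  qed
  then show ?case using d by (auto simp: differentiable_def)
qed

lemma Ck_on_add:
  assumes "open S" "Ck_on k S f" "Ck_on k S g"
  shows "Ck_on k S (\<lambda>x. f x + g x)"
  using assms(2,3)
proof (induction k arbitrary: f g)
  case 0
  then show ?case by (auto intro!: continuous_on_add)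
next
  case (Suc k)
  have d: "((\<lambda>x. f x + g x) has_derivative (\<lambda>h. frechet_derivative f (at x) h
      + frechet_derivative g (at x) h)) (at x)" if "x \<in> S" for x
    using Suc.prems that by (intro has_derivative_add) (simp_all add: frechet_derivative_works)
  have "Ck_on k S (\<lambda>x. frechet_derivative (\<lambda>x. f x + g x) (at x) u)" for u
  proof (rule Ck_on_cong[OF assms(1)])
    show "Ck_on k S (\<lambda>x. frechet_derivative f (at x) u + frechet_derivative g (at x) u)" using Suc by simp
    show "frechet_derivative f (at x) u + frechet_derivative g (at x) u
        = frechet_derivative (\<lambda>x. f x + g x) (at x) u" if "x \<in> S" for x
      using frechet_derivative_at[OF d[OF that]] by (simp add: fun_eq_iff)
  qed
  then show ?case using d by (auto simp: differentiable_def)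
qed

lemma Ck_on_fst:
  assumes "open S" "open T" "Ck_on k S f"
  shows "Ck_on k (S \<times> T) (\<lambda>x. f (fst x))"
  using assms(3)
proof (induction k arbitrary: f)
  case 0
  then show ?case by (auto intro!: continuous_on_compose2[of S f] continuous_on_fst)
next
  case (Suc k)
  have d: "((\<lambda>x. f (fst x)) has_derivative (\<lambda>h. frechet_derivative f (at (fst x)) (fst h))) (at x)"
      if "x \<in> S \<times> T" for x
  proof -
    have "(f has_derivative frechet_derivative f (at (fst x))) (at (fst x))"
      using Suc.prems that by (auto simp: frechet_derivative_works)
    from has_derivative_compose[OF has_derivative_fst[OF has_derivative_ident] this] show ?thesis by simp
  qed
  have "Ck_on k (S \<times> T) (\<lambda>x. frechet_derivative (\<lambda>x. f (fst x)) (at x) u)" for u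
  proof (rule Ck_on_cong)
    show "open (S \<times> T)" using assms by (simp add: open_Times)
    show "Ck_on k (S \<times> T) (\<lambda>x. frechet_derivative f (at (fst x)) (fst u))"
      by (rule Suc.IH) (use Suc.prems in simp)
    show "frechet_derivative f (at (fst x)) (fst u) = frechet_derivative (\<lambda>x. f (fst x)) (at x) u"
        if "x \<in> S \<times> T" for x
      using fun_cong[OF frechet_derivative_at[OF d[OF that]], of u] by simp
  qed
  moreover have "(\<lambda>x. f (fst x)) differentiable (at x)" if "x \<in> S \<times> T" for x
    using d[OF that] unfolding differentiable_def by blast
  ultimately show ?case by simp
qed

lemma Cinf_on_differentiable: "Cinf_on S f \<Longrightarrow> x \<in> S \<Longrightarrow> f differentiable (at x)"
  unfolding Cinf_on_def by (metis Ck_on.simps(2))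

lemma Cinf_on_continuous: "Cinf_on S f \<Longrightarrow> continuous_on S f"
  unfolding Cinf_on_def by (metis Ck_on.simps(1))

lemma Cinf_on_frechet: "Cinf_on S f \<Longrightarrow> Cinf_on S (\<lambda>x. frechet_derivative f (at x) u)"
  unfolding Cinf_on_def by (metis Ck_on.simps(2))

lemma Cinf_on_bounded_linear: "open S \<Longrightarrow> bounded_linear L \<Longrightarrow> Cinf_on S f \<Longrightarrow> Cinf_on S (\<lambda>x. L (f x))"
  unfolding Cinf_on_def by (blast intro: Ck_on_bounded_linear)

lemma Cinf_on_of_real: "open S \<Longrightarrow> Cinf_on S f \<Longrightarrow> Cinf_on S (\<lambda>x. complex_of_real (f x))"
  by (rule Cinf_on_bounded_linear[OF _ bounded_linear_of_real])

lemma Cinf_on_fst: "open S \<Longrightarrow> open T \<Longrightarrow> Cinf_on S f \<Longrightarrow> Cinf_on (S \<times> T) (\<lambda>x. f (fst x))"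
  unfolding Cinf_on_def by (blast intro: Ck_on_fst)

section \<open>Wirtinger derivatives\<close>

lemma Cinf_on_wirt:
  fixes F :: "(complex^'n::finite) \<times> (complex^'n) \<Rightarrow> complex"
  assumes "open S" "Cinf_on S F"
  shows "Cinf_on S (\<lambda>x. wirt F x e e')" "Cinf_on S (\<lambda>x. wirt_bar F x e e')"
proof -
  have a: "Cinf_on S (\<lambda>x. f x + g x)" if "Cinf_on S f" "Cinf_on S g"
      for f g :: "(complex^'n) \<times> (complex^'n) \<Rightarrow> complex"
    using that Ck_on_add[OF assms(1)] unfolding Cinf_on_def by blast
  have m: "Cinf_on S (\<lambda>x. c * f x)" if "Cinf_on S f" for f :: "(complex^'n) \<times> (complex^'n) \<Rightarrow> complex" and c
    using that by (rule Cinf_on_bounded_linear[OF assms(1) bounded_linear_mult_right])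
  have "wirt F x e e' = (1/2) * frechet_derivative F (at x) e + (- \<i> / 2)
      * frechet_derivative F (at x) e'" for x
    by (simp add: wirt_def field_simps)
  then show "Cinf_on S (\<lambda>x. wirt F x e e')"
    using a[OF m m, OF Cinf_on_frechet[OF assms(2)] Cinf_on_frechet[OF assms(2)]] by presburger
  have "wirt_bar F x e e' = (1/2) * frechet_derivative F (at x) e + (\<i> / 2)
      * frechet_derivative F (at x) e'" for x
    by (simp add: wirt_bar_def field_simps)
  then show "Cinf_on S (\<lambda>x. wirt_bar F x e e')"
    using a[OF m m, OF Cinf_on_frechet[OF assms(2)] Cinf_on_frechet[OF assms(2)]] by presburger
qed

lemma Cinf_on_dz: "open S \<Longrightarrow> Cinf_on S F \<Longrightarrow> Cinf_on S (dz i F)"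
  and Cinf_on_dv: "open S \<Longrightarrow> Cinf_on S F \<Longrightarrow> Cinf_on S (dv i F)"
  and Cinf_on_dvbar: "open S \<Longrightarrow> Cinf_on S F \<Longrightarrow> Cinf_on S (dvbar i F)"
  using Cinf_on_wirt[of S F] by (simp_all add: dz_def[abs_def] dv_def[abs_def] dvbar_def[abs_def])

lemma dz_cong_open:
  assumes "open S" "x \<in> S" "\<And>y. y \<in> S \<Longrightarrow> F y = K y"
  shows "dz i F x = dz i K x" and dv_cong_open: "dv i F x = dv i K x" and dvbar_cong_open: "dvbar i F x
      = dvbar i K x"
  using frechet_derivative_cong_open[OF assms]
  by (simp_all add: dz_def dv_def dvbar_def wirt_def wirt_bar_def)

lemma wirtinger_mult:
  assumes "F differentiable (at x)" "K differentiable (at x)"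
  shows dz_mult: "dz i (\<lambda>y. F y * K y) x = dz i F x * K x + F x * dz i K x"
    and dv_mult: "dv i (\<lambda>y. F y * K y) x = dv i F x * K x + F x * dv i K x"
    and dvbar_mult: "dvbar i (\<lambda>y. F y * K y) x = dvbar i F x * K x + F x * dvbar i K x"
proof -
  have "((\<lambda>y. F y * K y) has_derivative (\<lambda>h. F x * frechet_derivative K (at x) h
      + frechet_derivative F (at x) h * K x)) (at x)"
    using assms by (intro has_derivative_mult) (simp_all add: frechet_derivative_works)
  from frechet_derivative_at[OF this, symmetric]
  have *: "frechet_derivative (\<lambda>y. F y * K y) (at x)
      = (\<lambda>h. F x * frechet_derivative K (at x) h + frechet_derivative F (at x) h * K x)" .
  show "dz i (\<lambda>y. F y * K y) x = dz i F x * K x + F x * dz i K x"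
    "dv i (\<lambda>y. F y * K y) x = dv i F x * K x + F x * dv i K x"
    "dvbar i (\<lambda>y. F y * K y) x = dvbar i F x * K x + F x * dvbar i K x"
    unfolding dz_def dv_def dvbar_def wirt_def wirt_bar_def * by (simp_all add: field_simps)
qed

lemma dvbar_add:
  assumes "F differentiable (at x)" "K differentiable (at x)"
  shows "dvbar i (\<lambda>y. F y + K y) x = dvbar i F x + dvbar i K x"
proof -
  have "((\<lambda>y. F y + K y) has_derivative (\<lambda>h. frechet_derivative F (at x) h
      + frechet_derivative K (at x) h)) (at x)"
    using assms by (intro has_derivative_add) (simp_all add: frechet_derivative_works)
  from frechet_derivative_at[OF this, symmetric]
  have *: "frechet_derivative (\<lambda>y. F y + K y) (at x)
      = (\<lambda>h. frechet_derivative F (at x) h + frechet_derivative K (at x) h)" .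
  show ?thesis unfolding dvbar_def wirt_bar_def * by (simp add: field_simps)
qed

lemma frechet_derivative_linear: "f differentiable (at x) \<Longrightarrow> linear (frechet_derivative f (at x))"
  using frechet_derivative_works has_derivative_linear by blast

lemma wirtinger_chain:
  assumes "F differentiable (at x)" "(h has_field_derivative h') (at (F x))"
  shows dz_chain: "dz i (\<lambda>y. h (F y)) x = h' * dz i F x"
    and dv_chain: "dv i (\<lambda>y. h (F y)) x = h' * dv i F x"
    and dvbar_chain: "dvbar i (\<lambda>y. h (F y)) x = h' * dvbar i F x"
proof -
  have "((\<lambda>y. h (F y)) has_derivative (\<lambda>u. h' * frechet_derivative F (at x) u)) (at x)"
    using has_derivative_compose[of F _ x UNIV h "(*) h'"] assms
    by (simp add: frechet_derivative_works has_field_derivative_def)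
  from frechet_derivative_at[OF this, symmetric]
  have *: "frechet_derivative (\<lambda>y. h (F y)) (at x) = (\<lambda>u. h' * frechet_derivative F (at x) u)" .
  show "dz i (\<lambda>y. h (F y)) x = h' * dz i F x" "dv i (\<lambda>y. h (F y)) x = h' * dv i F x" 
    "dvbar i (\<lambda>y. h (F y)) x = h' * dvbar i F x"
    unfolding dz_def dv_def dvbar_def wirt_def wirt_bar_def * by (simp_all add: field_simps)
qed

lemma differentiable_chain:
  assumes "F differentiable (at x)" "(h has_field_derivative h') (at (F x))"
  shows "(\<lambda>y. h (F y)) differentiable (at x)"
  using assms has_derivative_compose[of F _ x UNIV h "(*) h'"]
  unfolding differentiable_def has_field_derivative_def by blast

lemma frechet_derivative_fst:
  assumes "f differentiable (at (fst x))"
  shows "(\<lambda>y. f (fst y)) differentiable (at x)"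
    and "frechet_derivative (\<lambda>y. f (fst y)) (at x) u = frechet_derivative f (at (fst x)) (fst u)"
proof -
  have "(f has_derivative frechet_derivative f (at (fst x))) (at (fst x))"
    using assms by (auto simp: frechet_derivative_works)
  from has_derivative_compose[OF has_derivative_fst[OF has_derivative_ident] this]
  have *: "((\<lambda>y. f (fst y)) has_derivative (\<lambda>h. frechet_derivative f (at (fst x)) (fst h))) (at x)" by simp
  then show "(\<lambda>y. f (fst y)) differentiable (at x)" by (auto simp: differentiable_def)
  show "frechet_derivative (\<lambda>y. f (fst y)) (at x) u = frechet_derivative f (at (fst x)) (fst u)"
    using fun_cong[OF frechet_derivative_at[OF *], of u] by simp
qed

lemma vertical_derivative_fst:
  assumes "f differentiable (at (fst x))"
  shows dv_fst: "dv i (\<lambda>y. f (fst y)) x = 0" and dvbar_fst: "dvbar i (\<lambda>y. f (fst y)) x = 0"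
  using linear_0[OF frechet_derivative_linear[OF assms]] frechet_derivative_fst(2)[OF assms]
  by (simp_all add: dv_def dvbar_def wirt_def wirt_bar_def)

lemma dvbar_of_real: "dvbar i (\<lambda>y. complex_of_real (g y)) x = cnj (dv i (\<lambda>y. complex_of_real (g y)) x)"
  if "g differentiable (at x)"
proof -
  have "((\<lambda>y. complex_of_real (g y)) has_derivative
      (\<lambda>u. complex_of_real (frechet_derivative g (at x) u))) (at x)"
    using that by (intro has_derivative_of_real) (simp add: frechet_derivative_works)
  from frechet_derivative_at[OF this, symmetric]
  have *: "frechet_derivative (\<lambda>y. complex_of_real (g y)) (at x)
      = (\<lambda>u. complex_of_real (frechet_derivative g (at x) u))" .
  show ?thesis unfolding dv_def dvbar_def wirt_def wirt_bar_def * by simp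
qed

text \<open>The two summands of a real linear functional; the Wirtinger derivatives in \<open>v\<close> are the values of
  these parts of the derivative at the coordinate vectors.\<close>

definition complex_linear_part :: "(complex^'n::finite \<Rightarrow> complex) \<Rightarrow> complex^'n \<Rightarrow> complex" where
  "complex_linear_part L u = (L u - \<i> * L (\<i> *s u)) / 2"
definition conj_linear_part :: "(complex^'n::finite \<Rightarrow> complex) \<Rightarrow> complex^'n \<Rightarrow> complex" where
  "conj_linear_part L u = (L u + \<i> * L (\<i> *s u)) / 2"

lemma dv_eq_complex_linear_part: "dv i F x = complex_linear_part
    (\<lambda>u. frechet_derivative F (at x) (0, u)) (axis i 1)"
  and dvbar_eq_conj_linear_part: "dvbar i F x = conj_linear_part
      (\<lambda>u. frechet_derivative F (at x) (0, u)) (axis i 1)"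
  by (simp_all add: dv_def dvbar_def wirt_def wirt_bar_def complex_linear_part_def conj_linear_part_def
      Finite_Cartesian_Product.vec_eq_iff axis_def 
      cong: if_cong) (simp_all add: vector_scalar_mult_def if_distrib cong: if_cong)

lemma smult_decomp: "a *s u = Re a *\<^sub>R u + Im a *\<^sub>R (\<i> *s u)" for u :: "complex^'n"
  by (simp add: Finite_Cartesian_Product.vec_eq_iff complex_eq_iff)

lemma part_smult:
  assumes "linear L"
  shows complex_linear_part_smult: "complex_linear_part L (a *s u) = a * complex_linear_part L u"
    and conj_linear_part_smult: "conj_linear_part L (a *s u) = cnj a * conj_linear_part L u"
proof -
  have 1: "L (b *s w) = of_real (Re b) * L w + of_real (Im b) * L (\<i> *s w)" for b w
    by (subst smult_decomp) (simp add: linear_add[OF assms] linear_scale[OF assms]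
        scaleR_conv_of_real[where 'a = complex])
  have 2: "\<i> *s (\<i> *s w) = - w" for w :: "complex^'n" by (simp add: Finite_Cartesian_Product.vec_eq_iff)
  have 3: "L (- w) = - L w" for w using linear_neg[OF assms] .
  have 4: "\<i> *s (a *s u) = a *s (\<i> *s u)" by (simp add: Finite_Cartesian_Product.vec_eq_iff)
  show "complex_linear_part L (a *s u) = a * complex_linear_part L u"
    unfolding complex_linear_part_def 4 1[of a] 2 3 by (subst (7) complex_eq) (simp add: field_simps)
  show "conj_linear_part L (a *s u) = cnj a * conj_linear_part L u"
    unfolding conj_linear_part_def 4 1[of a] 2 3 by (simp add: complex_eq_iff field_simps)
qed

lemma complex_linear_part_expand:
  fixes L :: "complex^'n::finite \<Rightarrow> complex"
  assumes "linear L"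
  shows "complex_linear_part L v = (\<Sum>i\<in>UNIV. v $ i * complex_linear_part L (axis i 1))"
proof -
  have v: "v = (\<Sum>i\<in>UNIV. v $ i *s axis i 1)"
    by (simp add: Finite_Cartesian_Product.vec_eq_iff axis_def if_distrib sum.delta' cong: if_cong)
  have lin: "L (\<Sum>i\<in>UNIV. w i) = (\<Sum>i\<in>UNIV. L (w i))" for w :: "'n \<Rightarrow> complex^'n"
    using linear_sum[OF assms] .
  have isum: "\<i> *s (\<Sum>i\<in>UNIV. w i) = (\<Sum>i\<in>UNIV. \<i> *s w i)" for w :: "'n \<Rightarrow> complex^'n"
    by (simp add: Finite_Cartesian_Product.vec_eq_iff sum_distrib_left)
  have "complex_linear_part L (\<Sum>i\<in>UNIV. w i) = (\<Sum>i\<in>UNIV. complex_linear_part L (w i))"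
      for w :: "'n \<Rightarrow> complex^'n"
    unfolding complex_linear_part_def isum lin
    by (simp only: sum_divide_distrib[symmetric] sum_subtractf sum_distrib_left)
  then show ?thesis
    by (subst v) (simp add: complex_linear_part_smult[OF assms])
qed

lemma linear_vertical_restriction: "linear D \<Longrightarrow> linear (\<lambda>u. D (0, u))"
    for D :: "'a::real_vector \<times> 'b::real_vector \<Rightarrow> 'c::real_vector"
  by (rule linearI) (metis add_Pair add_0 linear_add, metis scaleR_Pair scaleR_zero_right linear_scale)

lemma bounded_linear_smult_left: "bounded_linear (\<lambda>l. l *s v)" for v :: "complex^'n::finite"
  by (rule linear_conv_bounded_linear[THEN iffD1], rule linearI)
      (simp_all add: Finite_Cartesian_Product.vec_eq_iff algebra_simps)

lemma bounded_linear_smult_right: "bounded_linear (\<lambda>v::complex^'n::finite. l *s v)"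
  by (rule linear_conv_bounded_linear[THEN iffD1], rule linearI)
      (simp_all add: Finite_Cartesian_Product.vec_eq_iff algebra_simps)

section \<open>Homogeneous functions and Euler relations\<close>

text \<open>Differentiate \<open>F (z, l v) = h l * F (z, v)\<close> with respect to \<open>l\<close> at \<open>l = 1\<close>.\<close>

lemma euler_homogeneous:
  fixes F :: "'a::real_normed_vector \<times> (complex^'n::finite) \<Rightarrow> complex"
  assumes F: "F differentiable (at (z, v))"
    and hom: "\<And>l. l \<noteq> 0 \<Longrightarrow> F (z, l *s v) = h l * F (z, v)"
    and h: "(h has_derivative h') (at 1)"
  shows "frechet_derivative F (at (z, v)) (0, a *s v) = h' a * F (z, v)"
proof -
  have "((\<lambda>l. (z, l *s v)) has_derivative (\<lambda>a. (0, a *s v))) (at 1)"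
    by (intro derivative_intros bounded_linear.has_derivative[OF bounded_linear_smult_left, OF
        has_derivative_ident])
  moreover have "(F has_derivative frechet_derivative F (at (z, v))) (at (z, 1 *s v))"
    using F by (simp add: frechet_derivative_works)
  ultimately have "((\<lambda>l. F (z, l *s v)) has_derivative
      (\<lambda>a. frechet_derivative F (at (z, v)) (0, a *s v))) (at 1)"
    by (rule has_derivative_compose)
  then have "((\<lambda>l. h l * F (z, v)) has_derivative (\<lambda>a. frechet_derivative F (at (z, v)) (0, a *s v)))
      (at 1)"
    by (rule has_derivative_transform_within_open[where s = "- {0}"]) (auto simp: hom)
  moreover have "((\<lambda>l. h l * F (z, v)) has_derivative (\<lambda>a. h' a * F (z, v))) (at 1)"
    by (rule has_derivative_mult_left[OF h])
  ultimately have "(\<lambda>a. frechet_derivative F (at (z, v)) (0, a *s v)) = (\<lambda>a. h' a * F (z, v))"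
    by (rule has_derivative_unique)
  then show ?thesis by (simp add: fun_eq_iff)
qed

text \<open>Differentiating \<open>F (z, l v) = c F (z, v)\<close> in \<open>v\<close> produces the derivative at \<open>(z, l v)\<close> in the
  direction \<open>l u\<close>; the holomorphic part pulls \<open>l\<close> out and the antiholomorphic part pulls \<open>cnj l\<close>
  out.\<close>

lemma vertical_derivative_homogeneous:
  fixes F :: "(complex^'n::finite) \<times> (complex^'n) \<Rightarrow> complex"
  assumes U: "open U" and z: "z \<in> U" and v: "v \<noteq> 0" and l: "l \<noteq> 0"
    and F: "\<And>x. x \<in> U \<times> - {0} \<Longrightarrow> F differentiable (at x)"
    and hom: "\<And>z v. z \<in> U \<Longrightarrow> v \<noteq> 0 \<Longrightarrow> F (z, l *s v) = c * F (z, v)"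
  shows dv_homogeneous: "dv i F (z, l *s v) = c / l * dv i F (z, v)"
    and dvbar_homogeneous: "dvbar i F (z, l *s v) = c / cnj l * dvbar i F (z, v)"
proof -
  have lv: "l *s v \<noteq> 0" using v l by (auto simp: Finite_Cartesian_Product.vec_eq_iff)
  define L1 where "L1 u = frechet_derivative F (at (z, l *s v)) (0, u)" for u
  define L2 where "L2 u = frechet_derivative F (at (z, v)) (0, u)" for u
  have lin: "linear L1" "linear L2" unfolding L1_def L2_def
    using F z v lv by (auto intro!: linear_vertical_restriction frechet_derivative_linear)
  have "((\<lambda>y. (fst y, l *s snd y)) has_derivative (\<lambda>u. (fst u, l *s snd u))) (at (z, v))"
    by (intro derivative_intros bounded_linear.has_derivative[OF bounded_linear_smult_right]
        has_derivative_snd has_derivative_ident)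
  moreover have "(F has_derivative frechet_derivative F (at (z, l *s v)))
      (at (fst (z, v), l *s snd (z, v)))"
    using F z lv by (simp add: frechet_derivative_works[symmetric])
  ultimately have "((\<lambda>y. F (fst y, l *s snd y))
      has_derivative (\<lambda>u. frechet_derivative F (at (z, l *s v)) (fst u, l *s snd u))) (at (z, v))"
    by (rule has_derivative_compose)
  then have "((\<lambda>y. c * F y) has_derivative (\<lambda>u. frechet_derivative F (at (z, l *s v))
      (fst u, l *s snd u))) (at (z, v))"
    by (rule has_derivative_transform_within_open[where s = "U \<times> - {0}"])
        (use z v in \<open>auto intro!: open_Times U open_Compl hom\<close>)
  moreover have "((\<lambda>y. c * F y) has_derivative (\<lambda>u. c * frechet_derivative F (at (z, v)) u)) (at (z, v))"
    using F z v by (intro has_derivative_mult_right) (simp add: frechet_derivative_works[symmetric])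
  ultimately have "(\<lambda>u. frechet_derivative F (at (z, l *s v)) (fst u, l *s snd u))
      = (\<lambda>u. c * frechet_derivative F (at (z, v)) u)"
    by (rule has_derivative_unique)
  from fun_cong[OF this, of "(0, _)"] have key: "L1 (l *s u) = c * L2 u" for u
    by (simp add: L1_def L2_def)
  have com: "\<i> *s (l *s u) = l *s (\<i> *s u)" for u :: "complex^'n"
      by (simp add: Finite_Cartesian_Product.vec_eq_iff)
  have "complex_linear_part L1 (l *s u) = c * complex_linear_part L2 u" "conj_linear_part L1 (l *s u)
      = c * conj_linear_part L2 u" for u
    unfolding complex_linear_part_def conj_linear_part_def com key by (simp_all add: field_simps)
  then have "l * complex_linear_part L1 u = c * complex_linear_part L2 u" "cnj l * conj_linear_part L1 u
      = c * conj_linear_part L2 u" for u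
    unfolding complex_linear_part_smult[OF lin(1)] conj_linear_part_smult[OF lin(1)] by auto
  then show "dv i F (z, l *s v) = c / l * dv i F (z, v)" "dvbar i F (z, l *s v) = c / cnj l
      * dvbar i F (z, v)"
    using l unfolding dv_eq_complex_linear_part dvbar_eq_conj_linear_part L1_def[symmetric]
        L2_def[symmetric] 
    by (simp_all add: field_simps)
qed


text \<open>The factor \<open>(h' 1 - \<i> * h' \<i>) / 2\<close> is the holomorphic derivative of \<open>h\<close> at \<open>1\<close>.\<close>

lemma euler_contract:
  fixes F :: "(complex^'n::finite) \<times> (complex^'n) \<Rightarrow> complex"
  assumes F: "F differentiable (at (z, v))"
    and hom: "\<And>l. l \<noteq> 0 \<Longrightarrow> F (z, l *s v) = h l * F (z, v)"
    and h: "(h has_derivative h') (at 1)"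
  shows "(\<Sum>i\<in>UNIV. v $ i * dv i F (z, v)) = (h' 1 - \<i> * h' \<i>) / 2 * F (z, v)"
proof -
  let ?L = "\<lambda>u. frechet_derivative F (at (z, v)) (0, u)"
  have "(\<Sum>i\<in>UNIV. v $ i * dv i F (z, v)) = complex_linear_part ?L v"
    unfolding dv_eq_complex_linear_part
    by (rule complex_linear_part_expand[symmetric])
        (intro linear_vertical_restriction frechet_derivative_linear F)
  also have "\<dots> = (h' 1 - \<i> * h' \<i>) / 2 * F (z, v)"
    using euler_homogeneous[OF assms, of 1] euler_homogeneous[OF assms, of \<i>]
    by (simp add: complex_linear_part_def field_simps)
  finally show ?thesis .
qed

section \<open>A complex Finsler metric in a bundle chart\<close>

locale local_finsler =
  fixes U :: "(complex^'n::finite) set" and g :: "(complex^'n) \<times> (complex^'n) \<Rightarrow> real"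
  assumes open_U: "open U"
    and smooth: "Cinf_on (U \<times> - {0}) g"
    and homogeneous: "z \<in> U \<Longrightarrow> v \<noteq> 0 \<Longrightarrow> l \<noteq> 0 \<Longrightarrow> g (z, l *s v) = (cmod l)\<^sup>2 * g (z, v)"
    and positive: "z \<in> U \<Longrightarrow> v \<noteq> 0 \<Longrightarrow> 0 < g (z, v)"
    and levi_positive_definite: "x \<in> U \<times> - {0} \<Longrightarrow> positive_definite (levi_matrix g x)"
begin

abbreviation gc :: "(complex^'n) \<times> (complex^'n) \<Rightarrow> complex" where "gc \<equiv> \<lambda>y. complex_of_real (g y)"

lemma open_slit: "open (U \<times> - {0 :: complex^'n})"
  by (intro open_Times open_U open_Compl) simp

lemma smooth_gc: "Cinf_on (U \<times> - {0}) gc"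
  by (rule Cinf_on_of_real[OF open_slit smooth])

lemmas smooth_dv = Cinf_on_dv[OF open_slit] and smooth_dvbar = Cinf_on_dvbar[OF open_slit]
  and smooth_dz = Cinf_on_dz[OF open_slit]

lemma levi_component: "levi_matrix g x $ i $ j = dv i (dvbar j gc) x"
  by (simp add: levi_matrix_def)

lemma smooth_levi: "Cinf_on (U \<times> - {0}) (\<lambda>x. levi_matrix g x $ i $ j)"
  unfolding levi_component using smooth_dv[OF smooth_dvbar[OF smooth_gc]] .

lemma gc_homogeneous: "z \<in> U \<Longrightarrow> v \<noteq> 0 \<Longrightarrow> l \<noteq> 0 \<Longrightarrow> gc (z, l *s v) = l * cnj l * gc (z, v)"
  by (simp add: homogeneous complex_norm_square[symmetric] del: of_real_power)

lemma dvbar_gc_homogeneous: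
  assumes "z \<in> U" "v \<noteq> 0" "l \<noteq> 0"
  shows "dvbar j gc (z, l *s v) = l * dvbar j gc (z, v)"
  using dvbar_homogeneous[OF open_U assms Cinf_on_differentiable[OF smooth_gc]
      gc_homogeneous[OF _ _ assms(3)]] assms(3)
  by simp

lemma levi_homogeneous:
  assumes "z \<in> U" "v \<noteq> 0" "l \<noteq> 0"
  shows "levi_matrix g (z, l *s v) $ i $ j = levi_matrix g (z, v) $ i $ j"
  unfolding levi_component
  using dv_homogeneous[OF open_U assms Cinf_on_differentiable[OF smooth_dvbar[OF smooth_gc]]
      dvbar_gc_homogeneous[OF _ _ assms(3)]] assms(3)
  by simp

lemma euler_gc:
  assumes "z \<in> U" "v \<noteq> 0"
  shows "(\<Sum>i\<in>UNIV. v $ i * dv i gc (z, v)) = gc (z, v)"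
proof -
  have "((\<lambda>l. l * cnj l) has_derivative (\<lambda>a. 1 * cnj a + a * cnj 1)) (at 1)"
    by (intro has_derivative_mult has_derivative_ident bounded_linear.has_derivative[OF bounded_linear_cnj])
  from euler_contract[OF Cinf_on_differentiable[OF smooth_gc] gc_homogeneous this] assms show ?thesis
      by simp
qed

text \<open>The fibre derivative \<open>dvbar j gc\<close> satisfies \<open>F (l v) = l F (v)\<close>, so the Euler relation
  reproduces it.\<close>

lemma levi_contract_left:
  assumes "z \<in> U" "v \<noteq> 0"
  shows "(\<Sum>i\<in>UNIV. v $ i * levi_matrix g (z, v) $ i $ j) = dvbar j gc (z, v)"
proof -
  have "(\<Sum>i\<in>UNIV. v $ i * dv i (dvbar j gc) (z, v)) = (1 - \<i> * \<i>) / 2 * dvbar j gc (z, v)"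
    by (rule euler_contract[where h = "\<lambda>l. l" and h' = "\<lambda>a. a"])
       (use assms in \<open>auto intro!: Cinf_on_differentiable[OF smooth_dvbar[OF smooth_gc]]
           dvbar_gc_homogeneous\<close>)
  then show ?thesis by (simp add: levi_component)
qed

text \<open>The Levi matrix is homogeneous of degree \<open>0\<close>.\<close>

lemma levi_euler:
  assumes "z \<in> U" "v \<noteq> 0"
  shows "(\<Sum>l\<in>UNIV. v $ l * dv l (\<lambda>y. levi_matrix g y $ i $ j) (z, v)) = 0"
proof -
  have "(\<Sum>l\<in>UNIV. v $ l * dv l (\<lambda>y. levi_matrix g y $ i $ j) (z, v)) = (0 - \<i> * 0) / 2
      * levi_matrix g (z, v) $ i $ j"
    by (rule euler_contract[where h = "\<lambda>_. 1" and h' = "\<lambda>_. 0"])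
       (use assms in \<open>auto intro!: Cinf_on_differentiable[OF smooth_levi] simp: levi_homogeneous\<close>)
  then show ?thesis by simp
qed

lemma levi_hermitian: "x \<in> U \<times> - {0} \<Longrightarrow> levi_matrix g x $ j $ i = cnj (levi_matrix g x $ i $ j)"
  using levi_positive_definite unfolding positive_definite_def by blast

lemma levi_pos: "x \<in> U \<times> - {0} \<Longrightarrow> \<xi> \<noteq> 0 \<Longrightarrow>
    0 < Re (\<Sum>i\<in>UNIV. \<Sum>j\<in>UNIV. levi_matrix g x $ i $ j * \<xi> $ i * cnj (\<xi> $ j))"
  using levi_positive_definite unfolding positive_definite_def by blast

lemma levi_contract_right:
  assumes "z \<in> U" "v \<noteq> 0"
  shows "(\<Sum>j\<in>UNIV. levi_matrix g (z, v) $ i $ j * cnj (v $ j)) = dv i gc (z, v)"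
proof -
  have "(\<Sum>j\<in>UNIV. levi_matrix g (z, v) $ i $ j * cnj (v $ j))
      = cnj (\<Sum>j\<in>UNIV. v $ j * levi_matrix g (z, v) $ j $ i)"
    using assms levi_hermitian[of "(z, v)" _ i] by (simp add: mult.commute)
  also have "\<dots> = dv i gc (z, v)"
    using assms by (simp add: levi_contract_left dvbar_of_real Cinf_on_differentiable[OF smooth])
  finally show ?thesis .
qed

lemma levi_kernel:
  assumes "x \<in> U \<times> - {0}" "\<And>j. (\<Sum>i\<in>UNIV. levi_matrix g x $ i $ j * \<xi> $ i) = 0"
  shows "\<xi> = 0"
proof (rule ccontr)
  assume "\<xi> \<noteq> 0"
  have "(\<Sum>i\<in>UNIV. \<Sum>j\<in>UNIV. levi_matrix g x $ i $ j * \<xi> $ i * cnj (\<xi> $ j)) =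
      (\<Sum>j\<in>UNIV. (\<Sum>i\<in>UNIV. levi_matrix g x $ i $ j * \<xi> $ i) * cnj (\<xi> $ j))"
    by (subst sum.swap) (simp add: sum_distrib_right)
  also have "\<dots> = 0" by (simp add: assms(2))
  finally show False using levi_pos[OF assms(1) \<open>\<xi> \<noteq> 0\<close>] by simp
qed

lemma levi_transpose_mult: "(transpose (levi_matrix g x) *v \<xi>) $ j
    = (\<Sum>i\<in>UNIV. levi_matrix g x $ i $ j * \<xi> $ i)"
  by (simp add: matrix_vector_mult_def Finite_Cartesian_Product.transpose_def)

lemma levi_invertible:
  assumes "x \<in> U \<times> - {0}"
  shows "invertible (transpose (levi_matrix g x))"
  unfolding invertible_left_inverse matrix_left_invertible_ker
proof (intro allI impI)
  fix \<xi> assume "transpose (levi_matrix g x) *v \<xi> = 0"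
  from arg_cong[OF this, of "\<lambda>w. w $ j" for j] show "\<xi> = 0"
    by (intro levi_kernel[OF assms]) (simp only: levi_transpose_mult zero_index)
qed

lemma nconn_eq_matrix_inv:
  "nconn g i j x = (matrix_inv (transpose (levi_matrix g x)) *v (\<chi> k. dvbar k (dz j gc) x)) $ i"
  by (simp add: nconn_def levi_inverse_def matrix_vector_mult_def)

text \<open>The connection coefficients are characterised as the solution of a linear system. This form is
  convenient for verifying a proposed solution and for Cramer's rule.\<close>

lemma nconn_solves:
  assumes "x \<in> U \<times> - {0}"
  shows "(\<Sum>i\<in>UNIV. levi_matrix g x $ i $ k * nconn g i j x) = dvbar k (dz j gc) x"
proof -
  let ?A = "transpose (levi_matrix g x)" and ?b = "\<chi> k. dvbar k (dz j gc) x"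
  have "?A *v (matrix_inv ?A *v ?b) = ?b"
  proof -
    have "?A ** matrix_inv ?A = Finite_Cartesian_Product.mat 1"
      using levi_invertible[OF assms] unfolding invertible_def matrix_inv_def by (rule someI2_ex) simp
    then show ?thesis by (simp add: matrix_vector_mul_assoc)
  qed
  from arg_cong[OF this, of "\<lambda>w. w $ k"] show ?thesis
    by (simp only: levi_transpose_mult nconn_eq_matrix_inv vec_lambda_beta)
qed

lemma nconn_eqI:
  assumes x: "x \<in> U \<times> - {0}"
    and eq: "\<And>k. (\<Sum>i\<in>UNIV. levi_matrix g x $ i $ k * n i) = dvbar k (dz j gc) x"
  shows "nconn g i j x = n i"
proof -
  have "(\<chi> i. nconn g i j x - n i) = 0"
    by (rule levi_kernel[OF x]) (simp add: right_diff_distrib sum_subtractf eq nconn_solves[OF x])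
  then show ?thesis by (simp add: Finite_Cartesian_Product.vec_eq_iff)
qed

lemma log_levi:
  assumes x: "x \<in> U \<times> - {0}"
  shows "levi_matrix (\<lambda>y. ln (g y)) x $ i $ j =
    (levi_matrix g x $ i $ j * gc x - dv i gc x * dvbar j gc x) / (gc x)\<^sup>2"
proof -
  have pos: "0 < g y" if "y \<in> U \<times> - {0}" for y using positive that by auto
  have ninR: "gc y \<notin> \<real>\<^sub>\<le>\<^sub>0" if "y \<in> U \<times> - {0}" for y using pos[OF that] by simp
  note diff = Cinf_on_differentiable[OF smooth_gc] Cinf_on_differentiable[OF smooth_dvbar[OF smooth_gc]]
  have 1: "dvbar j (\<lambda>y. complex_of_real (ln (g y))) y = inverse (gc y) * dvbar j gc y"
      if y: "y \<in> U \<times> - {0}" for y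
  proof -
    have "dvbar j (\<lambda>y. complex_of_real (ln (g y))) y = dvbar j (\<lambda>y. Ln (gc y)) y"
      by (rule dvbar_cong_open[OF open_slit y]) (use pos in \<open>simp add: Ln_of_real\<close>)
    also have "\<dots> = inverse (gc y) * dvbar j gc y"
      by (rule dvbar_chain[OF diff(1)[OF y]]) (use has_field_derivative_Ln[OF ninR[OF y]] in simp)
    finally show ?thesis .
  qed
  have 2: "dv i (\<lambda>y. inverse (gc y)) x = - (inverse (gc x))\<^sup>2 * dv i gc x"
    by (rule dv_chain[OF diff(1)[OF x]])
       (use pos[OF x] in \<open>auto intro!: derivative_eq_intros simp: power2_eq_square\<close>)
  have 3: "(\<lambda>y. inverse (gc y)) differentiable (at x)"
    using diff(1)[OF x] pos[OF x] by (intro differentiable_inverse) auto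
  have "levi_matrix (\<lambda>y. ln (g y)) x $ i $ j = dv i (\<lambda>y. inverse (gc y) * dvbar j gc y) x"
    unfolding levi_matrix_def by (simp add: dv_cong_open[OF open_slit x 1])
  also have "\<dots> = - (inverse (gc x))\<^sup>2 * dv i gc x * dvbar j gc x + inverse (gc x) * levi_matrix g x $ i $ j"
    by (subst dv_mult[OF 3 diff(2)[OF x]]) (simp add: 2 levi_component)
  also have "\<dots> = (levi_matrix g x $ i $ j * gc x - dv i gc x * dvbar j gc x) / (gc x)\<^sup>2"
    using pos[OF x] by (simp add: field_simps power2_eq_square)
  finally show ?thesis .
qed

end

section \<open>Conformal changes by functions on the base\<close>

locale conformal_pair = local_finsler U g + g2: local_finsler U g2
  for U :: "(complex^'n::finite) set" and g g2 +
  fixes \<phi> :: "complex^'n \<Rightarrow> real"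
  assumes smooth_factor: "Cinf_on U \<phi>"
    and conformal: "z \<in> U \<Longrightarrow> v \<noteq> 0 \<Longrightarrow> g2 (z, v) = exp (\<phi> z) * g (z, v)"
begin

abbreviation \<phi>c :: "(complex^'n) \<times> (complex^'n) \<Rightarrow> complex" where "\<phi>c \<equiv> \<lambda>y. complex_of_real (\<phi> (fst y))"
abbreviation e\<phi> :: "(complex^'n) \<times> (complex^'n) \<Rightarrow> complex" where "e\<phi> \<equiv> \<lambda>y. exp (\<phi>c y)"

lemma smooth_\<phi>c: "Cinf_on (U \<times> - {0}) \<phi>c"
  by (intro Cinf_on_of_real open_slit Cinf_on_fst open_U smooth_factor open_Compl) simp

lemma \<phi>_diff: "z \<in> U \<Longrightarrow> (\<lambda>z. complex_of_real (\<phi> z)) differentiable (at z)"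
  by (rule Cinf_on_differentiable[OF Cinf_on_of_real[OF open_U smooth_factor]])

lemma e\<phi>_derivatives:
  assumes x: "x \<in> U \<times> - {0}"
  shows "e\<phi> differentiable (at x)" "dz k e\<phi> x = e\<phi> x * dz k \<phi>c x" "dv k e\<phi> x = 0" "dvbar k e\<phi> x = 0"
proof -
  note d = Cinf_on_differentiable[OF smooth_\<phi>c x]
  show "e\<phi> differentiable (at x)"
    using differentiable_chain[OF d DERIV_exp] .
  show "dz k e\<phi> x = e\<phi> x * dz k \<phi>c x" by (rule dz_chain[OF d DERIV_exp])
  have "fst x \<in> U" using x by auto
  show "dv k e\<phi> x = 0" "dvbar k e\<phi> x = 0"
    using dv_chain[OF d DERIV_exp, of k] dvbar_chain[OF d DERIV_exp, of k]
      dv_fst[OF \<phi>_diff[OF \<open>fst x \<in> U\<close>], of k] dvbar_fst[OF \<phi>_diff[OF \<open>fst x \<in> U\<close>], of k] by simp_all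
qed

lemma conformal_gc: "y \<in> U \<times> - {0} \<Longrightarrow> g2.gc y = e\<phi> y * gc y"
  by (cases y) (simp add: conformal exp_of_real)

lemma dvbar_conformal:
  assumes x: "x \<in> U \<times> - {0}"
  shows "dvbar j g2.gc x = e\<phi> x * dvbar j gc x"
proof -
  have "dvbar j g2.gc x = dvbar j (\<lambda>y. e\<phi> y * gc y) x"
    by (rule dvbar_cong_open[OF open_slit x conformal_gc])
  then show ?thesis
    by (simp add: dvbar_mult[OF e\<phi>_derivatives(1)[OF x] Cinf_on_differentiable[OF smooth_gc x]]
        e\<phi>_derivatives[OF x])
qed

lemma levi_conformal:
  assumes x: "x \<in> U \<times> - {0}"
  shows "levi_matrix g2 x $ i $ j = e\<phi> x * levi_matrix g x $ i $ j"
proof -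
  have "dv i (dvbar j g2.gc) x = dv i (\<lambda>y. e\<phi> y * dvbar j gc y) x"
    by (rule dv_cong_open[OF open_slit x dvbar_conformal])
  then show ?thesis unfolding g2.levi_component levi_component
    by (simp add: dv_mult[OF e\<phi>_derivatives(1)[OF x]
        Cinf_on_differentiable[OF smooth_dvbar[OF smooth_gc] x]] e\<phi>_derivatives[OF x])
qed

lemma dz_conformal:
  assumes x: "x \<in> U \<times> - {0}"
  shows "dz j g2.gc x = e\<phi> x * (dz j \<phi>c x * gc x + dz j gc x)"
proof -
  have "dz j g2.gc x = dz j (\<lambda>y. e\<phi> y * gc y) x"
    by (rule dz_cong_open[OF open_slit x conformal_gc])
  then show ?thesis
    unfolding dz_mult[OF e\<phi>_derivatives(1)[OF x] Cinf_on_differentiable[OF smooth_gc x]]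
    by (simp add: e\<phi>_derivatives[OF x] algebra_simps)
qed

text \<open>\<open>dz j \<phi>c\<close> is again a function of the base point.\<close>

lemma dvbar_dz_\<phi>c:
  assumes x: "x \<in> U \<times> - {0}"
  shows "dvbar k (dz j \<phi>c) x = 0"
proof -
  define \<psi> where "\<psi> z = (frechet_derivative (\<lambda>z. complex_of_real (\<phi> z)) (at z) (axis j 1) -
    \<i> * frechet_derivative (\<lambda>z. complex_of_real (\<phi> z)) (at z) (axis j \<i>)) / 2" for z
  have "dz j \<phi>c y = \<psi> (fst y)" if "y \<in> U \<times> - {0}" for y
  proof -
    have "fst y \<in> U" using that by auto
    from frechet_derivative_fst(2)[OF \<phi>_diff[OF this]] show ?thesis
      by (simp add: dz_def wirt_def \<psi>_def)
  qed
  hence "dvbar k (dz j \<phi>c) x = dvbar k (\<lambda>y. \<psi> (fst y)) x" by (rule dvbar_cong_open[OF open_slit x])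
  also have "\<dots> = 0"
  proof (rule dvbar_fst)
    have "fst x \<in> U" using x by auto
    moreover have "(\<lambda>z. frechet_derivative (\<lambda>z. complex_of_real (\<phi> z)) (at z) u) differentiable
        (at (fst x))" for u
      by (rule Cinf_on_differentiable[OF Cinf_on_frechet[OF Cinf_on_of_real[OF open_U smooth_factor]]
          \<open>fst x \<in> U\<close>])
    ultimately show "\<psi> differentiable (at (fst x))" unfolding \<psi>_def[abs_def]
      by (intro differentiable_divide differentiable_diff differentiable_mult differentiable_const) auto
  qed
  finally show ?thesis .
qed

lemma dvbar_dz_conformal:
  assumes x: "x \<in> U \<times> - {0}"
  shows "dvbar k (dz j g2.gc) x = e\<phi> x * (dz j \<phi>c x * dvbar k gc x + dvbar k (dz j gc) x)"
proof -
  note d = e\<phi>_derivatives(1)[OF x] Cinf_on_differentiable[OF smooth_gc x]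
    Cinf_on_differentiable[OF smooth_dz[OF smooth_gc] x]
        Cinf_on_differentiable[OF smooth_dz[OF smooth_\<phi>c] x]
  have "dvbar k (\<lambda>y. dz j \<phi>c y * gc y + dz j gc y) x = dz j \<phi>c x * dvbar k gc x + dvbar k (dz j gc) x"
    by (subst dvbar_add) (use d in \<open>auto intro: differentiable_mult simp: dvbar_mult dvbar_dz_\<phi>c[OF x]\<close>)
  moreover have "dvbar k (\<lambda>y. e\<phi> y * (dz j \<phi>c y * gc y + dz j gc y)) x =
      dvbar k e\<phi> x * (dz j \<phi>c x * gc x + dz j gc x) + e\<phi> x * dvbar k (\<lambda>y. dz j \<phi>c y * gc y + dz j gc y) x"
    using d by (intro dvbar_mult differentiable_add differentiable_mult) auto
  moreover have "dvbar k (dz j g2.gc) x = dvbar k (\<lambda>y. e\<phi> y * (dz j \<phi>c y * gc y + dz j gc y)) x"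
    by (rule dvbar_cong_open[OF open_slit x dz_conformal])
  ultimately show ?thesis by (simp add: e\<phi>_derivatives[OF x])
qed

text \<open>The system for the new coefficients has the additional right-hand side
  \<open>(dz j \<phi>c) * (dvbar k gc)\<close>, and \<open>dvbar k gc\<close> is the Levi matrix applied to \<open>v\<close>.\<close>

lemma nconn_conformal:
  assumes x: "x \<in> U \<times> - {0}"
  shows "nconn g2 i j x = nconn g i j x + dz j \<phi>c x * snd x $ i"
proof (rule g2.nconn_eqI[OF x])
  fix k
  obtain z v where zv: "x = (z, v)" "z \<in> U" "v \<noteq> 0" using x by auto
  have "(\<Sum>i\<in>UNIV. levi_matrix g x $ i $ k * snd x $ i) = dvbar k gc x"
    using levi_contract_left[OF zv(2,3), of k] zv(1) by (simp add: mult.commute)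
  moreover have "(\<Sum>i\<in>UNIV. levi_matrix g2 x $ i $ k * (nconn g i j x + dz j \<phi>c x * snd x $ i)) =
     e\<phi> x * ((\<Sum>i\<in>UNIV. levi_matrix g x $ i $ k * nconn g i j x) + dz j \<phi>c x
         * (\<Sum>i\<in>UNIV. levi_matrix g x $ i $ k * snd x $ i))"
    by (simp add: levi_conformal[OF x] sum_distrib_left sum.distrib algebra_simps)
  ultimately show "(\<Sum>i\<in>UNIV. levi_matrix g2 x $ i $ k * (nconn g i j x + dz j \<phi>c x * snd x $ i))
      = dvbar k (dz j g2.gc) x"
    by (simp add: dvbar_dz_conformal[OF x] nconn_solves[OF x] add.commute)
qed

text \<open>The change of the connection contributes \<open>v\<^sup>l dv l\<close> of the Levi matrix, which vanishes by
  \<open>levi_euler\<close>.\<close>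

lemma delta_levi_conformal:
  assumes x: "x \<in> U \<times> - {0}"
  shows "delta g2 k (\<lambda>y. levi_matrix g2 y $ i $ j) x =
    e\<phi> x * (dz k \<phi>c x * levi_matrix g x $ i $ j + delta g k (\<lambda>y. levi_matrix g y $ i $ j) x)"
proof -
  obtain z v where zv: "x = (z, v)" "z \<in> U" "v \<noteq> 0" using x by auto
  let ?H = "\<lambda>y. levi_matrix g y $ i $ j"
  note d = e\<phi>_derivatives(1)[OF x] Cinf_on_differentiable[OF smooth_levi x]
  have 1: "dz k (\<lambda>y. levi_matrix g2 y $ i $ j) x = e\<phi> x * (dz k \<phi>c x * ?H x + dz k ?H x)"
  proof -
    have "dz k (\<lambda>y. levi_matrix g2 y $ i $ j) x = dz k (\<lambda>y. e\<phi> y * ?H y) x"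
      by (rule dz_cong_open[OF open_slit x levi_conformal])
    then show ?thesis by (simp add: dz_mult[OF d] e\<phi>_derivatives[OF x] algebra_simps)
  qed
  have 2: "dv l (\<lambda>y. levi_matrix g2 y $ i $ j) x = e\<phi> x * dv l ?H x" for l
  proof -
    have "dv l (\<lambda>y. levi_matrix g2 y $ i $ j) x = dv l (\<lambda>y. e\<phi> y * ?H y) x"
      by (rule dv_cong_open[OF open_slit x levi_conformal])
    then show ?thesis by (simp add: dv_mult[OF d] e\<phi>_derivatives[OF x])
  qed
  have "(\<Sum>l\<in>UNIV. nconn g2 l k x * dv l (\<lambda>y. levi_matrix g2 y $ i $ j) x) =
    e\<phi> x * (\<Sum>l\<in>UNIV. nconn g l k x * dv l ?H x) + e\<phi> x * dz k \<phi>c x * (\<Sum>l\<in>UNIV. snd x $ l * dv l ?H x)"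
    by (simp add: 2 nconn_conformal[OF x] sum_distrib_left sum.distrib algebra_simps)
  also have "(\<Sum>l\<in>UNIV. snd x $ l * dv l ?H x) = 0" using levi_euler[OF zv(2,3)] zv(1) by simp
  finally show ?thesis by (simp add: delta_def 1 algebra_simps)
qed

end

section \<open>Kaehler metrics and conformal changes\<close>

text \<open>The form \<open>\<partial>\<^sub>H \<omega>\<^sub>H\<close> has type (2,1) and its conjugate has type (1,2), so multiplying all arguments
  by \<open>\<i>\<close> multiplies the former by \<open>\<i>\<close> and the latter by \<open>- \<i>\<close>; a vanishing sum forces both to
  vanish. In the same way, the last argument \<open>\<i> e\<^sub>j\<close> in place of \<open>e\<^sub>j\<close> separates the terms in
  which \<open>dzbar\<close> meets the last argument, and these are the antisymmetrized coefficients.\<close>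

lemma kaehler_symmetric:
  assumes "\<And>X. d_H_omega_H g x X = 0"
  shows "delta g k (\<lambda>y. levi_matrix g y $ i $ j) x = delta g i (\<lambda>y. levi_matrix g y $ k $ j) x"
proof -
  define T where "T k i j = delta g k (\<lambda>y. levi_matrix g y $ i $ j) x" for k i j
  (* B is the antisymmetrization of the trilinear M *)
  define M where "M p q r = (\<Sum>k\<in>UNIV. \<Sum>i\<in>UNIV. \<Sum>j\<in>UNIV. T k i j * (p $ k * q $ i * cnj (r $ j)))"
    for p q r :: "complex^'a"
  define B where "B p q r = M p q r + M q r p + M r p q - M q p r - M p r q - M r q p" for p q r
  have w: "wedge 1 [form_dz k, form_dz i, form_cnj (form_dz j)] X =
      fst (X 0) $ k * fst (X 1) $ i * cnj (fst (X 2) $ j) + fst (X 1) $ k * fst (X 2) $ i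
          * cnj (fst (X 0) $ j)
    + fst (X 2) $ k * fst (X 0) $ i * cnj (fst (X 1) $ j) - fst (X 1) $ k * fst (X 0) $ i
        * cnj (fst (X 2) $ j)
    - fst (X 0) $ k * fst (X 2) $ i * cnj (fst (X 1) $ j) - fst (X 2) $ k * fst (X 1) $ i
        * cnj (fst (X 0) $ j)"
    for k i j and X :: "nat \<Rightarrow> (complex^'a) \<times> (complex^'a)"
    by (rule wedge_three) (simp_all add: form_dz_def form_cnj_def)
  have del: "del_H_omega_H g x (\<lambda>n. if n = 0 then (p, 0) else if n = 1 then (q, 0) else (r, 0)) = \<i>
      * B p q r" for p q r
  proof -
    define X where "X = (\<lambda>n::nat. if n = 0 then (p, 0 :: complex^'a) else if n = 1 then (q, 0) else (r, 0))"
    have X: "X 0 = (p, 0)" "X 1 = (q, 0)" "X 2 = (r, 0)" by (simp_all add: X_def)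
    have "del_H_omega_H g x X = \<i> * B p q r"
      unfolding del_H_omega_H_def w T_def[symmetric] X fst_conv B_def M_def
      by (simp only: sum.distrib[symmetric] sum_subtractf[symmetric] distrib_left right_diff_distrib)
    then show ?thesis by (simp add: X_def)
  qed
  have M_axis: "M (axis K a) (axis I b) (axis J c) = T K I J * a * b * cnj c" for K I J a b c
  proof -
    have j: "(\<Sum>j\<in>UNIV. f j * cnj (axis J c $ j)) = f J * cnj c" for f :: "'a \<Rightarrow> complex"
    proof -
      have "(\<Sum>j\<in>UNIV. f j * cnj (axis J c $ j)) = (\<Sum>j\<in>UNIV. if j = J then f J * cnj c else 0)"
        by (intro sum.cong) (auto simp: axis_def)
      then show ?thesis by simp
    qed
    have i: "(\<Sum>j\<in>UNIV. f j * axis J c $ j) = f J * c" for f :: "'a \<Rightarrow> complex" and J c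
    proof -
      have "(\<Sum>j\<in>UNIV. f j * axis J c $ j) = (\<Sum>j\<in>UNIV. if j = J then f J * c else 0)"
        by (intro sum.cong) (auto simp: axis_def)
      then show ?thesis by simp
    qed
    have "M (axis K a) (axis I b) (axis J c) =
      (\<Sum>k\<in>UNIV. (\<Sum>i\<in>UNIV. (\<Sum>j\<in>UNIV. T k i j * cnj (axis J c $ j)) * axis I b $ i) * axis K a $ k)"
      unfolding M_def sum_distrib_right by (simp only: ac_simps)
    then show ?thesis unfolding j i by simp
  qed
  have M_i: "M (\<i> *s p) (\<i> *s q) (\<i> *s r) = \<i> * M p q r" for p q r
  proof -
    have "(\<i> *s p) $ k * (\<i> *s q) $ i * cnj ((\<i> *s r) $ j) = (\<i> * \<i> * cnj \<i>)
        * (p $ k * q $ i * cnj (r $ j))" for k i j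
      by (simp only: vector_smult_component complex_cnj_mult ac_simps)
    moreover have "\<i> * \<i> * cnj \<i> = \<i>" by simp
    ultimately have "T k i j * ((\<i> *s p) $ k * (\<i> *s q) $ i * cnj ((\<i> *s r) $ j)) = \<i>
        * (T k i j * (p $ k * q $ i * cnj (r $ j)))" for k i j
      by (simp only: mult.left_commute[of "T k i j"])
    then show ?thesis unfolding M_def sum_distrib_left by (simp only:)
  qed
  have B_i: "B (\<i> *s p) (\<i> *s q) (\<i> *s r) = \<i> * B p q r" for p q r
    unfolding B_def M_i by (simp add: algebra_simps)
  have eq: "\<i> * B p q r + cnj (\<i> * B p q r) = 0" for p q r
    using assms[of "\<lambda>n. if n = 0 then (p, 0) else if n = 1 then (q, 0) else (r, 0)"]
    unfolding d_H_omega_H_def form_cnj_def del .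
  have B0: "B p q r = 0" for p q r
    using eq[of p q r] eq[of "\<i> *s p" "\<i> *s q" "\<i> *s r"] unfolding B_i
    by (simp add: complex_eq_iff)
  have "T k i j - T i k j = 0"
    using B0[of "axis k 1" "axis i 1" "axis j 1"] B0[of "axis k 1" "axis i 1" "axis j \<i>"]
    unfolding B_def M_axis by (simp add: complex_eq_iff)
  then show ?thesis by (simp add: T_def)
qed

lemma (in conformal_pair) conformal_kaehler_derivative_zero:
  assumes n: "CARD('n) \<ge> 2" and z: "z \<in> U"
    and K1: "\<And>x X. x \<in> U \<times> - {0} \<Longrightarrow> d_H_omega_H g x X = 0"
    and K2: "\<And>x X. x \<in> U \<times> - {0} \<Longrightarrow> d_H_omega_H g2 x X = 0"
  shows "(\<phi> has_derivative (\<lambda>_. 0)) (at z)"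
proof -
  (* the relation is evaluated at some nonzero fibre vector *)
  define v :: "complex^'n" where "v = (\<chi> i. 1)"
  have "v \<noteq> 0" by (simp add: v_def Finite_Cartesian_Product.vec_eq_iff)
  define x where "x = (z, v)"
  have x: "x \<in> U \<times> - {0}" using z \<open>v \<noteq> 0\<close> by (simp add: x_def)
  let ?f = "\<lambda>k. dz k \<phi>c x"
  have sym: "?f k * levi_matrix g x $ i $ j = ?f i * levi_matrix g x $ k $ j" for i j k
    using kaehler_symmetric[OF K1[OF x], of k i j] kaehler_symmetric[OF K2[OF x], of k i j]
    unfolding delta_levi_conformal[OF x] by simp
  have f0: "?f k = 0" for k
  proof (rule ccontr)
    assume nz: "?f k \<noteq> 0"
    obtain i where "i \<noteq> k"
    proof -
      have "\<not> UNIV \<subseteq> {k}" using n card_mono[of "{k}" UNIV] by auto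
      then show ?thesis using that by auto
    qed
    (* a kernel vector of the Levi matrix, nonzero at i *)
    define \<xi> :: "complex^'n" where "\<xi> = (\<chi> l. if l = i then ?f k else if l = k then - ?f i else 0)"
    have "(\<Sum>l\<in>UNIV. levi_matrix g x $ l $ j * \<xi> $ l) = 0" for j
    proof -
      have "(\<Sum>l\<in>UNIV. levi_matrix g x $ l $ j * \<xi> $ l)
          = (\<Sum>l\<in>UNIV. (if l = i then levi_matrix g x $ i $ j * ?f k else 0)
          + (if l = k then - (levi_matrix g x $ k $ j * ?f i) else 0))"
        using \<open>i \<noteq> k\<close> by (intro sum.cong) (auto simp: \<xi>_def)
      also have "\<dots> = 0" using sym[of k i j] by (simp add: sum.distrib mult.commute)
      finally show ?thesis .
    qed
    from levi_kernel[OF x this] have "\<xi> $ i = 0" by simp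
    then show False using nz by (simp add: \<xi>_def)
  qed
  define D where "D = frechet_derivative \<phi> (at z)"
  have hd: "(\<phi> has_derivative D) (at z)"
    using Cinf_on_differentiable[OF smooth_factor z] by (simp add: D_def frechet_derivative_works)
  have "((\<lambda>z. complex_of_real (\<phi> z)) has_derivative (\<lambda>u. complex_of_real (D u))) (at z)"
    using hd by (rule has_derivative_of_real)
  from frechet_derivative_at[OF this] have "frechet_derivative (\<lambda>z. complex_of_real (\<phi> z)) (at z)
      = (\<lambda>u. complex_of_real (D u))" by simp
  with frechet_derivative_fst(2)[of "\<lambda>z. complex_of_real (\<phi> z)" x] \<phi>_diff[OF z]
  have fd: "frechet_derivative \<phi>c (at x) u = complex_of_real (D (fst u))" for u by (simp add: x_def)
  have "D (axis k 1) = 0 \<and> D (axis k \<i>) = 0" for k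
    using f0[of k] by (simp add: dz_def wirt_def fd complex_eq_iff)
  moreover have "linear D" using has_derivative_linear[OF hd] .
  ultimately have "D u = 0" for u
  proof -
    assume D: "\<And>k. D (axis k 1) = 0 \<and> D (axis k \<i>) = 0" and lin: "linear D"
    have u: "u = (\<Sum>k\<in>UNIV. Re (u $ k) *\<^sub>R axis k 1 + Im (u $ k) *\<^sub>R axis k \<i>)"
      by (simp add: Finite_Cartesian_Product.vec_eq_iff axis_def sum.distrib if_distrib sum.delta'
          complex_eq_iff cong: if_cong)
    show "D u = 0"
      by (subst u) (simp add: linear_sum[OF lin] linear_add[OF lin] linear_scale[OF lin] D)
  qed
  then have "D = (\<lambda>_. 0)" by auto
  then show ?thesis using hd by simp
qed


section \<open>The volume density of the projectivized bundle\<close>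

definition delta_v_coframe :: "((complex^'n) \<times> (complex^'n) \<Rightarrow> real) \<Rightarrow> (complex^'n::finite) \<times>
    (complex^'n) \<Rightarrow> 'n \<Rightarrow>
    (complex^'n) \<times> (complex^'n) \<Rightarrow> complex" where
  "delta_v_coframe g x i Y = snd Y $ i + (\<Sum>k\<in>UNIV. nconn g i k x * fst Y $ k)"

lemma wedge_dz: "wedge 1 [form_dz i, form_cnj (form_dz j)] X =
    fst (X 0) $ i * cnj (fst (X 1) $ j) - fst (X 1) $ i * cnj (fst (X 0) $ j)"
  by (rule wedge_two) (simp_all add: form_dz_def form_cnj_def)

lemma wedge_delta_v: "wedge 1 [form_delta_v g x i, form_cnj (form_delta_v g x j)] X =
    delta_v_coframe g x i (X 0) * cnj (delta_v_coframe g x j (X 1)) - delta_v_coframe g x i (X 1)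
        * cnj (delta_v_coframe g x j (X 0))"
  by (rule wedge_two) (simp_all add: form_dz_def form_delta_v_def delta_v_coframe_def form_cnj_def)

lemma bij_enum_of: "finite S \<Longrightarrow> bij_betw (enum_of S) {..<card S} S"
  using someI_ex[of "\<lambda>h. bij_betw h {..<card S} S"] ex_bij_betw_nat_finite[of S]
  unfolding enum_of_def atLeast0LessThan by blast

lemma affine_frame_even:
  "affine_frame a (2 * s) = (if s < CARD('n) then (axis (enum_of UNIV s) 1, 0)
     else (0, axis (enum_of (- {a}) (s - CARD('n))) 1))" for a :: "'n::finite"
  by (simp add: affine_frame_def Let_def)

lemma affine_frame_odd:
  "fst (affine_frame a (2 * s + 1)) = \<i> *s fst (affine_frame a (2 * s))"
  "snd (affine_frame a (2 * s + 1)) = \<i> *s snd (affine_frame a (2 * s))" for a :: "'n::finite"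
  by (auto simp: affine_frame_def Let_def Finite_Cartesian_Product.vec_eq_iff axis_def)

lemma card_minus_single: "card (- {a}) = CARD('n) - 1" for a :: "'n::finite"
  by (simp add: card_Diff_singleton Compl_eq_Diff_UNIV)

context local_finsler begin

definition log_hessian :: "(complex^'n) \<times> (complex^'n) \<Rightarrow> 'n \<Rightarrow> 'n \<Rightarrow> complex" where
  "log_hessian x i j = levi_matrix (\<lambda>y. ln (g y)) x $ i $ j"

lemma log_hessian_eq: "x \<in> U \<times> - {0} \<Longrightarrow>
    log_hessian x i j = (levi_matrix g x $ i $ j * gc x - dv i gc x * dvbar j gc x) / (gc x)\<^sup>2"
  unfolding log_hessian_def by (rule log_levi)

lemma dvbar_gc: "x \<in> U \<times> - {0} \<Longrightarrow> dvbar j gc x = cnj (dv j gc x)"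
  by (rule dvbar_of_real[OF Cinf_on_differentiable[OF smooth]])

lemma log_hessian_hermitian: "x \<in> U \<times> - {0} \<Longrightarrow> log_hessian x j i = cnj (log_hessian x i j)"
  using levi_hermitian[of x j i] by (simp add: log_hessian_eq dvbar_gc mult.commute)

lemma log_hessian_contract_left:
  assumes "z \<in> U" "v \<noteq> 0"
  shows "(\<Sum>i\<in>UNIV. v $ i * log_hessian (z, v) i j) = 0"
proof -
  have x: "(z, v) \<in> U \<times> - {0}" using assms by simp
  have "(\<Sum>i\<in>UNIV. v $ i * log_hessian (z, v) i j)
      = ((\<Sum>i\<in>UNIV. v $ i * levi_matrix g (z, v) $ i $ j) * gc (z, v) -
      (\<Sum>i\<in>UNIV. v $ i * dv i gc (z, v)) * dvbar j gc (z, v)) / (gc (z, v))\<^sup>2"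
    by (simp add: log_hessian_eq[OF x] sum_divide_distrib sum_distrib_right sum_subtractf
        right_diff_distrib diff_divide_distrib mult.assoc)
  then show ?thesis by (simp add: levi_contract_left[OF assms] euler_gc[OF assms])
qed

lemma log_hessian_contract_right:
  assumes "z \<in> U" "v \<noteq> 0"
  shows "(\<Sum>j\<in>UNIV. log_hessian (z, v) i j * cnj (v $ j)) = 0"
proof -
  have "(\<Sum>j\<in>UNIV. log_hessian (z, v) i j * cnj (v $ j)) = cnj (\<Sum>j\<in>UNIV. v $ j * log_hessian (z, v) j i)"
    using assms log_hessian_hermitian[of "(z, v)" _ i] by (simp add: mult.commute)
  then show ?thesis by (simp add: log_hessian_contract_left[OF assms])
qed

lemma levi_pos_def_on: "x \<in> U \<times> - {0} \<Longrightarrow> pos_def_on UNIV (\<lambda>i j. levi_matrix g x $ i $ j)"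
  unfolding pos_def_on_def
proof (intro conjI ballI allI impI)
  fix \<xi> :: "'n \<Rightarrow> complex" assume x: "x \<in> U \<times> - {0}" and "\<exists>i\<in>UNIV. \<xi> i \<noteq> 0"
  then have "(\<chi> i. \<xi> i) \<noteq> 0" by (auto simp: Finite_Cartesian_Product.vec_eq_iff)
  from levi_pos[OF x this] show "0 < Re (\<Sum>i\<in>UNIV. \<Sum>j\<in>UNIV. levi_matrix g x $ i $ j * \<xi> i * cnj (\<xi> j))"
      by simp
qed (rule levi_hermitian)

text \<open>The quadratic form at \<open>\<xi>\<close> is \<open>(\<langle>\<xi>, \<xi>\<rangle> \<langle>v, v\<rangle> - \<bar>\<langle>\<xi>, v\<rangle>\<bar>\<^sup>2) / \<langle>v, v\<rangle>\<^sup>2\<close> for the inner product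
  given by the Levi matrix, since \<open>G = \<langle>v, v\<rangle>\<close> by the Euler relations. By Cauchy and Schwarz it is
  positive unless \<open>\<xi>\<close> is a multiple of \<open>v\<close>, and a vector with entry \<open>0\<close> at \<open>a\<close> is no nonzero
  multiple of a vector with entry \<open>1\<close> at \<open>a\<close>.\<close>

lemma log_hessian_pos_def_on:
  assumes z: "z \<in> U" and va: "v $ a = 1"
  shows "pos_def_on (- {a}) (log_hessian (z, v))"
  unfolding pos_def_on_def
proof (intro conjI ballI allI impI)
  have v: "v \<noteq> 0" using va by auto
  have x: "(z, v) \<in> U \<times> - {0}" using z v by simp
  have gpos: "0 < g (z, v)" using positive[OF z v] .
  show "log_hessian (z, v) j i = cnj (log_hessian (z, v) i j)" for i j by (rule log_hessian_hermitian[OF x])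
  fix \<xi>' :: "'n \<Rightarrow> complex" assume ne: "\<exists>i\<in>- {a}. \<xi>' i \<noteq> 0"
  define \<xi> :: "complex^'n" where "\<xi> = (\<chi> i. if i = a then 0 else \<xi>' i)"
  define Q where "Q \<alpha> \<beta> = (\<Sum>i\<in>UNIV. \<Sum>j\<in>UNIV. levi_matrix g (z, v) $ i $ j * \<alpha> $ i * cnj (\<beta> $ j))"
      for \<alpha> \<beta> :: "complex^'n"
  define s where "s = (\<Sum>i\<in>UNIV. \<xi> $ i * dv i gc (z, v))"
  (* \<xi> - c v is the component of \<xi> orthogonal to v *)
  define c where "c = s / gc (z, v)"
  have Q1: "Q (\<alpha> - b *s \<beta>) \<gamma> = Q \<alpha> \<gamma> - b * Q \<beta> \<gamma>" for \<alpha> \<beta> \<gamma> b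
    unfolding Q_def sum_distrib_left sum_subtractf[symmetric] by (simp add: algebra_simps)
  have Q2: "Q \<gamma> (\<alpha> - b *s \<beta>) = Q \<gamma> \<alpha> - cnj b * Q \<gamma> \<beta>" for \<alpha> \<beta> \<gamma> b
    unfolding Q_def sum_distrib_left sum_subtractf[symmetric] by (simp add: algebra_simps)
  have Qv: "Q \<alpha> v = (\<Sum>i\<in>UNIV. \<alpha> $ i * dv i gc (z, v))" for \<alpha>
    unfolding Q_def levi_contract_right[OF z v, symmetric] sum_distrib_left by (simp add: ac_simps)
  have vQ: "Q v \<alpha> = cnj (\<Sum>i\<in>UNIV. \<alpha> $ i * dv i gc (z, v))" for \<alpha>
  proof -
    have "Q v \<alpha> = (\<Sum>j\<in>UNIV. cnj (\<alpha> $ j) * (\<Sum>i\<in>UNIV. v $ i * levi_matrix g (z, v) $ i $ j))"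
      unfolding Q_def sum_distrib_left by (subst sum.swap) (simp add: ac_simps)
    then show ?thesis by (simp add: levi_contract_left[OF z v] dvbar_gc[OF x])
  qed
  have Qvv: "Q v v = gc (z, v)" by (simp add: Qv euler_gc[OF z v])
  have Q\<eta>: "Q (\<xi> - c *s v) (\<xi> - c *s v) = Q \<xi> \<xi> - s * cnj s / gc (z, v)"
    unfolding Q1 Q2 Qvv unfolding Qv vQ s_def[symmetric] using gpos by (simp add: c_def field_simps)
  have "\<xi> - c *s v \<noteq> 0"
  proof
    assume e: "\<xi> - c *s v = 0"
    from arg_cong[OF this, of "\<lambda>w. w $ a"] have "c = 0" using va by (simp add: \<xi>_def)
    with e have "\<xi> = 0" by simp
    obtain i where "i \<noteq> a" "\<xi>' i \<noteq> 0" using ne by auto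
    moreover have "\<xi> $ i = 0" using \<open>\<xi> = 0\<close> by simp
    ultimately show False by (simp add: \<xi>_def)
  qed
  from levi_pos[OF x this] have "0 < Re (Q (\<xi> - c *s v) (\<xi> - c *s v))" by (simp add: Q_def)
  also have "Q (\<xi> - c *s v) (\<xi> - c *s v) = gc (z, v)
      * (\<Sum>i\<in>UNIV. \<Sum>j\<in>UNIV. log_hessian (z, v) i j * \<xi> $ i * cnj (\<xi> $ j))"
  proof -
    have "gc (z, v) * (\<Sum>i\<in>UNIV. \<Sum>j\<in>UNIV. log_hessian (z, v) i j * \<xi> $ i * cnj (\<xi> $ j)) =
      (\<Sum>i\<in>UNIV. \<Sum>j\<in>UNIV. levi_matrix g (z, v) $ i $ j * \<xi> $ i * cnj (\<xi> $ j)
        - \<xi> $ i * dv i gc (z, v) * cnj (\<xi> $ j * dv j gc (z, v)) / gc (z, v))"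
      unfolding sum_distrib_left
      using gpos by (intro sum.cong refl) (simp add: log_hessian_eq[OF x] dvbar_gc[OF x] field_simps
          power2_eq_square)
    also have "\<dots> = Q \<xi> \<xi> - s * cnj s / gc (z, v)"
      unfolding Q_def s_def cnj_sum sum_product sum_divide_distrib by (simp only: sum_subtractf)
    finally show ?thesis by (simp only: Q\<eta>)
  qed
  also have "(\<Sum>i\<in>UNIV. \<Sum>j\<in>UNIV. log_hessian (z, v) i j * \<xi> $ i * cnj (\<xi> $ j)) =
    (\<Sum>i\<in>- {a}. \<Sum>j\<in>- {a}. log_hessian (z, v) i j * \<xi>' i * cnj (\<xi>' j))"
  proof -
    have "(\<Sum>i\<in>UNIV. f i) = (\<Sum>i\<in>- {a}. f i)" if "f a = 0" for f :: "'n \<Rightarrow> complex"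
      by (rule sum.mono_neutral_right) (use that in auto)
    then show ?thesis by (simp add: \<xi>_def)
  qed
  finally show "0 < Re (\<Sum>i\<in>- {a}. \<Sum>j\<in>- {a}. log_hessian (z, v) i j * \<xi>' i * cnj (\<xi>' j))"
    using gpos by (simp add: zero_less_mult_iff)
qed

text \<open>Because \<open>v\<close> spans the kernel of the Hessian of \<open>log G\<close>, subtracting \<open>v\<^sup>b \<delta>v\<^sup>a\<close> from \<open>\<delta>v\<^sup>b\<close> does
  not change the vertical form. The new covectors vanish for \<open>b = a\<close>, and only the positive
  definite block of the Hessian remains.\<close>

lemma omega_V_reduced:
  assumes z: "z \<in> U" and va: "v $ a = 1"
  defines "\<theta> \<equiv> \<lambda>b Y. delta_v_coframe g (z, v) b Y - v $ b * delta_v_coframe g (z, v) a Y"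
  shows "omega_V g (z, v) Y = \<i> * ((\<Sum>b\<in>- {a}. \<Sum>c\<in>- {a}. log_hessian (z, v) b c
      * (\<theta> b (Y 0) * cnj (\<theta> c (Y 1)))) -
     (\<Sum>b\<in>- {a}. \<Sum>c\<in>- {a}. log_hessian (z, v) b c * (\<theta> b (Y 1) * cnj (\<theta> c (Y 0)))))"
proof -
  have v: "v \<noteq> 0" using va by auto
  let ?d = "delta_v_coframe g (z, v)"
  have red: "(\<Sum>b\<in>- {a}. \<Sum>c\<in>- {a}. log_hessian (z, v) b c * (\<theta> b P * cnj (\<theta> c R))) =
     (\<Sum>i\<in>UNIV. \<Sum>j\<in>UNIV. log_hessian (z, v) i j * (?d i P * cnj (?d j R)))" for P R
  proof -
    have "\<theta> a Y = 0" for Y using va by (simp add: \<theta>_def)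
    moreover have "(\<Sum>i\<in>- {a}. f i) = (\<Sum>i\<in>UNIV. f i)" if "f a = 0" for f :: "'n \<Rightarrow> complex"
      by (rule sum.mono_neutral_left) (use that in auto)
    ultimately have "(\<Sum>b\<in>- {a}. \<Sum>c\<in>- {a}. log_hessian (z, v) b c * (\<theta> b P * cnj (\<theta> c R))) =
      (\<Sum>b\<in>UNIV. \<Sum>c\<in>UNIV. log_hessian (z, v) b c * (\<theta> b P * cnj (\<theta> c R)))" by simp
    also have "\<dots> = (\<Sum>b\<in>UNIV. \<theta> b P * (\<Sum>c\<in>UNIV. log_hessian (z, v) b c * cnj (\<theta> c R)))"
      unfolding sum_distrib_left by (simp only: ac_simps)
    also have "\<dots> = (\<Sum>b\<in>UNIV. \<theta> b P * (\<Sum>c\<in>UNIV. log_hessian (z, v) b c * cnj (?d c R)))"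
    proof (rule sum.cong[OF refl], rule arg_cong2[where f = "(*)", OF refl])
      fix b
      have "(\<Sum>c\<in>UNIV. log_hessian (z, v) b c * cnj (\<theta> c R))
          = (\<Sum>c\<in>UNIV. log_hessian (z, v) b c * cnj (?d c R))
         - (\<Sum>c\<in>UNIV. log_hessian (z, v) b c * cnj (v $ c)) * cnj (?d a R)"
        unfolding sum_distrib_right sum_subtractf[symmetric] by (simp add: \<theta>_def algebra_simps)
      then show "(\<Sum>c\<in>UNIV. log_hessian (z, v) b c * cnj (\<theta> c R))
          = (\<Sum>c\<in>UNIV. log_hessian (z, v) b c * cnj (?d c R))"
        by (simp add: log_hessian_contract_right[OF z v])
    qed
    also have "\<dots> = (\<Sum>c\<in>UNIV. cnj (?d c R) * (\<Sum>b\<in>UNIV. \<theta> b P * log_hessian (z, v) b c))"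
      unfolding sum_distrib_left by (subst sum.swap) (simp only: ac_simps)
    also have "\<dots> = (\<Sum>c\<in>UNIV. cnj (?d c R) * (\<Sum>b\<in>UNIV. ?d b P * log_hessian (z, v) b c))"
    proof (rule sum.cong[OF refl], rule arg_cong2[where f = "(*)", OF refl])
      fix c
      have "(\<Sum>b\<in>UNIV. \<theta> b P * log_hessian (z, v) b c) = (\<Sum>b\<in>UNIV. ?d b P * log_hessian (z, v) b c)
         - (\<Sum>b\<in>UNIV. v $ b * log_hessian (z, v) b c) * ?d a P"
        unfolding sum_distrib_right sum_subtractf[symmetric] by (simp add: \<theta>_def algebra_simps)
      then show "(\<Sum>b\<in>UNIV. \<theta> b P * log_hessian (z, v) b c) = (\<Sum>b\<in>UNIV. ?d b P * log_hessian (z, v) b c)"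
        by (simp add: log_hessian_contract_left[OF z v])
    qed
    also have "\<dots> = (\<Sum>i\<in>UNIV. \<Sum>j\<in>UNIV. log_hessian (z, v) i j * (?d i P * cnj (?d j R)))"
      unfolding sum_distrib_left by (subst sum.swap) (simp only: ac_simps)
    finally show ?thesis .
  qed
  show ?thesis
    unfolding omega_V_def wedge_delta_v red log_hessian_def[symmetric]
    by (simp only: right_diff_distrib sum_subtractf)
qed

text \<open>All forms in the product are brought into the shape required by \<open>wedge_sum_of_squares\<close>, and a
  determinant that does not vanish is exhibited: it selects every \<open>\<phi>V\<close> and every \<open>\<phi>H\<close> exactly
  once. If a combination \<open>(p, q)\<close> of the frame vectors is annihilated by all of them, then
  positivity of the Levi matrix gives \<open>p = 0\<close>, and then positivity of the reduced Hessian gives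
  \<open>q = 0\<close>.\<close>

lemma proj_density_pos:
  assumes z: "z \<in> U"
  shows "proj_density g a z u > 0"
proof -
  define n where "n = CARD('n)"
  define v where "v = affine_point a u"
  have va: "v $ a = 1" by (simp add: v_def affine_point_def)
  have v: "v \<noteq> 0" using va by auto
  have x: "(z, v) \<in> U \<times> - {0}" using z v by simp
  have n: "n > 0" by (simp add: n_def)
  define m where "m = 2 * n - 1"
  define X where "X = affine_frame a"
  define H where "H i j = levi_matrix g (z, v) $ i $ j" for i j
  define \<theta> where "\<theta> b Y = delta_v_coframe g (z, v) b Y - v $ b * delta_v_coframe g (z, v) a Y" for b Y
  have pdH: "pos_def_on UNIV H" unfolding H_def using levi_pos_def_on[OF x] .
  have pdL: "pos_def_on (- {a}) (log_hessian (z, v))" using log_hessian_pos_def_on[OF z va] .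
  obtain B where B: "\<forall>j\<in>UNIV. \<forall>k\<in>UNIV. H j k = (\<Sum>l::'n\<in>UNIV. B l j * cnj (B l k))"
    using gram_decomposition[OF finite pdH] by (rule exE) (rule that)
  obtain C where C: "\<forall>j\<in>- {a}. \<forall>k\<in>- {a}. log_hessian (z, v) j k = (\<Sum>l\<in>- {a}. C l j * cnj (C l k))"
    using gram_decomposition[OF finite pdL] by (rule exE) (rule that)
  define \<phi>H where "\<phi>H l Y = (\<Sum>j\<in>UNIV. B l j * fst Y $ j)" for l and Y :: "(complex^'n) \<times> (complex^'n)"
  define \<phi>V where "\<phi>V l Y = (\<Sum>j\<in>- {a}. C l j * \<theta> j Y)" for l and Y
  define S where "S t = (if t < n - 1 then - {a} else UNIV)" for t
  define \<phi> where "\<phi> t = (if t < n - 1 then \<phi>V else \<phi>H)" for t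
  define \<alpha>s where "\<alpha>s = replicate (n - 1) (omega_V g (z, v)) @ replicate n (omega_H g (z, v))"
  have oH: "omega_H g (z, v) Y = \<i> * (\<Sum>l\<in>UNIV. \<phi>H l (Y 0) * cnj (\<phi>H l (Y 1)) - \<phi>H l (Y 1)
      * cnj (\<phi>H l (Y 0)))" for Y
    unfolding omega_H_def wedge_dz H_def[symmetric] \<phi>H_def right_diff_distrib sum_subtractf
    by (simp only: gram_sesquilinear[OF B])
  have oV: "omega_V g (z, v) Y = \<i> * (\<Sum>l\<in>- {a}. \<phi>V l (Y 0) * cnj (\<phi>V l (Y 1)) - \<phi>V l (Y 1)
      * cnj (\<phi>V l (Y 0)))" for Y
    unfolding omega_V_reduced[OF z va] \<theta>_def[symmetric] \<phi>V_def sum_subtractf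
    by (simp only: gram_sesquilinear[OF C])
  have lin\<theta>: "\<theta> b (\<Sum>s\<in>I. c s *s fst (Y s), \<Sum>s\<in>I. c s *s snd (Y s)) = (\<Sum>s\<in>I. c s * \<theta> b (Y s))"
    if "finite I" for b c Y and I :: "nat set"
    using that
    by (induction I rule: finite_induct)
       (simp_all add: \<theta>_def delta_v_coframe_def algebra_simps sum.distrib sum_distrib_left)
  have lin\<phi>: "\<phi> t l (\<Sum>s\<in>I. c s *s fst (Y s), \<Sum>s\<in>I. c s *s snd (Y s)) = (\<Sum>s\<in>I. c s * \<phi> t l (Y s))"
    if I: "finite I" for t l c Y and I :: "nat set"
  proof (cases "t < n - 1")
    case True
    have "(\<Sum>j\<in>- {a}. C l j * (\<Sum>s\<in>I. c s * \<theta> j (Y s))) = (\<Sum>s\<in>I. c s * (\<Sum>j\<in>- {a}. C l j * \<theta> j (Y s)))"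
      unfolding sum_distrib_left by (subst sum.swap) (simp only: ac_simps)
    then show ?thesis using True by (simp add: \<phi>_def \<phi>V_def lin\<theta>[OF I])
  next
    case False
    have "(\<Sum>j\<in>UNIV. B l j * (\<Sum>s\<in>I. c s * fst (Y s) $ j)) = (\<Sum>s\<in>I. c s * (\<Sum>j\<in>UNIV. B l j * fst (Y s) $ j))"
      unfolding sum_distrib_left by (subst sum.swap) (simp only: ac_simps)
    then show ?thesis using False by (simp add: \<phi>_def \<phi>H_def)
  qed
  have X_odd: "\<phi> t l (X (2 * s + 1)) = \<i> * \<phi> t l (X (2 * s))" for t l s
  proof -
    have "X (2 * s + 1) = (\<Sum>r\<in>{s}. \<i> *s fst (X (2 * r)), \<Sum>r\<in>{s}. \<i> *s snd (X (2 * r)))"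
      unfolding X_def using affine_frame_odd[of a s] by (simp add: prod_eq_iff)
    then show ?thesis using lin\<phi>[of "{s}" t l "\<lambda>_. \<i>" "\<lambda>r. X (2 * r)"] by simp
  qed
  define Dt where "Dt L = Determinant.det (Matrix.mat m m (\<lambda>(t, s). \<phi> t (L t) (X (2 * s))))" for L
  have wedge: "wedge 2 \<alpha>s X = complex_of_real (2 ^ m * (\<Sum>L\<in>PiE {..<m} S. (cmod (Dt L))\<^sup>2))"
    unfolding Dt_def
  proof (rule wedge_sum_of_squares)
    show "length \<alpha>s = m" using n by (simp add: \<alpha>s_def m_def)
    show "finite (S t)" for t by (simp add: S_def)
    show "(\<alpha>s ! t) Y = \<i> * (\<Sum>l\<in>S t. \<phi> t l (Y 0) * cnj (\<phi> t l (Y 1)) - \<phi> t l (Y 1) * cnj (\<phi> t l (Y 0)))"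
      if "t < m" for t Y
      using that n by (simp add: \<alpha>s_def nth_append S_def \<phi>_def oH oV m_def)
  qed (rule X_odd)
  define eV where "eV = enum_of (- {a})"
  define eH where "eH = enum_of (UNIV :: 'n set)"
  have eV: "bij_betw eV {..<n - 1} (- {a})"
    using bij_enum_of[of "- {a}"] by (simp add: eV_def n_def card_minus_single)
  have eH: "bij_betw eH {..<n} UNIV" using bij_enum_of[of "UNIV :: 'n set"] by (simp add: eH_def n_def)
  (* the first n - 1 factors of the product are vertical, the last n are horizontal *)
  define L0 where "L0 = (\<lambda>t\<in>{..<m}. if t < n - 1 then eV t else eH (t - (n - 1)))"
  have L0: "L0 \<in> PiE {..<m} S"
    using bij_betwE[OF eV] by (auto simp: L0_def S_def)
  have "Dt L0 \<noteq> 0"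
    unfolding Dt_def
  proof (rule det_mat_nonzeroI)
    fix c :: "nat \<Rightarrow> complex"
    assume ker: "\<And>t. t < m \<Longrightarrow> (\<Sum>s<m. \<phi> t (L0 t) (X (2 * s)) * c s) = 0"
    define p where "p = (\<Sum>s<m. c s *s fst (X (2 * s)))"
    define q where "q = (\<Sum>s<m. c s *s snd (X (2 * s)))"
    have ker': "\<phi> t (L0 t) (p, q) = 0" if "t < m" for t
      using ker[OF that] lin\<phi>[of "{..<m}" t "L0 t" c "\<lambda>s. X (2 * s)"]
          by (simp add: p_def q_def mult.commute)
    have H0: "(\<Sum>j\<in>UNIV. B l j * p $ j) = 0" for l
    proof -
      have "l \<in> eH ` {..<n}" using bij_betw_imp_surj_on[OF eH] by simp
      then obtain s where s: "s < n" "eH s = l" by auto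
      define t where "t = s + (n - 1)"
      have t: "t < m" "\<not> t < n - 1" "t - (n - 1) = s" using s n by (auto simp: m_def t_def)
      from ker'[OF t(1)] show ?thesis using s t by (simp add: L0_def \<phi>_def \<phi>H_def)
    qed
    have pj: "p $ j = 0" for j
      by (rule gram_kernel[OF pdH B]) (simp_all add: H0)
    have V0: "(\<Sum>j\<in>- {a}. C l j * \<theta> j (p, q)) = 0" if "l \<in> - {a}" for l
    proof -
      have "l \<in> eV ` {..<n - 1}" using bij_betw_imp_surj_on[OF eV] that by simp
      then obtain s where s: "s < n - 1" "eV s = l" by auto
      have "s < m" using s n by (simp add: m_def)
      from ker'[OF this] show ?thesis using s \<open>s < m\<close> by (simp add: L0_def \<phi>_def \<phi>V_def)
    qed
    have \<theta>0: "\<theta> j (p, q) = 0" if "j \<in> - {a}" for j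
      by (rule gram_kernel[OF pdL C V0 that])
    have comp: "(\<Sum>s<m. c s *s w s) $ j = (\<Sum>s<m. c s * w s $ j)" for w :: "nat \<Rightarrow> complex^'n" and j by simp
    have cp: "c s = 0" if "s < n" for s
    proof -
      have "s < m" using that n by (simp add: m_def)
      have "p $ eH s = (\<Sum>r<m. if r = s then c s else 0)"
        unfolding p_def comp
      proof (rule sum.cong[OF refl])
        fix r assume "r \<in> {..<m}"
        show "c r * fst (X (2 * r)) $ eH s = (if r = s then c s else 0)"
        proof (cases "r < n")
          case True
          then have "eH r = eH s \<longleftrightarrow> r = s" using eH that by (auto simp: bij_betw_def inj_on_eq_iff)
          then show ?thesis using True that
            by (auto simp: X_def affine_frame_even n_def[symmetric] eH_def[symmetric] axis_def)
        next
          case False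
          then show ?thesis using that by (auto simp: X_def affine_frame_even n_def[symmetric])
        qed
      qed
      then show ?thesis using pj \<open>s < m\<close> by simp
    qed
    have qa: "q $ a = 0"
      unfolding q_def comp
    proof (rule sum.neutral, rule ballI)
      fix r assume r: "r \<in> {..<m}"
      show "c r * snd (X (2 * r)) $ a = 0"
      proof (cases "r < n")
        case False
        then have "r - n < n - 1" using r n by (auto simp: m_def)
        then have "eV (r - n) \<noteq> a" using bij_betwE[OF eV] by auto
        then show ?thesis using False by (auto simp: X_def affine_frame_even n_def[symmetric]
            eV_def[symmetric] axis_def)
      qed (simp add: cp)
    qed
    have qj: "q $ j = 0" if "j \<in> - {a}" for j
      using \<theta>0[OF that] by (simp add: \<theta>_def delta_v_coframe_def pj qa)
    have "c s = 0" if s: "s < m" "\<not> s < n" for s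
    proof -
      have sn: "s - n < n - 1" using s n by (auto simp: m_def)
      have "q $ eV (s - n) = (\<Sum>r<m. if r = s then c s else 0)"
        unfolding q_def comp
      proof (rule sum.cong[OF refl])
        fix r assume r: "r \<in> {..<m}"
        show "c r * snd (X (2 * r)) $ eV (s - n) = (if r = s then c s else 0)"
        proof (cases "r < n")
          case False
          then have "r - n < n - 1" using r n by (auto simp: m_def)
          then have "eV (r - n) = eV (s - n) \<longleftrightarrow> r - n = s - n"
            using eV sn by (auto simp: bij_betw_def inj_on_eq_iff)
          then show ?thesis using False s(2)
            by (auto simp: X_def affine_frame_even n_def[symmetric] eV_def[symmetric] axis_def)
        qed (use s in \<open>auto simp: cp\<close>)
      qed
      moreover have "eV (s - n) \<in> - {a}" using bij_betwE[OF eV] sn by auto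
      ultimately show ?thesis using qj s(1) by simp
    qed
    with cp show "\<forall>s<m. c s = 0" by blast
  qed
  then have "0 < (\<Sum>L\<in>PiE {..<m} S. (cmod (Dt L))\<^sup>2)"
    by (intro sum_pos2[OF _ L0]) (auto intro!: finite_PiE simp: S_def)
  then have pos: "0 < 2 ^ m * (\<Sum>L\<in>PiE {..<m} S. (cmod (Dt L))\<^sup>2)" by simp
  have "proj_density g a z u = Re (wedge 2 \<alpha>s X / (fact (n - 1) * fact n))"
    by (simp add: proj_density_def proj_volume_form_def v_def X_def \<alpha>s_def n_def)
  also have "wedge 2 \<alpha>s X / (fact (n - 1) * fact n) =
      complex_of_real (2 ^ m * (\<Sum>L\<in>PiE {..<m} S. (cmod (Dt L))\<^sup>2) / (fact (n - 1) * fact n))"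
    unfolding wedge by simp
  finally show ?thesis using pos by (simp only: Re_complex_of_real) simp
qed

lemma continuous_on_det:
  fixes A :: "'x::topological_space \<Rightarrow> complex^'m^'m::finite"
  assumes "\<And>i j. continuous_on S (\<lambda>x. A x $ i $ j)"
  shows "continuous_on S (\<lambda>x. Determinants.det (A x))"
  unfolding Determinants.det_def
  by (intro continuous_on_sum continuous_on_mult continuous_on_const continuous_on_prod assms)

lemma continuous_levi: "continuous_on (U \<times> - {0}) (\<lambda>x. levi_matrix g x $ i $ j)"
  by (rule Cinf_on_continuous[OF smooth_levi])

text \<open>By Cramer's rule.\<close>

lemma continuous_nconn: "continuous_on (U \<times> - {0}) (nconn g i j)"
proof -
  let ?A = "\<lambda>x. transpose (levi_matrix g x)"
  let ?b = "\<lambda>x. (\<chi> k. dvbar k (dz j gc) x) :: complex^'n"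
  define R where "R x = Determinants.det (\<chi> k l. if l = i then ?b x $ k else ?A x $ k $ l)
      / Determinants.det (?A x)" for x
  have nz: "Determinants.det (?A x) \<noteq> 0" if "x \<in> U \<times> - {0}" for x
    using levi_invertible[OF that] by (simp add: invertible_det_nz)
  have R: "continuous_on (U \<times> - {0}) R"
    unfolding R_def
  proof (intro continuous_on_divide continuous_on_det ballI nz)
    show A: "continuous_on (U \<times> - {0}) (\<lambda>x. ?A x $ p $ q)" for p q
      unfolding Finite_Cartesian_Product.transpose_def by (simp add: continuous_levi)
    show "continuous_on (U \<times> - {0}) (\<lambda>x. (\<chi> k l. if l = i then ?b x $ k else ?A x $ k $ l) $ p $ q)" for p q
      using A by (cases "q = i") (simp_all add:
          Cinf_on_continuous[OF smooth_dvbar[OF smooth_dz[OF smooth_gc]]])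
  qed
  have "nconn g i j x = R x" if x: "x \<in> U \<times> - {0}" for x
  proof -
    have "?A x *v (\<chi> i. nconn g i j x) = ?b x"
      by (simp add: Finite_Cartesian_Product.vec_eq_iff levi_transpose_mult nconn_solves[OF x] del:
          transpose_matrix_vector)
    from this[unfolded cramer[OF nz[OF x]]] have "(\<chi> i. nconn g i j x) $ i = R x" unfolding R_def by simp
    then show ?thesis by simp
  qed
  then show ?thesis by (intro continuous_on_eq[OF R]) simp
qed

lemma continuous_log_levi: "continuous_on (U \<times> - {0}) (\<lambda>x. levi_matrix (\<lambda>y. ln (g y)) x $ i $ j)"
proof -
  have "continuous_on (U \<times> - {0}) (\<lambda>x. (levi_matrix g x $ i $ j * gc x - dv i gc x * dvbar j gc x)
      / (gc x)\<^sup>2)"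
  proof (intro continuous_on_divide continuous_on_diff continuous_on_mult continuous_on_power
      continuous_levi ballI)
    show "(gc x)\<^sup>2 \<noteq> 0" if "x \<in> U \<times> - {0}" for x using positive[of "fst x" "snd x"] that by auto
  qed (intro Cinf_on_continuous smooth_gc smooth_dv smooth_dvbar)+
  then show ?thesis by (rule continuous_on_eq) (rule log_levi[symmetric])
qed

lemma continuous_omega_H: "continuous_on (U \<times> - {0}) (\<lambda>x. omega_H g x X)"
  unfolding omega_H_def by (intro continuous_intros continuous_levi)

lemma continuous_omega_V: "continuous_on (U \<times> - {0}) (\<lambda>x. omega_V g x X)"
  unfolding omega_V_def wedge_delta_v delta_v_coframe_def
  by (intro continuous_intros continuous_log_levi continuous_nconn)

lemma continuous_proj_volume: "continuous_on (U \<times> - {0}) (\<lambda>x. Re (proj_volume_form g x X))"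
proof -
  let ?as = "\<lambda>x. replicate (CARD('n) - 1) (omega_V g x) @ replicate CARD('n) (omega_H g x)"
  let ?m = "2 * CARD('n) - 1"
  have len: "length (?as x) = ?m" for x by simp
  have "continuous_on (U \<times> - {0}) (\<lambda>x. (?as x ! j) Y)" if "j < ?m" for j Y
    using that by (cases "j < CARD('n) - 1") (auto simp: nth_append intro: continuous_omega_V
        continuous_omega_H)
  then have "continuous_on (U \<times> - {0}) (\<lambda>x. \<Prod>j<?m. (?as x ! j) (Y j))" for Y
    by (intro continuous_on_prod) simp
  then have "continuous_on (U \<times> - {0}) (\<lambda>x. wedge 2 (?as x) X)"
    unfolding wedge_def len
    by (intro continuous_on_divide continuous_on_sum continuous_on_mult continuous_on_const) simp_all
  then show ?thesis
    unfolding proj_volume_form_def by (intro continuous_on_Re continuous_on_divide continuous_on_const)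
        simp_all
qed

end

text \<open>Only the \<open>n\<close> horizontal factors change.\<close>

lemma (in conformal_pair) proj_density_scaling:
  assumes const: "\<And>z. \<phi> z = c" and z: "z \<in> U"
  shows "proj_density g2 a z u = exp c ^ CARD('n) * proj_density g a z u"
proof -
  define v where "v = affine_point a u"
  have "v $ a = 1" by (simp add: v_def affine_point_def)
  then have v: "v \<noteq> 0" by auto
  have x: "(z, v) \<in> U \<times> - {0}" using z v by simp
  have e: "e\<phi> (z, v) = complex_of_real (exp c)" by (simp add: const exp_of_real)
  have "dz j \<phi>c (z, v) = 0" for j
    by (simp add: const dz_def wirt_def frechet_derivative_const)
  then have N: "nconn g2 i j (z, v) = nconn g i j (z, v)" for i j
    by (simp add: nconn_conformal[OF x])
  have dvb: "dvbar j g2.gc (z, v) = e\<phi> (z, v) * dvbar j gc (z, v)" for j by (rule dvbar_conformal[OF x])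
  have dv: "dv j g2.gc (z, v) = e\<phi> (z, v) * dv j gc (z, v)" for j
  proof -
    have "cnj (dvbar j g2.gc (z, v)) = cnj (e\<phi> (z, v)) * cnj (dvbar j gc (z, v))"
        by (simp only: dvb complex_cnj_mult)
    moreover have "cnj (e\<phi> (z, v)) = e\<phi> (z, v)" by (simp only: e complex_cnj_complex_of_real)
    ultimately show ?thesis by (simp only: dvbar_gc[OF x] g2.dvbar_gc[OF x] complex_cnj_cnj)
  qed
  have L: "levi_matrix (\<lambda>y. ln (g2 y)) (z, v) $ i $ j = levi_matrix (\<lambda>y. ln (g y)) (z, v) $ i $ j" for i j
    unfolding log_levi[OF x] g2.log_levi[OF x] dv dvb levi_conformal[OF x] conformal_gc[OF x]
    using positive[OF z v] by (simp add: power2_eq_square field_simps)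
  have V: "omega_V g2 (z, v) = omega_V g (z, v)"
    by (rule ext) (simp add: omega_V_def L wedge_delta_v[unfolded One_nat_def] delta_v_coframe_def N)
  have H: "omega_H g2 (z, v) X = complex_of_real (exp c) * omega_H g (z, v) X" for X
    unfolding omega_H_def levi_conformal[OF x] e
    by (simp add: sum_distrib_left algebra_simps)
  let ?n = "CARD('n)"
  let ?as = "\<lambda>g. replicate (?n - 1) (omega_V g (z, v)) @ replicate ?n (omega_H g (z, v))"
  have factor: "(\<Prod>j<2 * ?n - 1. (?as g2 ! j) (Y j)) = complex_of_real (exp c) ^ ?n
      * (\<Prod>j<2 * ?n - 1. (?as g ! j) (Y j))" for Y
  proof -
    have "(\<Prod>j<2 * ?n - 1. (?as g2 ! j) (Y j)) =
      (\<Prod>j<2 * ?n - 1. (if j < ?n - 1 then 1 else complex_of_real (exp c)) * (?as g ! j) (Y j))"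
      by (intro prod.cong) (auto simp: nth_append V H)
    also have "\<dots> = (\<Prod>j<2 * ?n - 1. if j < ?n - 1 then 1 else complex_of_real (exp c))
        * (\<Prod>j<2 * ?n - 1. (?as g ! j) (Y j))"
      by (rule prod.distrib)
    also have "(\<Prod>j<2 * ?n - 1. if j < ?n - 1 then 1 else complex_of_real (exp c))
        = complex_of_real (exp c) ^ card {?n - 1..<2 * ?n - 1}"
    proof -
      have "(\<Prod>j<2 * ?n - 1. if j < ?n - 1 then 1 else complex_of_real (exp c))
          = (\<Prod>j\<in>{?n - 1..<2 * ?n - 1}. complex_of_real (exp c))"
        by (rule prod.mono_neutral_cong_right) auto
      then show ?thesis by simp
    qed
    finally show ?thesis by simp
  qed
  have len: "length (?as h) = 2 * ?n - 1" for h by simp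
  have "wedge 2 (?as g2) X = complex_of_real (exp c) ^ ?n * wedge 2 (?as g) X" for X
    unfolding wedge_def len factor by (simp add: sum_distrib_left algebra_simps)
  then have "proj_volume_form g2 (z, v) X = complex_of_real (exp c ^ ?n) * proj_volume_form g (z, v) X"
      for X
    by (simp add: proj_volume_form_def)
  then show ?thesis
    by (simp only: proj_density_def v_def[symmetric]) simp
qed


section \<open>Integration along the fibre\<close>

lemma emeasure_lborel_open_nonzero:
  fixes S :: "'a::euclidean_space set"
  assumes "open S" "S \<noteq> {}"
  shows "emeasure lborel S \<noteq> 0"
proof
  assume "emeasure lborel S = 0"
  then have "S \<in> null_sets lborel" using assms by (simp add: null_sets_def)
  then have "negligible S" by (simp add: negligible_iff_null_sets null_sets_completionI)
  with open_not_negligible[OF assms] show False by simp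
qed

lemma integral_pos:
  fixes f :: "'a \<Rightarrow> real"
  assumes f: "integrable M f" "\<And>x. x \<in> space M \<Longrightarrow> 0 \<le> f x"
    and B: "B \<in> sets M" "emeasure M B \<noteq> 0" "\<And>x. x \<in> B \<Longrightarrow> 0 < f x"
  shows "0 < integral\<^sup>L M f"
proof -
  have "integral\<^sup>L M f \<noteq> 0"
  proof
    assume "integral\<^sup>L M f = 0"
    then have "AE x in M. f x = 0"
      using integral_nonneg_eq_0_iff_AE[OF f(1)] f(2) by auto
    then have "AE x in M. x \<notin> B" by eventually_elim (use B(3) in force)
    then have "emeasure M B = 0" using AE_iff_measurable[OF B(1), of "\<lambda>x. x \<notin> B"]
        sets.sets_into_space[OF B(1)] by auto
    with B(2) show False ..
  qed
  moreover have "0 \<le> integral\<^sup>L M f" by (rule integral_nonneg_AE) (use f(2) in auto)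
  ultimately show ?thesis by simp
qed

text \<open>With \<open>m v = \<Sum>b. \<bar>v\<^sup>b\<bar>\<close>, some entry of a nonzero vector satisfies \<open>\<bar>v\<^sup>a\<bar> \<ge> m v / n\<close>. Cutting off
  \<open>\<bar>v\<^sup>a\<bar> / m v\<close> at the smaller threshold \<open>1 / (2 n)\<close> keeps the sum positive and makes the support
  of the \<open>a\<close>-th function a closed set on which \<open>v\<^sup>a\<close> does not vanish.\<close>

lemma proj_partition_exists: "\<exists>\<tau>. proj_partition (\<tau> :: 'n::finite \<Rightarrow> complex^'n \<Rightarrow> real)"
proof -
  define n where "n = real CARD('n)"
  have n: "n > 0" by (simp add: n_def)
  define m where "m v = (\<Sum>b\<in>UNIV. cmod (v $ b))" for v :: "complex^'n"
  define h where "h a v = max 0 (cmod (v $ a) / m v - 1 / (2 * n))" for a and v :: "complex^'n"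
  define \<tau> where "\<tau> a v = h a v / (\<Sum>b\<in>UNIV. h b v)" for a and v :: "complex^'n"
  have m_pos: "0 < m v" if "v \<noteq> 0" for v
  proof -
    obtain b where "v $ b \<noteq> 0" using \<open>v \<noteq> 0\<close> by (auto simp: Finite_Cartesian_Product.vec_eq_iff)
    then show ?thesis unfolding m_def by (intro sum_pos2[where i = b]) auto
  qed
  have h_nonneg: "0 \<le> h a v" for a v by (simp add: h_def)
  have sum_pos: "0 < (\<Sum>b\<in>UNIV. h b v)" if v: "v \<noteq> 0" for v
  proof -
    have "\<exists>a. m v / n \<le> cmod (v $ a)"
    proof (rule ccontr)
      assume "\<nexists>a. m v / n \<le> cmod (v $ a)"
      then have "m v < (\<Sum>b\<in>(UNIV::'n set). m v / n)" unfolding m_def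
        by (intro sum_strict_mono) (auto simp: not_le)
      also have "\<dots> = m v" using n by (simp add: n_def)
      finally show False by simp
    qed
    then obtain a where "m v / n \<le> cmod (v $ a)" ..
    then have "1 / n \<le> cmod (v $ a) / m v" using m_pos[OF v] n by (simp add: field_simps)
    moreover have "1 / (2 * n) < 1 / n" using n by (simp add: field_simps)
    ultimately have "0 < h a v" by (simp add: h_def)
    then show ?thesis using h_nonneg by (intro sum_pos2[where i = a]) auto
  qed
  have cont_m: "continuous_on S m" for S unfolding m_def by (intro continuous_intros)
  have cont_h: "continuous_on (- {0}) (h a)" for a
    unfolding h_def by (intro continuous_intros cont_m) (use m_pos in force)
  have hom_h: "h a (l *s v) = h a v" if "l \<noteq> 0" for a l v
    using that by (simp add: h_def m_def norm_mult sum_distrib_left[symmetric])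
  have "proj_partition \<tau>"
    unfolding proj_partition_def
  proof (intro conjI allI impI)
    fix a
    show "continuous_on (- {0}) (\<tau> a)"
      unfolding \<tau>_def by (intro continuous_intros cont_h) (use sum_pos in force)
    show "0 \<le> \<tau> a v" for v unfolding \<tau>_def by (intro divide_nonneg_nonneg sum_nonneg h_nonneg)
    show "\<tau> a (l *s v) = \<tau> a v" if "v \<noteq> 0 \<and> l \<noteq> 0" for v l
      using that by (simp add: \<tau>_def hom_h)
    define C where "C = {v :: complex^'n. m v / (2 * n) \<le> cmod (v $ a)}"
    have "closed C" unfolding C_def by (intro closed_Collect_le continuous_intros cont_m) (use n in auto)
    moreover have "{v. v \<noteq> 0 \<and> \<tau> a v \<noteq> 0} \<subseteq> C"
    proof (clarify)
      fix v assume v: "v \<noteq> 0" and "\<tau> a v \<noteq> 0"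
      then have "h a v \<noteq> 0" by (auto simp: \<tau>_def)
      then have "1 / (2 * n) \<le> cmod (v $ a) / m v" by (auto simp: h_def max_def split: if_splits)
      then show "v \<in> C" using m_pos[OF v] n by (simp add: C_def field_simps)
    qed
    ultimately have "closure {v. v \<noteq> 0 \<and> \<tau> a v \<noteq> 0} \<subseteq> C" by (rule closure_minimal[rotated])
    moreover have "v $ a \<noteq> 0" if "v \<in> C" "v \<noteq> 0" for v
      using m_pos[OF that(2)] that(1) n by (auto simp: C_def divide_le_0_iff)
    ultimately show "closure {v. v \<noteq> 0 \<and> \<tau> a v \<noteq> 0} - {0} \<subseteq> {v. v $ a \<noteq> 0}" by blast
  next
    fix v :: "complex^'n" assume "v \<noteq> 0"
    from sum_pos[OF this] show "(\<Sum>a\<in>UNIV. \<tau> a v) = 1"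
      unfolding \<tau>_def sum_divide_distrib[symmetric] by simp
  qed
  then show ?thesis by blast
qed

lemma affine_point_nth: "affine_point a u $ b = (if b = a then 1 else u b)"
  by (simp add: affine_point_def)

lemma affine_point_nonzero: "affine_point a u \<noteq> 0"
  using affine_point_nth[of a u a] by auto

lemma affine_point_measurable:
  "(\<lambda>u. affine_point a u) \<in> borel_measurable (Pi\<^sub>M (- {a}) (\<lambda>_. lborel :: complex measure))"
      for a :: "'n::finite"
proof -
  have eq: "affine_point a u = axis a 1 + (\<Sum>b\<in>- {a}. axis b (u b))" for u :: "'n \<Rightarrow> complex"
  proof (subst Finite_Cartesian_Product.vec_eq_iff, rule allI)
    fix j
    have "(\<Sum>b\<in>- {a}. axis b (u b) $ j) = (\<Sum>b\<in>- {a}. if b = j then u j else 0)"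
      by (intro sum.cong) (auto simp: axis_def)
    then show "affine_point a u $ j = (axis a 1 + (\<Sum>b\<in>- {a}. axis b (u b))) $ j"
      by (auto simp: affine_point_nth axis_def)
  qed
  have "bounded_linear (axis b :: complex \<Rightarrow> complex^'n)" for b
    by (rule linear_conv_bounded_linear[THEN iffD1], rule linearI)
        (auto simp: Finite_Cartesian_Product.vec_eq_iff axis_def)
  then have ax: "(axis b :: complex \<Rightarrow> complex^'n) \<in> borel_measurable borel" for b
    by (intro borel_measurable_continuous_onI linear_continuous_on)
  have c: "(\<lambda>u. u b) \<in> borel_measurable (Pi\<^sub>M (- {a}) (\<lambda>_. lborel :: complex measure))" if "b \<in> - {a}" for b
    using measurable_component_singleton[OF that, of "\<lambda>_. lborel :: complex measure"] by simp
  show ?thesis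
    unfolding eq
    by (intro borel_measurable_add borel_measurable_sum borel_measurable_const measurable_compose[OF c ax])
qed

text \<open>On the compact intersection of the closed support with the unit sphere, \<open>\<bar>v\<^sup>a\<bar>\<close> has a positive
  minimum. A point of the affine chart has entry \<open>1\<close> at \<open>a\<close>, so rescaling it to the unit sphere
  bounds its norm by the inverse of that minimum.\<close>

lemma proj_partition_affine_support:
  assumes "proj_partition \<tau>"
  shows "\<exists>R. \<forall>u. \<tau> a (affine_point a u) \<noteq> 0 \<longrightarrow> norm (affine_point a u) \<le> R"
proof -
  define C where "C = closure {v. v \<noteq> 0 \<and> \<tau> a v \<noteq> 0} \<inter> sphere 0 1"
  have comp: "compact C" unfolding C_def by (intro closed_Int_compact) auto
  have nz: "v $ a \<noteq> 0" if "v \<in> C" for v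
  proof -
    have "closure {v. v \<noteq> 0 \<and> \<tau> a v \<noteq> 0} - {0} \<subseteq> {v. v $ a \<noteq> 0}"
      using assms unfolding proj_partition_def by blast
    moreover have "v \<in> closure {v. v \<noteq> 0 \<and> \<tau> a v \<noteq> 0}" "v \<noteq> 0" using that by (auto simp: C_def)
    ultimately show ?thesis by blast
  qed
  have inC: "(1 / of_real (norm v)) *s v \<in> C" if v: "v \<noteq> 0" "\<tau> a v \<noteq> 0" for v :: "complex^'a"
  proof -
    have l: "(1 / complex_of_real (norm v)) \<noteq> 0" using v by simp
    have e: "(1 / complex_of_real (norm v)) *s v = (1 / norm v) *\<^sub>R v"
      by (simp only: Finite_Cartesian_Product.vec_eq_iff vector_smult_component vector_scaleR_component)
          (simp add: scaleR_conv_of_real)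
    have "\<tau> a ((1 / of_real (norm v)) *s v) = \<tau> a v" using assms v l unfolding proj_partition_def by blast
    then have "(1 / of_real (norm v)) *s v \<in> {v. v \<noteq> 0 \<and> \<tau> a v \<noteq> 0}" using v by (simp add: e)
    then have "(1 / of_real (norm v)) *s v \<in> closure {v. v \<noteq> 0 \<and> \<tau> a v \<noteq> 0}"
        by (rule subsetD[OF closure_subset])
    moreover have "(1 / of_real (norm v)) *s v \<in> sphere 0 1" unfolding e using v by simp
    ultimately show ?thesis unfolding C_def by (rule IntI)
  qed
  show ?thesis
  proof (cases "C = {}")
    case True
    then have "\<tau> a (affine_point a u) = 0" for u using inC[OF affine_point_nonzero[of a u]] by auto
    then show ?thesis by simp
  next
    case False
    have "continuous_on C (\<lambda>v. cmod (v $ a))" by (intro continuous_intros)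
    from continuous_attains_inf[OF comp False this]
    obtain w where w: "w \<in> C" "\<And>v. v \<in> C \<Longrightarrow> cmod (w $ a) \<le> cmod (v $ a)" by blast
    have "norm (affine_point a u) \<le> 1 / cmod (w $ a)" if "\<tau> a (affine_point a u) \<noteq> 0" for u
    proof -
      let ?v = "affine_point a u"
      have "cmod (w $ a) \<le> cmod (((1 / of_real (norm ?v)) *s ?v) $ a)"
        by (rule w(2)[OF inC[OF affine_point_nonzero that]])
      also have "\<dots> = 1 / norm ?v" by (simp add: affine_point_nth norm_divide)
      finally show ?thesis using nz[OF w(1)] affine_point_nonzero[of a u] by (simp add: field_simps)
    qed
    then show ?thesis by blast
  qed
qed

lemma proj_partition_bounds:
  assumes "proj_partition \<tau>" "v \<noteq> 0"
  shows "0 \<le> \<tau> a v" "\<tau> a v \<le> 1"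
proof -
  show nn: "0 \<le> \<tau> a v" for a using assms unfolding proj_partition_def by blast
  have "\<tau> a v \<le> (\<Sum>a\<in>UNIV. \<tau> a v)" by (rule member_le_sum) (use nn in auto)
  then show "\<tau> a v \<le> 1" using assms unfolding proj_partition_def by simp
qed

text \<open>The measure on the affine charts of projective space.\<close>

interpretation lborel_product: product_sigma_finite "\<lambda>_. lborel :: complex measure"
  by (rule product_sigma_finite.intro) (rule lborel.sigma_finite_measure_axioms)

context local_finsler begin

context
  fixes \<tau> :: "'n \<Rightarrow> complex^'n \<Rightarrow> real"
  assumes \<tau>: "proj_partition \<tau>"
begin

definition fibre_integrand :: "'n \<Rightarrow> complex^'n \<Rightarrow> ('n \<Rightarrow> complex) \<Rightarrow> real" where
  "fibre_integrand a z u = \<tau> a (affine_point a u) * proj_density g a z u"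

lemma fibre_integrand_nonneg: "z \<in> U \<Longrightarrow> 0 \<le> fibre_integrand a z u"
  using proj_partition_bounds[OF \<tau> affine_point_nonzero] proj_density_pos[of z a u]
  by (simp add: fibre_integrand_def)

text \<open>Joint measurability, needed for the measurability of the fibre integral in \<open>z\<close>: the integrand is
  a function continuous on an open set, evaluated at \<open>(z, affine_point a u)\<close>.\<close>

lemma fibre_integrand_measurable:
  "(\<lambda>(z, u). indicator U z * fibre_integrand a z u)
      \<in> borel_measurable (borel \<Otimes>\<^sub>M Pi\<^sub>M (- {a}) (\<lambda>_. lborel))"
proof -
  have cont: "continuous_on (U \<times> - {0}) (\<lambda>x. \<tau> a (snd x) * Re (proj_volume_form g x (affine_frame a)))"
  proof (intro continuous_on_mult continuous_proj_volume)
    have "continuous_on (- {0}) (\<tau> a)" using \<tau> unfolding proj_partition_def by blast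
    then show "continuous_on (U \<times> - {0}) (\<lambda>x. \<tau> a (snd x))"
      by (rule continuous_on_compose2[OF _ continuous_on_snd[OF continuous_on_id]]) auto
  qed
  define p where "p x = indicator (U \<times> - {0}) x *\<^sub>R (\<tau> a (snd x)
      * Re (proj_volume_form g x (affine_frame a)))" for x
  have p: "p \<in> borel_measurable borel"
    unfolding p_def by (rule borel_measurable_continuous_on_indicator[OF _ cont]) (use open_slit in auto)
  have "(\<lambda>y. (fst y, affine_point a (snd y))) \<in> borel_measurable
      ((borel :: (complex^'n) measure) \<Otimes>\<^sub>M Pi\<^sub>M (- {a}) (\<lambda>_. lborel))"
    by (intro borel_measurable_Pair measurable_fst
        measurable_compose[OF measurable_snd affine_point_measurable])
  from measurable_compose[OF this p]
  have "(\<lambda>y. p (fst y, affine_point a (snd y)))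
      \<in> borel_measurable ((borel :: (complex^'n) measure) \<Otimes>\<^sub>M Pi\<^sub>M (- {a}) (\<lambda>_. lborel))" .
  moreover have "p (fst y, affine_point a (snd y))
      = (case y of (z, u) \<Rightarrow> indicator U z * fibre_integrand a z u)" for y
    using affine_point_nonzero[of a "snd y"]
    by (auto simp: p_def fibre_integrand_def proj_density_def indicator_def split: prod.splits)
  ultimately show ?thesis by simp
qed

definition fibre_box :: "real \<Rightarrow> 'n \<Rightarrow> ('n \<Rightarrow> complex) set" where
  "fibre_box R a = PiE (- {a}) (\<lambda>_. cball 0 R)"

lemma fibre_box: "fibre_box R a \<in> sets (Pi\<^sub>M (- {a}) (\<lambda>_. lborel))"
    "emeasure (Pi\<^sub>M (- {a}) (\<lambda>_. lborel)) (fibre_box R a) < \<infinity>"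
proof -
  show "fibre_box R a \<in> sets (Pi\<^sub>M (- {a}) (\<lambda>_. lborel))"
    unfolding fibre_box_def by (intro sets_PiM_I_finite) auto
  have "emeasure (Pi\<^sub>M (- {a}) (\<lambda>_. lborel)) (fibre_box R a)
      = (\<Prod>b\<in>- {a}. emeasure lborel (cball 0 R :: complex set))"
    unfolding fibre_box_def by (intro lborel_product.emeasure_PiM) auto
  also have "\<dots> < \<infinity>"
    using emeasure_lborel_cball_finite[of "0 :: complex" R]
        by (simp add: ennreal_prod_eq_top less_top[symmetric] power_eq_top_ennreal)
  finally show "emeasure (Pi\<^sub>M (- {a}) (\<lambda>_. lborel)) (fibre_box R a) < \<infinity>" .
qed

lemma fibre_integrand_bound:
  assumes Z: "compact Z" "Z \<subseteq> U"
  shows "\<exists>B R. 0 \<le> B \<and> (\<forall>z\<in>Z. \<forall>u\<in>space (Pi\<^sub>M (- {a}) (\<lambda>_. lborel)). norm (fibre_integrand a z u) \<le> B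
      * indicator (fibre_box R a) u)"
proof -
  obtain R where R: "\<And>u. \<tau> a (affine_point a u) \<noteq> 0 \<Longrightarrow> norm (affine_point a u) \<le> R"
    using proj_partition_affine_support[OF \<tau>] by blast
  define V where "V = {v :: complex^'n. v $ a = 1} \<inter> cball 0 R"
  have V: "compact V" unfolding V_def
    by (intro closed_Int_compact closed_Collect_eq continuous_intros) auto
  have VS: "Z \<times> V \<subseteq> U \<times> - {0}" using Z by (auto simp: V_def)
  have "bounded ((\<lambda>x. Re (proj_volume_form g x (affine_frame a))) ` (Z \<times> V))"
    by (intro compact_imp_bounded compact_continuous_image
        continuous_on_subset[OF continuous_proj_volume VS] compact_Times Z V)
  then obtain B where B: "0 < B" "\<And>x. x \<in> Z \<times> V \<Longrightarrow> norm (Re (proj_volume_form g x (affine_frame a))) \<le> B"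
    unfolding bounded_pos by auto
  have "norm (fibre_integrand a z u) \<le> B * indicator (fibre_box R a) u"
    if z: "z \<in> Z" and u: "u \<in> space (Pi\<^sub>M (- {a}) (\<lambda>_. lborel))" for z u
  proof (cases "\<tau> a (affine_point a u) = 0")
    case True
    then show ?thesis using B(1) by (simp add: fibre_integrand_def)
  next
    case False
    have r: "norm (affine_point a u) \<le> R" by (rule R[OF False])
    have "u \<in> fibre_box R a"
      unfolding fibre_box_def
    proof (rule PiE_I)
      fix b assume "b \<in> - {a}"
      then have "cmod (u b) = norm (affine_point a u $ b)" by (simp add: affine_point_nth)
      also have "\<dots> \<le> R" using Finite_Cartesian_Product.norm_nth_le[of "affine_point a u" b] r by linarith
      finally show "u b \<in> cball 0 R" by simp
    qed (use u in \<open>auto simp: space_PiM PiE_def extensional_def\<close>)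
    moreover have "(z, affine_point a u) \<in> Z \<times> V" using z r by (simp add: V_def affine_point_nth)
    from B(2)[OF this] have "\<bar>proj_density g a z u\<bar> \<le> B" by (simp add: proj_density_def)
    moreover have "\<bar>\<tau> a (affine_point a u)\<bar> \<le> 1"
      using proj_partition_bounds[OF \<tau> affine_point_nonzero[of a u], of a] by simp
    ultimately show ?thesis
      using mult_mono[of "\<bar>\<tau> a (affine_point a u)\<bar>" 1 "\<bar>proj_density g a z u\<bar>" B]
          by (simp add: fibre_integrand_def abs_mult)
  qed
  with B(1) show ?thesis by (intro exI[of _ B] exI[of _ R]) auto
qed

lemma fibre_integrand_measurable_at:
  assumes "z \<in> U"
  shows "fibre_integrand a z \<in> borel_measurable (Pi\<^sub>M (- {a}) (\<lambda>_. lborel))"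
proof -
  have "(\<lambda>u. (z, u)) \<in> measurable (Pi\<^sub>M (- {a}) (\<lambda>_. lborel :: complex measure))
      (borel \<Otimes>\<^sub>M Pi\<^sub>M (- {a}) (\<lambda>_. lborel))"
    by (intro measurable_Pair measurable_const measurable_ident_sets) auto
  from measurable_compose[OF this fibre_integrand_measurable] show ?thesis using assms by simp
qed

lemma fibre_integrand_integrable:
  assumes "z \<in> U"
  shows "integrable (Pi\<^sub>M (- {a}) (\<lambda>_. lborel)) (fibre_integrand a z)"
proof -
  obtain B R where B: "\<forall>u\<in>space (Pi\<^sub>M (- {a}) (\<lambda>_. lborel)). norm (fibre_integrand a z u) \<le> B
      * indicator (fibre_box R a) u"
    using fibre_integrand_bound[of "{z}" a] assms by auto
  have "integrable (Pi\<^sub>M (- {a}) (\<lambda>_. lborel)) (\<lambda>u. B * indicator (fibre_box R a) u)"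
    using fibre_box[where R = R and a = a] by (intro integrable_mult_right integrable_real_indicator) auto
  then show ?thesis
    by (rule Bochner_Integration.integrable_bound[OF _ fibre_integrand_measurable_at[OF assms]])
       (intro AE_I2, use B in fastforce)
qed

definition fibre_integral :: "complex^'n \<Rightarrow> real" where
  "fibre_integral z = (\<Sum>a\<in>UNIV. LINT u | Pi\<^sub>M (- {a}) (\<lambda>_. lborel). fibre_integrand a z u)"

lemma fibre_integral_measurable: "(\<lambda>z. indicator U z * fibre_integral z) \<in> borel_measurable borel"
proof -
  have "(\<lambda>z. LINT u | Pi\<^sub>M (- {a}) (\<lambda>_. lborel). indicator U z * fibre_integrand a z u)
      \<in> borel_measurable borel" for a
  proof -
    interpret sigma_finite_measure "Pi\<^sub>M (- {a}) (\<lambda>_. lborel :: complex measure)"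
      by (rule lborel_product.sigma_finite) simp
    show ?thesis by (rule borel_measurable_lebesgue_integral[OF fibre_integrand_measurable])
  qed
  then have "(\<lambda>z. \<Sum>a\<in>UNIV. LINT u | Pi\<^sub>M (- {a}) (\<lambda>_. lborel). indicator U z * fibre_integrand a z u)
      \<in> borel_measurable borel"
    by (rule borel_measurable_sum)
  then show ?thesis by (simp only: fibre_integral_def sum_distrib_left integral_mult_right_zero)
qed

lemma fibre_integral_bound:
  assumes Z: "compact Z" "Z \<subseteq> U"
  shows "\<exists>B. \<forall>z\<in>Z. \<bar>fibre_integral z\<bar> \<le> B"
proof -
  have "\<exists>B. \<forall>z\<in>Z. \<bar>LINT u | Pi\<^sub>M (- {a}) (\<lambda>_. lborel). fibre_integrand a z u\<bar> \<le> B" for a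
  proof -
    let ?N = "Pi\<^sub>M (- {a}) (\<lambda>_. lborel :: complex measure)"
    obtain B R where B: "\<forall>z\<in>Z. \<forall>u\<in>space ?N. norm (fibre_integrand a z u) \<le> B * indicator (fibre_box R a) u"
      using fibre_integrand_bound[OF Z, of a] by blast
    have int: "integrable ?N (\<lambda>u. B * indicator (fibre_box R a) u)"
      using fibre_box[where R = R and a = a] by (intro integrable_mult_right integrable_real_indicator) auto
    have "\<bar>LINT u | ?N. fibre_integrand a z u\<bar> \<le> (LINT u | ?N. B * indicator (fibre_box R a) u)"
        if "z \<in> Z" for z
      by (rule order_trans[OF integral_abs_bound], rule integral_mono)
         (use B that Z fibre_integrand_integrable int in \<open>auto intro!: integrable_abs\<close>)
    then show ?thesis by blast
  qed
  then obtain B where "\<And>a z. z \<in> Z \<Longrightarrow> \<bar>LINT u | Pi\<^sub>M (- {a}) (\<lambda>_. lborel). fibre_integrand a z u\<bar> \<le> B a"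
    by metis
  then have "\<bar>fibre_integral z\<bar> \<le> (\<Sum>a\<in>UNIV. B a)" if "z \<in> Z" for z
    unfolding fibre_integral_def using that by (intro order_trans[OF sum_abs] sum_mono) auto
  then show ?thesis by blast
qed

text \<open>Some \<open>\<tau> a\<close> is positive at the vector with all entries \<open>1\<close>, which lies in every affine chart;
  hence it is positive on a box of positive measure in the \<open>a\<close>-th chart.\<close>

lemma fibre_integral_pos:
  assumes z: "z \<in> U"
  shows "0 < fibre_integral z"
proof -
  define v1 :: "complex^'n" where "v1 = (\<chi> b. 1)"
  have v1: "v1 \<noteq> 0" by (simp add: v1_def Finite_Cartesian_Product.vec_eq_iff)
  have "\<exists>a. 0 < \<tau> a v1"
  proof (rule ccontr)
    assume "\<nexists>a. 0 < \<tau> a v1"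
    then have "(\<Sum>a\<in>UNIV. \<tau> a v1) \<le> 0" by (intro sum_nonpos) (auto simp: not_less)
    then show False using \<tau> v1 unfolding proj_partition_def by simp
  qed
  then obtain a where a: "0 < \<tau> a v1" ..
  let ?N = "Pi\<^sub>M (- {a}) (\<lambda>_. lborel :: complex measure)"
  have "continuous_on (- {0}) (\<tau> a)" using \<tau> unfolding proj_partition_def by blast
  then have "open (\<tau> a -` {0<..} \<inter> - {0})"
    by (subst (asm) continuous_on_open_vimage) (auto intro!: open_Compl)
  moreover have "v1 \<in> \<tau> a -` {0<..} \<inter> - {0}" using a v1 by simp
  ultimately obtain W where W: "\<And>i. open (W i) \<and> v1 $ i \<in> W i" "\<And>y. (\<forall>i. y $ i \<in> W i) \<Longrightarrow> y
      \<in> \<tau> a -` {0<..} \<inter> - {0}"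
    unfolding open_vec_def by metis
  have meas: "PiE (- {a}) W \<in> sets ?N" using W(1) by (intro sets_PiM_I_finite) auto
  have "emeasure ?N (PiE (- {a}) W) = (\<Prod>b\<in>- {a}. emeasure lborel (W b))"
    using W(1) by (intro lborel_product.emeasure_PiM) auto
  also have "\<dots> \<noteq> 0" using emeasure_lborel_open_nonzero W(1) by (auto simp: prod_zero_iff)
  finally have nz: "emeasure ?N (PiE (- {a}) W) \<noteq> 0" .
  have "0 < (LINT u | ?N. fibre_integrand a z u)"
  proof (rule integral_pos[OF fibre_integrand_integrable[OF z] fibre_integrand_nonneg[OF z] meas nz])
    fix u assume u: "u \<in> PiE (- {a}) W"
    have "affine_point a u $ i \<in> W i" for i
      using u W(1)[of i] by (auto simp: affine_point_nth v1_def)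
    then have "0 < \<tau> a (affine_point a u)" using W(2)[of "affine_point a u"] by simp
    then show "0 < fibre_integrand a z u" using proj_density_pos[OF z] by (simp add: fibre_integrand_def)
  qed
  moreover have "0 \<le> (LINT u | Pi\<^sub>M (- {b}) (\<lambda>_. lborel). fibre_integrand b z u)" for b
    by (rule integral_nonneg_AE) (simp add: fibre_integrand_nonneg[OF z])
  ultimately show ?thesis unfolding fibre_integral_def by (intro sum_pos2[where i = a]) auto
qed

end

end


section \<open>Partitions of unity on compact manifolds\<close>

text \<open>A compact Hausdorff space is completely regular: for each point \<open>p\<close> there is a continuous \<open>f p\<close>
  with value \<open>0\<close> at \<open>p\<close> and \<open>1\<close> outside a chart. Cutting off at \<open>1 / 2\<close> gives functions whose
  closed support is contained in the chart, and finitely many of the sets \<open>f p < 1 / 2\<close> cover.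
  Those belonging to the same chart are added up.\<close>

lemma manifold_partition_exists:
  fixes M :: "'a topology" and A :: "('a, 'n::finite) chart set"
  assumes compact: "compact_space M" and Hausdorff: "Hausdorff_space M"
    and cover: "\<And>p. p \<in> topspace M \<Longrightarrow> \<exists>c\<in>A. openin M (fst c) \<and> p \<in> fst c"
  shows "\<exists>K \<rho>. manifold_partition M A K \<rho>"
proof -
  have "completely_regular_space M"
    using normal_imp_completely_regular_space compact_Hausdorff_or_regular_imp_normal_space compact
        Hausdorff by blast
  then have cr: "\<exists>f. continuous_map M euclideanreal f \<and> f p = 0 \<and> f ` (topspace M - S) \<subseteq> {1}"
    if "openin M S" "p \<in> S" for p S
    using that unfolding completely_regular_space_alt' by blast
  have "\<exists>c f. c \<in> A \<and> openin M (fst c) \<and> p \<in> fst c \<and> continuous_map M euclideanreal f \<and> f p = 0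
      \<and> f ` (topspace M - fst c) \<subseteq> {1::real}"
    if "p \<in> topspace M" for p
    using cover[OF that] cr by meson
  then obtain c f where cA: "\<And>p. p \<in> topspace M \<Longrightarrow> c p \<in> A"
    and cf: "\<And>p. p \<in> topspace M \<Longrightarrow> continuous_map M euclideanreal (f p)"
    and fp: "\<And>p. p \<in> topspace M \<Longrightarrow> f p p = (0::real)"
    and f1: "\<And>p. p \<in> topspace M \<Longrightarrow> f p ` (topspace M - fst (c p)) \<subseteq> {1}"
    by metis
  define k where "k p q = max 0 (1 / 2 - f p q)" for p q
  define V where "V p = {q \<in> topspace M. f p q \<in> {..<1 / 2}}" for p
  have "\<forall>U\<in>V ` topspace M. openin M U"
  proof (rule ballI, elim imageE)
    fix U p assume "U = V p" "p \<in> topspace M"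
    then show "openin M U"
      unfolding V_def by (simp only: openin_continuous_map_preimage[OF cf] open_openin[symmetric]
          open_lessThan)
  qed
  moreover have "topspace M \<subseteq> \<Union> (V ` topspace M)" using fp by (auto simp: V_def)
  ultimately obtain \<F> where "finite \<F>" "\<F> \<subseteq> V ` topspace M" and \<F>: "topspace M \<subseteq> \<Union>\<F>"
    using compact unfolding compact_space_alt by meson
  then obtain P where P: "finite P" "P \<subseteq> topspace M" "\<F> = V ` P"
    by (meson finite_subset_image)
  define s where "s q = (\<Sum>p\<in>P. k p q)" for q
  have k_nonneg: "0 \<le> k p q" for p q by (simp add: k_def)
  have s_pos: "0 < s q" if "q \<in> topspace M" for q
  proof -
    have "q \<in> \<Union> (V ` P)" using \<F> that P(3) by blast
    then obtain p where "p \<in> P" "q \<in> V p" by blast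
    then show ?thesis unfolding s_def using P(1) k_nonneg
      by (intro sum_pos2[where i = p]) (auto simp: V_def k_def)
  qed
  define K where "K = c ` P"
  define \<rho> where "\<rho> d q = (\<Sum>p\<in>{p \<in> P. c p = d}. k p q) / s q" for d q
  have cont_k: "continuous_map M euclideanreal (k p)" if "p \<in> P" for p
    unfolding k_def using cf P(2) that
    by (intro continuous_map_real_max continuous_map_diff continuous_map_const[THEN iffD2]) auto
  have "manifold_partition M A K \<rho>"
    unfolding manifold_partition_def
  proof (intro conjI ballI)
    show "finite K" "K \<subseteq> A" using P(1,2) cA by (auto simp: K_def)
    show "continuous_map M euclideanreal (\<rho> d)" for d
      unfolding \<rho>_def
    proof (rule continuous_map_real_divide)
      show "continuous_map M euclideanreal (\<lambda>q. \<Sum>p\<in>{p \<in> P. c p = d}. k p q)"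
        by (rule continuous_map_sum) (use P(1) cont_k in auto)
      show "continuous_map M euclideanreal s"
        unfolding s_def by (rule continuous_map_sum) (use P(1) cont_k in auto)
      show "s q \<noteq> 0" if "q \<in> topspace M" for q using s_pos[OF that] by simp
    qed
    show "0 \<le> \<rho> d q" if "q \<in> topspace M" for d q
      unfolding \<rho>_def using s_pos[OF that] by (intro divide_nonneg_pos sum_nonneg k_nonneg) auto
    show "M closure_of {q \<in> topspace M. \<rho> d q \<noteq> 0} \<subseteq> fst d" for d
    proof -
      define C where "C = (\<Union>p\<in>{p \<in> P. c p = d}. {q \<in> topspace M. f p q \<in> {..1 / 2}})"
      have "closedin M C" unfolding C_def
      proof (rule closedin_Union)
        show "finite ((\<lambda>p. {q \<in> topspace M. f p q \<in> {..1 / 2}}) ` {p \<in> P. c p = d})" using P(1) by simp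
      next
        fix T assume "T \<in> (\<lambda>p. {q \<in> topspace M. f p q \<in> {..1 / 2}}) ` {p \<in> P. c p = d}"
        then obtain p where "p \<in> topspace M" and T: "T = {q \<in> topspace M. f p q \<in> {..1 / 2}}" using P(2)
            by blast
        then show "closedin M T"
          unfolding T by (simp only: closedin_continuous_map_preimage[OF cf] closed_closedin[symmetric]
              closed_atMost)
      qed
      moreover have "{q \<in> topspace M. \<rho> d q \<noteq> 0} \<subseteq> C"
      proof clarify
        fix q assume q: "q \<in> topspace M" and "\<rho> d q \<noteq> 0"
        then have "(\<Sum>p\<in>{p \<in> P. c p = d}. k p q) \<noteq> 0" by (auto simp: \<rho>_def)
        then obtain p where p: "p \<in> {p \<in> P. c p = d}" "k p q \<noteq> 0"
            by (rule sum.not_neutral_contains_not_neutral)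
        then show "q \<in> C" using q unfolding C_def
            by (intro UN_I[OF p(1)]) (auto simp: k_def max_def split: if_splits)
      qed
      ultimately have "M closure_of {q \<in> topspace M. \<rho> d q \<noteq> 0} \<subseteq> C" by (intro closure_of_minimal)
      also have "C \<subseteq> fst d"
      proof
        fix q assume "q \<in> C"
        then obtain p where p: "p \<in> P" "c p = d" "q \<in> topspace M" "f p q \<le> 1 / 2" by (auto simp: C_def)
        show "q \<in> fst d"
        proof (rule ccontr)
          assume "q \<notin> fst d"
          then have "q \<in> topspace M - fst (c p)" using p(2,3) by simp
          moreover have "p \<in> topspace M" using p(1) P(2) by blast
          ultimately have "f p q \<in> {1}" using f1 by blast
          then show False using p(4) by simp
        qed
      qed
      finally show ?thesis .
    qed
    show "(\<Sum>d\<in>K. \<rho> d q) = 1" if "q \<in> topspace M" for q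
    proof -
      have "(\<Sum>d\<in>K. \<Sum>p\<in>{p \<in> P. c p = d}. k p q) = s q"
        unfolding K_def s_def by (rule sum.image_gen[OF P(1), symmetric])
      then show ?thesis using s_pos[OF that] by (simp add: \<rho>_def sum_divide_distrib[symmetric])
    qed
  qed
  then show ?thesis by blast
qed

section \<open>Charts and tangent vectors\<close>

locale charted_manifold =
  fixes M :: "'a topology" and A :: "('a, 'n::finite) chart set"
  assumes manifold: "complex_manifold M A"
begin

lemma chart_open: "c \<in> A \<Longrightarrow> openin M (fst c)"
  and chart_image_open: "c \<in> A \<Longrightarrow> open (chart_image c)"
  and chart_homeomorphic: "c \<in> A \<Longrightarrow> homeomorphic_map (subtopology M (fst c)) (top_of_set (chart_image c))
      (snd c)"
  and transition_holomorphic: "c \<in> A \<Longrightarrow> d \<in> A \<Longrightarrow> holomorphic_map_on (transition c d)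
      (snd c ` (fst c \<inter> fst d))"
  and chart_cover: "p \<in> topspace M \<Longrightarrow> \<exists>c\<in>A. p \<in> fst c"
  and Hausdorff: "Hausdorff_space M"
  using manifold unfolding complex_manifold_def by (simp_all, blast)

lemma chart_subset: "c \<in> A \<Longrightarrow> fst c \<subseteq> topspace M"
  using openin_subset[OF chart_open] .

lemma chart_topspace: "c \<in> A \<Longrightarrow> topspace (subtopology M (fst c)) = fst c"
  unfolding topspace_subtopology by (rule Int_absorb1[OF chart_subset])

lemma chart_inj: "c \<in> A \<Longrightarrow> inj_on (snd c) (fst c)"
  using homeomorphic_imp_injective_map[OF chart_homeomorphic] chart_topspace by metis

lemma chart_inv_chart: "c \<in> A \<Longrightarrow> p \<in> fst c \<Longrightarrow> chart_inv c (snd c p) = p"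
  by (rule inv_into_f_f[OF chart_inj])

lemma chart_inv_in: "z \<in> chart_image c \<Longrightarrow> chart_inv c z \<in> fst c"
  by (rule inv_into_into)

lemma chart_chart_inv: "z \<in> chart_image c \<Longrightarrow> snd c (chart_inv c z) = z"
  by (rule f_inv_into_f)

lemma chart_image_of_open:
  assumes c: "c \<in> A" and W: "openin M W" "W \<subseteq> fst c"
  shows "open (snd c ` W)"
proof -
  have "openin (subtopology M (fst c)) W"
    using W openin_open_subtopology[OF chart_open[OF c]] by blast
  then have "openin (top_of_set (chart_image c)) (snd c ` W)"
    using homeomorphic_imp_open_map[OF chart_homeomorphic[OF c]] unfolding open_map_def by blast
  then show ?thesis using openin_open_eq[OF chart_image_open[OF c]] by blast
qed

lemma chart_overlap_open: "c \<in> A \<Longrightarrow> d \<in> A \<Longrightarrow> open (snd c ` (fst c \<inter> fst d))"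
  by (rule chart_image_of_open) (auto intro: openin_Int chart_open)

lemma chart_overlapI: "z \<in> chart_image c \<Longrightarrow> chart_inv c z \<in> fst d \<Longrightarrow> z \<in> snd c ` (fst c \<inter> fst d)"
  using chart_inv_in[of z c] chart_chart_inv[of z c] by (metis IntI imageI)

lemma chart_continuous:
  assumes "c \<in> A"
  shows "continuous_map (subtopology M (fst c)) euclidean (snd c)"
  using homeomorphic_imp_continuous_map[OF chart_homeomorphic[OF assms]]
      continuous_map_into_fulltopology by blast

lemma chart_inv_continuous:
  assumes c: "c \<in> A"
  shows "continuous_map (top_of_set (chart_image c)) M (chart_inv c)"
proof -
  obtain h where h: "homeomorphic_maps (subtopology M (fst c)) (top_of_set (chart_image c)) (snd c) h"
    using chart_homeomorphic[OF c] unfolding homeomorphic_map_maps by blast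
  have "continuous_map (top_of_set (chart_image c)) M h"
    using h unfolding homeomorphic_maps_def by (blast intro: continuous_map_into_fulltopology)
  moreover have "h z = chart_inv c z" if z: "z \<in> topspace (top_of_set (chart_image c))" for z
  proof -
    have "h (snd c (chart_inv c z)) = chart_inv c z"
      using h chart_inv_in[of z c] z chart_topspace[OF c] unfolding homeomorphic_maps_def by auto
    then show ?thesis using chart_chart_inv[of z c] z by simp
  qed
  ultimately show ?thesis by (rule continuous_map_eq)
qed

lemma transition_has_derivative:
  assumes "c \<in> A" "d \<in> A" "z \<in> snd c ` (fst c \<inter> fst d)"
  shows "(transition c d has_derivative frechet_derivative (transition c d) (at z)) (at z)"
    and "frechet_derivative (transition c d) (at z) (l *s v)
        = l *s frechet_derivative (transition c d) (at z) v"
proof -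
  obtain D where D: "(transition c d has_derivative D) (at z)" "\<And>a v. D (a *s v) = a *s D v"
    using transition_holomorphic[OF assms(1,2)] assms(3) unfolding holomorphic_map_on_def by blast
  have "D = frechet_derivative (transition c d) (at z)" by (rule frechet_derivative_at[OF D(1)])
  then show "(transition c d has_derivative frechet_derivative (transition c d) (at z)) (at z)"
    "frechet_derivative (transition c d) (at z) (l *s v)
        = l *s frechet_derivative (transition c d) (at z) v"
    using D by simp_all
qed

lemma transition_self_derivative:
  assumes "c \<in> A" "z \<in> chart_image c"
  shows "frechet_derivative (transition c c) (at z) v = v"
proof -
  have "frechet_derivative (transition c c) (at z) = frechet_derivative (\<lambda>z. z) (at z)"
    by (rule frechet_derivative_cong_open[OF chart_image_open[OF assms(1)] assms(2)])
       (simp add: transition_def chart_chart_inv)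
  also have "\<dots> = (\<lambda>v. v)" by (rule frechet_derivative_at[symmetric, OF has_derivative_ident])
  finally show ?thesis by simp
qed

lemma transition_chain:
  assumes c: "c \<in> A" and d: "d \<in> A" and e: "e \<in> A" and z: "z \<in> chart_image c"
    and zd: "chart_inv c z \<in> fst d" and ze: "chart_inv c z \<in> fst e"
  shows "frechet_derivative (transition c e) (at z) v =
    frechet_derivative (transition d e) (at (snd d (chart_inv c z)))
        (frechet_derivative (transition c d) (at z) v)"
proof -
  let ?w = "snd d (chart_inv c z)"
  have z1: "z \<in> snd c ` (fst c \<inter> fst d)" by (rule chart_overlapI[OF z zd])
  have w: "?w \<in> snd d ` (fst d \<inter> fst e)" using zd ze by blast
  have "frechet_derivative (transition c e) (at z)
      = frechet_derivative (\<lambda>y. transition d e (transition c d y)) (at z)"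
  proof (rule frechet_derivative_cong_open[OF chart_overlap_open[OF c d] z1])
    fix y assume "y \<in> snd c ` (fst c \<inter> fst d)"
    then obtain q where "y = snd c q" "q \<in> fst c" "q \<in> fst d" by blast
    then show "transition c e y = transition d e (transition c d y)"
      by (simp add: transition_def chart_inv_chart c d)
  qed
  moreover have "((\<lambda>y. transition d e (transition c d y)) has_derivative
      (\<lambda>v. frechet_derivative (transition d e) (at ?w) (frechet_derivative (transition c d) (at z) v)))
          (at z)"
  proof (rule has_derivative_compose[OF transition_has_derivative(1)[OF c d z1]])
    have "transition c d z = ?w" by (simp add: transition_def)
    then show "(transition d e has_derivative frechet_derivative (transition d e) (at ?w))
        (at (transition c d z))"
      using transition_has_derivative(1)[OF d e w] by simp
  qed
  from frechet_derivative_at[OF this] have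
    "frechet_derivative (\<lambda>y. transition d e (transition c d y)) (at z) =
     (\<lambda>v. frechet_derivative (transition d e) (at ?w) (frechet_derivative (transition c d) (at z) v))"
         by simp
  ultimately show ?thesis by simp
qed

text \<open>The compatibility of the components is the chain rule for the coordinate changes.\<close>

lemma tangent_of_in_bundle:
  assumes c: "c \<in> A" and z: "z \<in> chart_image c"
  shows "tangent_of A c (z, v) \<in> tangent_bundle M A"
  unfolding tangent_bundle_def tangent_of_def mem_Collect_eq case_prod_conv
proof (intro conjI allI ballI impI)
  show "chart_inv c z \<in> topspace M" using chart_inv_in[OF z] chart_subset[OF c] by blast
next
  fix d e assume d: "d \<in> A" "e \<in> A" and p: "chart_inv c z \<in> fst d \<and> chart_inv c z \<in> fst e"
  then show "(if e \<in> A \<and> chart_inv c z \<in> fst e then frechet_derivative (transition c e) (at z) v else 0) =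
    frechet_derivative (transition d e) (at (snd d (chart_inv c z)))
      (if d \<in> A \<and> chart_inv c z \<in> fst d then frechet_derivative (transition c d) (at z) v else 0)"
    using transition_chain[OF c d z] by simp
qed auto

lemma tangent_of_scale:
  assumes c: "c \<in> A" and z: "z \<in> chart_image c"
  shows "tangent_of A c (z, l *s v) = scale_tangent l (tangent_of A c (z, v))"
  by (auto simp: tangent_of_def scale_tangent_def fun_eq_iff
      transition_has_derivative(2)[OF c _ chart_overlapI[OF z]])

lemma fst_tangent_of: "fst (tangent_of A c (z, v)) = chart_inv c z"
  by (simp add: tangent_of_def)

lemma tangent_of_nonzero:
  assumes c: "c \<in> A" and z: "z \<in> chart_image c" and v: "v \<noteq> 0"
  shows "snd (tangent_of A c (z, v)) \<noteq> (\<lambda>_. 0)"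
proof
  assume "snd (tangent_of A c (z, v)) = (\<lambda>_. 0)"
  from fun_cong[OF this, of c] show False
    using c chart_inv_in[OF z] v by (simp add: tangent_of_def transition_self_derivative[OF c z])
qed

lemma local_finsler_local_rep:
  assumes G: "complex_finsler M A G" and c: "c \<in> A"
  shows "local_finsler (chart_image c) (local_rep A G c)"
proof
  show "open (chart_image c)" by (rule chart_image_open[OF c])
  show "Cinf_on (chart_image c \<times> - {0}) (local_rep A G c)" using G c unfolding complex_finsler_def by blast
  show "positive_definite (levi_matrix (local_rep A G c) x)" if "x \<in> chart_image c \<times> - {0}" for x
    using G c that unfolding complex_finsler_def by blast
  fix z assume z: "z \<in> chart_image c"
  fix v :: "complex^'n" assume v: "v \<noteq> 0"
  have t: "tangent_of A c (z, v) \<in> tangent_bundle M A" by (rule tangent_of_in_bundle[OF c z])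
  have nn: "0 \<le> G (tangent_of A c (z, v))" and nz: "G (tangent_of A c (z, v)) = 0
      \<longleftrightarrow> snd (tangent_of A c (z, v)) = (\<lambda>_. 0)"
    using G t unfolding complex_finsler_def by blast+
  then show "0 < local_rep A G c (z, v)"
    using tangent_of_nonzero[OF c z v] by (simp add: local_rep_def)
  fix l :: complex assume "l \<noteq> 0"
  then have "complex_of_real (G (scale_tangent l (tangent_of A c (z, v)))) = l * cnj l
      * complex_of_real (G (tangent_of A c (z, v)))"
    using G t unfolding complex_finsler_def by blast
  also have "\<dots> = complex_of_real ((cmod l)\<^sup>2 * G (tangent_of A c (z, v)))"
    by (simp only: of_real_mult complex_norm_square)
  finally have "G (scale_tangent l (tangent_of A c (z, v))) = (cmod l)\<^sup>2 * G (tangent_of A c (z, v))"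
    by (simp only: of_real_eq_iff)
  then show "local_rep A G c (z, l *s v) = (cmod l)\<^sup>2 * local_rep A G c (z, v)"
    by (simp add: local_rep_def tangent_of_scale[OF c z])
qed

lemma local_rep_conformal_change:
  assumes "c \<in> A" "z \<in> chart_image c"
  shows "local_rep A (conformal_change M A f G) c (z, v) = exp (f (chart_inv c z)) * local_rep A G c (z, v)"
  using tangent_of_in_bundle[OF assms] by (simp add: local_rep_def conformal_change_def fst_tangent_of)

section \<open>The volume of a compact Finsler manifold\<close>

lemma induced_volume_eq:
  "induced_volume A G c z = local_finsler.fibre_integral (local_rep A G c) (SOME \<tau>. proj_partition \<tau>) z"
  if "complex_finsler M A G" "c \<in> A"
proof -
  interpret local_finsler "chart_image c" "local_rep A G c" by (rule local_finsler_local_rep[OF that])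
  have \<tau>: "proj_partition (SOME \<tau> :: 'n \<Rightarrow> complex^'n \<Rightarrow> real. proj_partition \<tau>)"
    using proj_partition_exists by (rule someI_ex)
  show ?thesis
    unfolding induced_volume_def proj_integral_def Let_def fibre_integral_def[OF \<tau>]
        fibre_integrand_def[OF \<tau>] ..
qed

text \<open>Each chart of the partition contributes the integral of a nonnegative measurable function that
  is bounded and supported on a compact subset of the chart. At any given point some \<open>\<rho> c\<close> is
  positive, and so is the contribution of that chart.\<close>

lemma vol_pos:
  assumes compact: "compact_space M" and ne: "topspace M \<noteq> {}" and G: "complex_finsler M A G"
  shows "0 < vol M A G"
proof -
  define \<tau> where "\<tau> = (SOME \<tau> :: 'n \<Rightarrow> complex^'n \<Rightarrow> real. proj_partition \<tau>)"
  have \<tau>: "proj_partition \<tau>" unfolding \<tau>_def using proj_partition_exists by (rule someI_ex)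
  define K\<rho> where "K\<rho> = (SOME (K, \<rho>). manifold_partition M A K \<rho>)"
  obtain K \<rho> where K\<rho>: "K\<rho> = (K, \<rho>)" by fastforce
  have "\<exists>x. case x of (K, \<rho>) \<Rightarrow> manifold_partition M A K \<rho>"
    using manifold_partition_exists[OF compact Hausdorff, of A] chart_cover chart_open by fast
  then have "case K\<rho> of (K, \<rho>) \<Rightarrow> manifold_partition M A K \<rho>"
    unfolding K\<rho>_def by (rule someI_ex)
  then have mp: "manifold_partition M A K \<rho>" by (simp add: K\<rho>)
  then have K: "finite K" "K \<subseteq> A" and cont_\<rho>: "\<And>c. c \<in> K \<Longrightarrow> continuous_map M euclideanreal (\<rho> c)"
    and \<rho>_nonneg: "\<And>c p. c \<in> K \<Longrightarrow> p \<in> topspace M \<Longrightarrow> 0 \<le> \<rho> c p"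
    and \<rho>_supp: "\<And>c. c \<in> K \<Longrightarrow> M closure_of {p \<in> topspace M. \<rho> c p \<noteq> 0} \<subseteq> fst c"
    and \<rho>_sum: "\<And>p. p \<in> topspace M \<Longrightarrow> (\<Sum>c\<in>K. \<rho> c p) = 1"
    unfolding manifold_partition_def by blast+
  define D where "D c z = induced_volume A G c z" for c z
  define F where "F c z = indicator (chart_image c) z *\<^sub>R (\<rho> c (chart_inv c z) * D c z)" for c z
  have vol: "vol M A G = (\<Sum>c\<in>K. integral\<^sup>L lborel (F c))"
    unfolding vol_def manifold_integral_def K\<rho>_def[symmetric] K\<rho>
    by (simp add: set_lebesgue_integral_def F_def[abs_def] D_def)
  have chart: "integrable lborel (F c)" "\<And>z. 0 \<le> F c z" "\<And>z. z \<in> chart_image c \<Longrightarrow> 0 < D c z"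
    "continuous_on (chart_image c) (\<lambda>z. \<rho> c (chart_inv c z))"
    if cK: "c \<in> K" for c
  proof -
    have c: "c \<in> A" using cK K by blast
    interpret local_finsler "chart_image c" "local_rep A G c" by (rule local_finsler_local_rep[OF G c])
    have Dc: "D c = fibre_integral \<tau>" unfolding D_def \<tau>_def using induced_volume_eq[OF G c] by blast
    show Dpos: "0 < D c z" if "z \<in> chart_image c" for z
      unfolding Dc by (rule fibre_integral_pos[OF \<tau> that])
    have top: "chart_inv c z \<in> topspace M" if "z \<in> chart_image c" for z
      using chart_inv_in[OF that] chart_subset[OF c] by blast
    show "0 \<le> F c z" for z
      unfolding F_def using Dpos[of z] \<rho>_nonneg[OF cK top[of z]] by (auto simp: indicator_def)
    show cont: "continuous_on (chart_image c) (\<lambda>z. \<rho> c (chart_inv c z))"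
      using continuous_map_compose[OF chart_inv_continuous[OF c] cont_\<rho>[OF cK]] by (simp add: o_def)
    define T where "T = M closure_of {p \<in> topspace M. \<rho> c p \<noteq> 0}"
    define Z where "Z = snd c ` T"
    have "compactin M T" unfolding T_def by (rule closedin_compact_space[OF compact closedin_closure_of])
    then have "compactin (subtopology M (fst c)) T"
      using \<rho>_supp[OF cK] by (simp add: compactin_subtopology T_def)
    from image_compactin[OF this chart_continuous[OF c]] have Z: "compact Z" by (simp add: Z_def)
    have ZU: "Z \<subseteq> chart_image c" using \<rho>_supp[OF cK] by (auto simp: Z_def T_def)
    have F0: "F c z = 0" if "z \<notin> Z" for z
    proof (cases "z \<in> chart_image c")
      case True
      have "\<rho> c (chart_inv c z) = 0"
      proof (rule ccontr)
        assume "\<rho> c (chart_inv c z) \<noteq> 0"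
        then have "chart_inv c z \<in> {p \<in> topspace M. \<rho> c p \<noteq> 0}" using top[OF True] by simp
        then have "chart_inv c z \<in> T" unfolding T_def
          using closure_of_subset[of "{p \<in> topspace M. \<rho> c p \<noteq> 0}" M] by blast
        then have "snd c (chart_inv c z) \<in> Z" unfolding Z_def by blast
        then show False using that chart_chart_inv[OF True] by simp
      qed
      then show ?thesis by (simp add: F_def)
    qed (simp add: F_def)
    have meas: "F c \<in> borel_measurable borel"
    proof -
      have 1: "(\<lambda>z. indicator (chart_image c) z *\<^sub>R \<rho> c (chart_inv c z)) \<in> borel_measurable borel"
        by (rule borel_measurable_continuous_on_indicator[OF _ cont]) (use open_U in auto)
      have "F c z = (indicator (chart_image c) z *\<^sub>R \<rho> c (chart_inv c z))
          * (indicator (chart_image c) z * fibre_integral \<tau> z)" for z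
        by (auto simp: F_def Dc indicator_def)
      then show ?thesis using borel_measurable_times[OF 1 fibre_integral_measurable[OF \<tau>]]
          by (simp cong: measurable_cong)
    qed
    obtain B1 where B1: "\<And>z. z \<in> Z \<Longrightarrow> \<bar>fibre_integral \<tau> z\<bar> \<le> B1"
      using fibre_integral_bound[OF \<tau> Z ZU] by blast
    have "bounded ((\<lambda>z. \<rho> c (chart_inv c z)) ` Z)"
      by (intro compact_imp_bounded compact_continuous_image continuous_on_subset[OF cont ZU] Z)
    then obtain B2 where B2: "0 < B2" "\<And>z. z \<in> Z \<Longrightarrow> \<bar>\<rho> c (chart_inv c z)\<bar> \<le> B2"
      unfolding bounded_pos by auto
    have bound: "norm (F c z) \<le> norm (B2 * B1 * indicator Z z)" for z
    proof (cases "z \<in> Z")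
      case True
      have "\<bar>F c z\<bar> = \<bar>\<rho> c (chart_inv c z)\<bar> * \<bar>fibre_integral \<tau> z\<bar>"
        using True ZU by (auto simp: F_def Dc abs_mult)
      also have "\<dots> \<le> B2 * B1" by (intro mult_mono B1 B2 True) (use B2(1) in auto)
      finally show ?thesis using True by simp
    qed (simp add: F0)
    have "Z \<in> sets lborel" "emeasure lborel Z < \<infinity>"
      using Z emeasure_bounded_finite[OF compact_imp_bounded[OF Z]]
          by (auto simp: compact_imp_closed less_top)
    then have "integrable lborel (\<lambda>z. B2 * B1 * indicator Z z)"
      by (intro integrable_mult_right integrable_real_indicator) auto
    then show "integrable lborel (F c)"
      by (rule Bochner_Integration.integrable_bound) (use meas bound in auto)
  qed
  obtain p where p: "p \<in> topspace M" using ne by blast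
  have "\<exists>c\<in>K. 0 < \<rho> c p"
  proof (rule ccontr)
    assume "\<not> (\<exists>c\<in>K. 0 < \<rho> c p)"
    then have "(\<Sum>c\<in>K. \<rho> c p) \<le> 0" by (intro sum_nonpos) (auto simp: not_less)
    then show False using \<rho>_sum[OF p] by simp
  qed
  then obtain c where cK: "c \<in> K" and cp: "0 < \<rho> c p" by blast
  have c: "c \<in> A" using cK K by blast
  have pc: "p \<in> fst c"
    using closure_of_subset[of "{p \<in> topspace M. \<rho> c p \<noteq> 0}" M] \<rho>_supp[OF cK] p cp by auto
  define W where "W = (\<lambda>z. \<rho> c (chart_inv c z)) -` {0<..} \<inter> chart_image c"
  have "open W" unfolding W_def
    by (rule chart(4)[OF cK, unfolded continuous_on_open_vimage[OF chart_image_open[OF c]],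
        rule_format]) simp
  moreover have "snd c p \<in> W" using cp pc by (simp add: W_def chart_inv_chart[OF c])
  ultimately have W: "W \<in> sets lborel" "emeasure lborel W \<noteq> 0"
    using emeasure_lborel_open_nonzero[of W] by auto
  have "0 < integral\<^sup>L lborel (F c)"
    by (rule integral_pos[OF chart(1,2)[OF cK] W]) (use chart(3)[OF cK] in \<open>auto simp: F_def W_def\<close>)
  moreover have "0 \<le> integral\<^sup>L lborel (F d)" if "d \<in> K" for d
    by (rule integral_nonneg_AE) (simp add: chart(2)[OF that])
  ultimately show ?thesis unfolding vol using K(1) cK by (intro sum_pos2[where i = c]) auto
qed

section \<open>Uniqueness in the volume preserved conformal class\<close>

lemma conformal_pair_local:
  assumes G1: "complex_finsler M A (conformal_change M A f1 G)"
    and G2: "complex_finsler M A (conformal_change M A f2 G)"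
    and f: "smooth_function A f1" "smooth_function A f2" and c: "c \<in> A"
  shows "conformal_pair (chart_image c) (local_rep A (conformal_change M A f1 G) c)
    (local_rep A (conformal_change M A f2 G) c) (\<lambda>z. f2 (chart_inv c z) - f1 (chart_inv c z))"
proof (intro conformal_pair.intro conformal_pair_axioms.intro local_finsler_local_rep G1 G2 c)
  have "Cinf_on (chart_image c) (\<lambda>z. f2 (chart_inv c z))" "Cinf_on (chart_image c) (\<lambda>z. f1 (chart_inv c z))"
    using f c unfolding smooth_function_def by (simp_all add: o_def)
  from this(1) Cinf_on_bounded_linear[OF chart_image_open[OF c]
      bounded_linear_minus[OF bounded_linear_ident] this(2)]
  have "Cinf_on (chart_image c) (\<lambda>z. f2 (chart_inv c z) + - f1 (chart_inv c z))"
    unfolding Cinf_on_def by (intro allI Ck_on_add[OF chart_image_open[OF c]]) blast+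
  then show "Cinf_on (chart_image c) (\<lambda>z. f2 (chart_inv c z) - f1 (chart_inv c z))" by simp
  show "local_rep A (conformal_change M A f2 G) c (z, v) =
      exp (f2 (chart_inv c z) - f1 (chart_inv c z)) * local_rep A (conformal_change M A f1 G) c (z, v)"
    if "z \<in> chart_image c" for z and v :: "complex^'n"
    by (simp add: local_rep_conformal_change[OF c that] exp_diff)
qed

lemma locally_constant_imp_constant:
  assumes conn: "connected_space M"
    and h: "\<And>c z. c \<in> A \<Longrightarrow> z \<in> chart_image c \<Longrightarrow> ((\<lambda>z. h (chart_inv c z)) has_derivative (\<lambda>_. 0)) (at z)"
    and p: "p \<in> topspace M" and q: "q \<in> topspace M"
  shows "h q = (h p :: real)"
proof -
  have loc: "\<exists>T. openin M T \<and> x \<in> T \<and> (\<forall>y\<in>T. h y = h x)" if x: "x \<in> topspace M" for x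
  proof -
    obtain c where c: "c \<in> A" "x \<in> fst c" using chart_cover[OF x] by blast
    then obtain e where e: "0 < e" "ball (snd c x) e \<subseteq> chart_image c"
      using chart_image_open[OF c(1)] open_contains_ball by (metis imageI)
    have "\<exists>k. \<forall>z\<in>ball (snd c x) e. h (chart_inv c z) = k"
      by (rule has_derivative_zero_constant[OF convex_ball])
         (use e h[OF c(1)] in \<open>blast intro: has_derivative_at_withinI\<close>)
    then obtain k where k: "\<And>z. z \<in> ball (snd c x) e \<Longrightarrow> h (chart_inv c z) = k" by blast
    define T where "T = {y \<in> topspace (subtopology M (fst c)). snd c y \<in> ball (snd c x) e}"
    have "openin (subtopology M (fst c)) T" unfolding T_def
      by (rule openin_continuous_map_preimage[OF chart_continuous[OF c(1)]]) simp
    then have "openin M T" using openin_open_subtopology[OF chart_open[OF c(1)]] by blast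
    moreover have hT: "h y = k" if "y \<in> T" for y
      using k[of "snd c y"] that chart_topspace[OF c(1)] chart_inv_chart[OF c(1), of y]
          by (auto simp: T_def)
    moreover have "x \<in> T" using c chart_topspace[OF c(1)] e(1) by (simp add: T_def)
    ultimately show ?thesis by (metis)
  qed
  define L where "L = {x \<in> topspace M. h x = h p}"
  have L_open: "openin M L"
    unfolding openin_subopen[of M L]
  proof
    fix x assume "x \<in> L"
    then have x: "x \<in> topspace M" "h x = h p" by (auto simp: L_def)
    obtain T where T: "openin M T" "x \<in> T" "\<forall>y\<in>T. h y = h x" using loc[OF x(1)] by blast
    then show "\<exists>T. openin M T \<and> x \<in> T \<and> T \<subseteq> L" using x openin_subset[OF T(1)]
        by (intro exI[of _ T]) (auto simp: L_def)
  qed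
  have L_compl: "openin M (topspace M - L)"
    unfolding openin_subopen[of M "topspace M - L"]
  proof
    fix x assume "x \<in> topspace M - L"
    then have x: "x \<in> topspace M" "h x \<noteq> h p" by (auto simp: L_def)
    obtain T where T: "openin M T" "x \<in> T" "\<forall>y\<in>T. h y = h x" using loc[OF x(1)] by blast
    have "T \<subseteq> topspace M - L"
    proof
      fix y assume y: "y \<in> T"
      then have "y \<in> topspace M" using openin_subset[OF T(1)] by blast
      moreover have "y \<notin> L" using T(3) y x(2) unfolding L_def by simp
      ultimately show "y \<in> topspace M - L" by (rule DiffI)
    qed
    then show "\<exists>T. openin M T \<and> x \<in> T \<and> T \<subseteq> topspace M - L" using T(1,2) by blast
  qed
  have "L \<subseteq> topspace M" by (auto simp: L_def)
  then have L_closed: "closedin M L" unfolding closedin_def using L_compl by (rule conjI)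
  have "L = {} \<or> L = topspace M"
    by (rule conn[unfolded connected_space_clopen_in, rule_format, OF conjI[OF L_open L_closed]])
  then show ?thesis using p q by (auto simp: L_def)
qed

text \<open>The constant factor comes out of the integrals over the fibres and the charts. The existence of
  a partition guarantees that the chosen one consists of charts of the atlas.\<close>

lemma vol_scaling:
  assumes G1: "complex_finsler M A G1" and G2: "complex_finsler M A G2"
    and scale: "\<And>c z v. c \<in> A \<Longrightarrow> z \<in> chart_image c \<Longrightarrow> v \<noteq> 0 \<Longrightarrow> local_rep A G2 c (z, v) = exp k
        * local_rep A G1 c (z, v)"
    and part: "\<exists>K \<rho>. manifold_partition M A K \<rho>"
  shows "vol M A G2 = exp k ^ CARD('n) * vol M A G1"
proof -
  have "induced_volume A G2 c z = exp k ^ CARD('n) * induced_volume A G1 c z"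
      if c: "c \<in> A" and z: "z \<in> chart_image c" for c z
  proof -
    have "Cinf_on (chart_image c) (\<lambda>_::complex^'n. k)"
    proof -
      have "Ck_on m (chart_image c) (\<lambda>_::complex^'n. k)" for m and k :: real
        by (induction m arbitrary: k) (simp_all add: frechet_derivative_const)
      then show ?thesis by (simp add: Cinf_on_def)
    qed
    then interpret conformal_pair "chart_image c" "local_rep A G1 c" "local_rep A G2 c" "\<lambda>_. k"
      by (intro conformal_pair.intro conformal_pair_axioms.intro local_finsler_local_rep G1 G2 c scale)
    show ?thesis
      unfolding induced_volume_def proj_integral_def Let_def proj_density_scaling[OF refl z]
      by (simp add: sum_distrib_left mult.left_commute)
  qed
  note iv = this
  define K\<rho> where "K\<rho> = (SOME (K, \<rho>). manifold_partition M A K \<rho>)"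
  obtain K \<rho> where K\<rho>: "K\<rho> = (K, \<rho>)" by fastforce
  have "\<exists>x. case x of (K, \<rho>) \<Rightarrow> manifold_partition M A K \<rho>" using part by fast
  then have "case K\<rho> of (K, \<rho>) \<Rightarrow> manifold_partition M A K \<rho>" unfolding K\<rho>_def by (rule someI_ex)
  then have "manifold_partition M A K \<rho>" by (simp add: K\<rho>)
  then have "K \<subseteq> A" unfolding manifold_partition_def by blast
  have "set_lebesgue_integral lborel (chart_image c) (\<lambda>z. \<rho> c (chart_inv c z) * induced_volume A G2 c z) =
    exp k ^ CARD('n) * set_lebesgue_integral lborel (chart_image c) (\<lambda>z. \<rho> c (chart_inv c z)
        * induced_volume A G1 c z)" if "c \<in> K" for c
  proof -
    have "c \<in> A" using that \<open>K \<subseteq> A\<close> by blast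
    have "set_lebesgue_integral lborel (chart_image c) (\<lambda>z. \<rho> c (chart_inv c z) * induced_volume A G2 c z) =
      set_lebesgue_integral lborel (chart_image c) (\<lambda>z. exp k ^ CARD('n)
          * (\<rho> c (chart_inv c z) * induced_volume A G1 c z))"
      unfolding set_lebesgue_integral_def
      by (rule Bochner_Integration.integral_cong[OF refl]) (auto simp: indicator_def iv[OF \<open>c \<in> A\<close>])
    then show ?thesis by simp
  qed
  then show ?thesis
    unfolding vol_def manifold_integral_def K\<rho>_def[symmetric] K\<rho> by (simp add: sum_distrib_left)
qed

end

theorem theorem1p1:
  fixes M :: "'a topology"
    and A :: "('a, 'n::finite) chart set"
    and G :: "('a, 'n) tangent \<Rightarrow> real"
  assumes "complex_manifold M A"
    and "compact_space M"
    and "connected_space M"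
    and "CARD('n) \<ge> 2"
    and "complex_finsler M A G"
  shows "\<forall>G1 \<in> vp_conformal_class M A G. \<forall>G2 \<in> vp_conformal_class M A G.
           kaehler_finsler M A G1 \<and> kaehler_finsler M A G2 \<longrightarrow> G1 = G2"
proof (intro ballI impI, elim conjE)
  interpret charted_manifold M A by (rule charted_manifold.intro) fact
  fix G1 G2
  assume "G1 \<in> vp_conformal_class M A G" "G2 \<in> vp_conformal_class M A G"
    and K1: "kaehler_finsler M A G1" and K2: "kaehler_finsler M A G2"
  then obtain f1 f2 where G1: "G1 = conformal_change M A f1 G" "smooth_function A f1"
    and G2: "G2 = conformal_change M A f2 G" "smooth_function A f2"
    and vol: "vol M A G1 = vol M A G2"
    unfolding vp_conformal_class_def by auto
  have F1: "complex_finsler M A G1" and F2: "complex_finsler M A G2"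
    using K1 K2 unfolding kaehler_finsler_def by auto
  (* If M is empty, then so is its tangent bundle, and the metrics are restricted to it. *)
  show "G1 = G2"
  proof (cases "topspace M = {}")
    case True
    then have "tangent_bundle M A = {}" by (simp add: tangent_bundle_def)
    then show ?thesis by (simp add: G1 G2 conformal_change_def restrict_def)
  next
    case False
    then obtain p where p: "p \<in> topspace M" by blast
    define h where "h q = f2 q - f1 q" for q
    define k where "k = h p"
    have "((\<lambda>z. h (chart_inv c z)) has_derivative (\<lambda>_. 0)) (at z)"
        if c: "c \<in> A" and z: "z \<in> chart_image c" for c z
    proof -
      interpret conformal_pair "chart_image c" "local_rep A G1 c" "local_rep A G2 c" "\<lambda>z. h (chart_inv c z)"
        using conformal_pair_local[OF F1[unfolded G1] F2[unfolded G2] G1(2) G2(2) c]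
            by (simp add: G1 G2 h_def)
      show ?thesis
      proof (rule conformal_kaehler_derivative_zero[OF assms(4) z])
        fix x X assume x: "x \<in> chart_image c \<times> - {0 :: complex^'n}"
        show "d_H_omega_H (local_rep A G1 c) x X = 0" "d_H_omega_H (local_rep A G2 c) x X = 0"
          using K1 K2 c x unfolding kaehler_finsler_def by blast+
      qed
    qed
    from locally_constant_imp_constant[OF assms(3) this p] have h: "h q = k" if "q \<in> topspace M" for q
      using that by (simp add: k_def)
    have "local_rep A G2 c (z, v) = exp k * local_rep A G1 c (z, v)"
        if c: "c \<in> A" and z: "z \<in> chart_image c" for c z v
    proof -
      have "chart_inv c z \<in> topspace M" using chart_inv_in[OF z] chart_subset[OF c] by blast
      from h[OF this] have "f2 (chart_inv c z) = f1 (chart_inv c z) + k" by (simp add: h_def)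
      then show ?thesis by (simp add: G1 G2 local_rep_conformal_change[OF c z] exp_add)
    qed
    then have "vol M A G2 = exp k ^ CARD('n) * vol M A G1"
      using manifold_partition_exists[OF assms(2) Hausdorff, of A] chart_cover chart_open
          by (intro vol_scaling F1 F2) fast+
    then have "exp k ^ CARD('n) = 1" using vol vol_pos[OF assms(2) False F1] by simp
    then have "exp (real CARD('n) * k) = 1" by (simp add: exp_of_nat_mult)
    then have "k = 0" by simp
    then have "f1 q = f2 q" if "q \<in> topspace M" for q using h[OF that] by (simp add: h_def)
    then show ?thesis
      unfolding G1 G2 conformal_change_def by (intro restrict_ext) (auto simp: tangent_bundle_def)
  qed
qed

end
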